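(* Let $\Omega\subset\mathbb{R}^n$ be a bounded open set with piecewise $C^1$-boundary. Then there exist constants $\mathsf{A},\mathsf{B},C_j,\kappa,m,\sigma$ (with $m\ge 1$ an integer) such that, for any small enough $h>0$, there exist an open covering $\{\omega_j\}$ of $\Omega$, balls $\omega_j^*\subset\omega_j$, and a partition of unity $\{\phi_j\}$ subordinated to $\{\omega_j\}$ which, together with the local approximation spaces $\Psi_j$ of restrictions to $\omega_j$ of polynomials of degree $\le m$, satisfy Assumptions A--D for the given values of the parameters $\mathsf{A},\mathsf{B},C_j,\kappa,m,\sigma$, and $h$.
   Context: For real $s\ge 0$ and open $U\subset\mathbb{R}^n$, $H^s(U)$ is the space of restrictions to $U$ of elements of $H^s(\mathbb{R}^n)$ with the quotient (infimum) norm. The Assumptions, for parameters $\mathsf{A},\mathsf{B},\sigma>0$, $C_0,\dots,C_m$, integers $\kappa,m$, and $h>0$, concern: an open cover $\{\omega_j\}$ of $\Omega$ (by open subsets of $\mathbb{R}^n$), balls $\omega_j^*\subset\omega_j$, a partition of unity $\{\phi_j\}$ on $\Omega$ of Lipschitz functions with $\operatorname{supp}\phi_j\subset\omega_j$, and linear subspaces $\Psi_j\subset H^m(\omega_j)$. Put $d_j=\operatorname{diam}\omega_j$. Assumption A: the $\omega_j$ are convex with $d_j\le h\le 1$; $\omega_j^*$ is a ball of diameter $\ge\sigma h$ whose closure is contained in $\omega_j$; and $\omega_j^*\subset\Omega$ whenever $\phi_j$ is not identically zero on $\Omega$. Assumption B: no $\kappa+1$ of the sets $\omega_j$ have non-empty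 intersection, $\|\partial^\alpha\phi_j\|_{L^\infty(\Omega)}\le C_{|\alpha|}/d_j^{|\alpha|}$ for $|\alpha|\le m$, and $\phi_j=1$ on $\omega_j^*$. Assumption C: $\Psi_j$ contains all restrictions to $\omega_j$ of polynomials of degree $\le 1$, and $\|w\|_{H^l(\omega_j)}\le\mathsf{A}\|w\|_{H^l(\omega_j^* )}$ for all $j$, $w\in\Psi_j$, $0\le l\le m$. Assumption D: $\|w\|_{H^t(\omega_j)}\le\mathsf{B}\,d_j^{\,t-s}\|w\|_{H^s(\omega_j)}$ for all $j$, $w\in\Psi_j$, $0\le s\le t\le m$.
   Formalization: In Assumption D the factor d_j^{t-s} is corrected to d_j^{s-t} (as printed it fails for w=1, s=0, t=1 and small h); "piecewise C^1 boundary" is read as locally a finite union of C^1 cells with an inward direction, which excludes outward cusps, where the claim fails. *)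

theory Defs
  imports "HOL-Analysis.Analysis"
begin

section \<open>Iterated partial derivatives and test functions\<close>

definition partial_deriv :: "'n::finite \<Rightarrow> (real^'n \<Rightarrow> 'b::real_normed_vector) \<Rightarrow> real^'n \<Rightarrow> 'b" where
  "partial_deriv i f x = vector_derivative (\<lambda>t. f (x + t *\<^sub>R axis i 1)) (at 0)"

text \<open>A multi-index \<open>\<alpha>\<close> is represented by a list of coordinate indices in which \<open>i\<close> occurs
  \<open>\<alpha>\<^sub>i\<close> times, so that \<open>|\<alpha>|\<close> is the length of the list. Classical iterated partial derivatives
  are only taken of smooth functions, for which the order of the list is immaterial.\<close>

primrec iter_partial :: "'n::finite list \<Rightarrow> (real^'n \<Rightarrow> 'b::real_normed_vector) \<Rightarrow> real^'n \<Rightarrow> 'b" where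
  "iter_partial [] f = f"
| "iter_partial (i # \<alpha>) f = partial_deriv i (iter_partial \<alpha> f)"

definition smooth :: "(real^'n::finite \<Rightarrow> 'b::real_normed_vector) \<Rightarrow> bool" where
  "smooth f \<longleftrightarrow> (\<forall>\<alpha> x. iter_partial \<alpha> f differentiable (at x))"

definition test_function :: "(real^'n::finite) set \<Rightarrow> (real^'n \<Rightarrow> real) \<Rightarrow> bool" where
  "test_function U \<psi> \<longleftrightarrow>
     smooth \<psi> \<and> compact (closure {x. \<psi> x \<noteq> 0}) \<and> closure {x. \<psi> x \<noteq> 0} \<subseteq> U"

definition schwartz :: "(real^'n::finite \<Rightarrow> complex) \<Rightarrow> bool" where
  "schwartz f \<longleftrightarrow>
     smooth f \<and> (\<forall>\<alpha> (k::nat). bounded (range (\<lambda>x. norm x ^ k *\<^sub>R iter_partial \<alpha> f x)))"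

text \<open>\<open>g\<close> is the weak (distributional) derivative \<open>\<partial>\<^sup>\<alpha>u\<close> on the open set \<open>U\<close>.\<close>

definition weak_partial ::
    "(real^'n::finite) set \<Rightarrow> 'n list \<Rightarrow> (real^'n \<Rightarrow> real) \<Rightarrow> (real^'n \<Rightarrow> real) \<Rightarrow> bool" where
  "weak_partial U \<alpha> u g \<longleftrightarrow>
     (\<forall>K. compact K \<and> K \<subseteq> U \<longrightarrow> set_integrable lborel K u \<and> set_integrable lborel K g) \<and>
     (\<forall>\<psi>. test_function U \<psi> \<longrightarrow>
        (LINT x:U|lborel. u x * iter_partial \<alpha> \<psi> x) =
        (-1) ^ length \<alpha> * (LINT x:U|lborel. g x * \<psi> x))"

section \<open>Sobolev spaces of real order\<close>

definition fourier :: "(real^'n::finite \<Rightarrow> complex) \<Rightarrow> real^'n \<Rightarrow> complex" where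
  "fourier f \<xi> =
     of_real ((2 * pi) powr (- real CARD('n) / 2)) * (LINT x|lborel. cis (- (\<xi> \<bullet> x)) * f x)"

definition square_integrable :: "(real^'n::finite \<Rightarrow> complex) \<Rightarrow> bool" where
  "square_integrable u \<longleftrightarrow>
     u \<in> borel_measurable lborel \<and> integrable lborel (\<lambda>x. (cmod (u x))\<^sup>2)"

text \<open>The Fourier transform of an \<open>L\<^sup>2\<close> function, taken in the sense of tempered distributions
  (transposition against Schwartz functions). The transform \<open>v\<close> is unique up to null sets.\<close>

definition has_fourier :: "(real^'n::finite \<Rightarrow> complex) \<Rightarrow> (real^'n \<Rightarrow> complex) \<Rightarrow> bool" where
  "has_fourier u v \<longleftrightarrow> square_integrable u \<and> square_integrable v \<and>
     (\<forall>f. schwartz f \<longrightarrow> (LINT \<xi>|lborel. v \<xi> * f \<xi>) = (LINT x|lborel. u x * fourier f x))"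

definition sobolev_weight :: "real \<Rightarrow> (real^'n::finite \<Rightarrow> complex) \<Rightarrow> real^'n \<Rightarrow> real" where
  "sobolev_weight s v \<xi> = (1 + (norm \<xi>)\<^sup>2) powr s * (cmod (v \<xi>))\<^sup>2"

text \<open>\<open>H\<^sup>s(\<real>\<^sup>n)\<close> for \<open>s \<ge> 0\<close>; its elements are represented by (complex-valued) functions.\<close>

definition sobolev :: "real \<Rightarrow> (real^'n::finite \<Rightarrow> complex) set" where
  "sobolev s = {u. \<exists>v. has_fourier u v \<and> integrable lborel (sobolev_weight s v)}"

definition sobolev_norm :: "real \<Rightarrow> (real^'n::finite \<Rightarrow> complex) \<Rightarrow> real" where
  "sobolev_norm s u = sqrt (LINT \<xi>|lborel. sobolev_weight s (SOME v. has_fourier u v) \<xi>)"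

text \<open>\<open>H\<^sup>s(U)\<close> and its quotient norm: only the values of \<open>w\<close> on \<open>U\<close> (up to null sets) matter.
  The infimum is meaningful for \<open>w\<close> in \<open>sobolev_on s U\<close> only.\<close>

definition sobolev_extensions ::
    "real \<Rightarrow> (real^'n::finite) set \<Rightarrow> (real^'n \<Rightarrow> complex) \<Rightarrow> (real^'n \<Rightarrow> complex) set" where
  "sobolev_extensions s U w = {u \<in> sobolev s. AE x in lborel. x \<in> U \<longrightarrow> u x = w x}"

definition sobolev_on :: "real \<Rightarrow> (real^'n::finite) set \<Rightarrow> (real^'n \<Rightarrow> complex) set" where
  "sobolev_on s U = {w. sobolev_extensions s U w \<noteq> {}}"

definition sobolev_norm_on ::
    "real \<Rightarrow> (real^'n::finite) set \<Rightarrow> (real^'n \<Rightarrow> complex) \<Rightarrow> real" where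
  "sobolev_norm_on s U w = (INF u \<in> sobolev_extensions s U w. sobolev_norm s u)"

section \<open>Polynomials\<close>

definition polys :: "nat \<Rightarrow> (real^'n::finite \<Rightarrow> complex) set" where
  "polys k = {p. \<exists>a :: ('n \<Rightarrow> nat) \<Rightarrow> complex.
     p = (\<lambda>x. \<Sum>\<alpha> | (\<Sum>i\<in>UNIV. \<alpha> i) \<le> k. a \<alpha> * of_real (\<Prod>i\<in>UNIV. (x $ i) ^ \<alpha> i))}"

text \<open>A function on \<open>U\<close> is represented by its extension by zero.\<close>

definition restrict_to :: "(real^'n::finite) set \<Rightarrow> (real^'n \<Rightarrow> complex) \<Rightarrow> real^'n \<Rightarrow> complex" where
  "restrict_to U w x = (if x \<in> U then w x else 0)"

definition linear_subspace :: "(real^'n::finite \<Rightarrow> complex) set \<Rightarrow> bool" where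
  "linear_subspace W \<longleftrightarrow> (\<lambda>x. 0) \<in> W \<and>
     (\<forall>w\<in>W. \<forall>w'\<in>W. \<forall>a b. (\<lambda>x. a * w x + b * w' x) \<in> W)"

section \<open>Open sets with piecewise \<open>C\<^sup>1\<close> boundary\<close>

definition C1_with_gradient ::
    "(real^'n::finite) set \<Rightarrow> (real^'n \<Rightarrow> real) \<Rightarrow> (real^'n \<Rightarrow> real^'n) \<Rightarrow> bool" where
  "C1_with_gradient U f g \<longleftrightarrow>
     continuous_on U g \<and> (\<forall>y\<in>U. (f has_derivative (\<lambda>v. g y \<bullet> v)) (at y))"

text \<open>Near each boundary point \<open>x\<close> there are finitely many \<open>C\<^sup>1\<close> functions \<open>f 0, \<dots>, f (k - 1)\<close>
  vanishing at \<open>x\<close> such that \<open>\<Omega>\<close> is a union of cells, each cut out by strict inequalities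
  \<open>f i > 0\<close>. The existence of a direction \<open>v\<close> pointing strictly into every cell makes the \<open>f i\<close>
  involved have nonzero gradient, so that the boundary consists near \<open>x\<close> of pieces of \<open>C\<^sup>1\<close>
  hypersurfaces, and excludes cells with an outward cusp at \<open>x\<close>. \<open>C\<^sup>1\<close> domains (one function, one
  cell), polyhedra and curvilinear polyhedra, convex or not, are covered.\<close>

definition piecewise_C1_boundary :: "(real^'n::finite) set \<Rightarrow> bool" where
  "piecewise_C1_boundary \<Omega> \<longleftrightarrow>
     (\<forall>x \<in> frontier \<Omega>. \<exists>U (k::nat) f g (F :: nat set set).
        open U \<and> x \<in> U \<and>
        (\<forall>i<k. C1_with_gradient U (f i) (g i) \<and> f i x = 0) \<and>
        F \<subseteq> Pow {..<k} \<and>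
        \<Omega> \<inter> U = (\<Union>I\<in>F. {y \<in> U. \<forall>i\<in>I. f i y > 0}) \<and>
        (\<forall>I\<in>F. \<exists>v. \<forall>i\<in>I. g i x \<bullet> v > 0))"

section \<open>Covering data and the Assumptions\<close>

text \<open>The families are indexed by a set \<open>J\<close> of natural numbers. The function \<open>supp_sum\<close> is the sum
  over the indices at which the summand is nonzero; it is \<open>0\<close> if there are infinitely many of them.\<close>

definition covering_with_balls ::
    "(real^'n::finite) set \<Rightarrow> nat set \<Rightarrow> (nat \<Rightarrow> (real^'n) set) \<Rightarrow> (nat \<Rightarrow> (real^'n) set) \<Rightarrow> bool" where
  "covering_with_balls \<Omega> J \<omega> \<omega>s \<longleftrightarrow>
     (\<forall>j\<in>J. open (\<omega> j)) \<and> \<Omega> \<subseteq> (\<Union>j\<in>J. \<omega> j) \<and>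
     (\<forall>j\<in>J. (\<exists>c r. 0 < r \<and> \<omega>s j = ball c r) \<and> \<omega>s j \<subseteq> \<omega> j)"

definition lipschitz_partition_of_unity ::
    "(real^'n::finite) set \<Rightarrow> nat set \<Rightarrow> (nat \<Rightarrow> (real^'n) set) \<Rightarrow> (nat \<Rightarrow> real^'n \<Rightarrow> real) \<Rightarrow> bool" where
  "lipschitz_partition_of_unity \<Omega> J \<omega> \<phi> \<longleftrightarrow>
     (\<forall>j\<in>J. (\<exists>L. L-lipschitz_on UNIV (\<phi> j)) \<and> (\<forall>x. 0 \<le> \<phi> j x) \<and>
            closure {x. \<phi> j x \<noteq> 0} \<subseteq> \<omega> j) \<and>
     (\<forall>x\<in>\<Omega>. supp_sum (\<lambda>j. \<phi> j x) J = 1)"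

definition local_spaces ::
    "nat \<Rightarrow> nat set \<Rightarrow> (nat \<Rightarrow> (real^'n::finite) set) \<Rightarrow> (nat \<Rightarrow> (real^'n \<Rightarrow> complex) set) \<Rightarrow> bool" where
  "local_spaces m J \<omega> \<Psi> \<longleftrightarrow>
     (\<forall>j\<in>J. linear_subspace (\<Psi> j) \<and> \<Psi> j \<subseteq> sobolev_on (real m) (\<omega> j))"

definition assumption_A ::
    "real \<Rightarrow> real \<Rightarrow> (real^'n::finite) set \<Rightarrow> nat set \<Rightarrow> (nat \<Rightarrow> (real^'n) set) \<Rightarrow>
     (nat \<Rightarrow> (real^'n) set) \<Rightarrow> (nat \<Rightarrow> real^'n \<Rightarrow> real) \<Rightarrow> bool" where
  "assumption_A \<sigma> h \<Omega> J \<omega> \<omega>s \<phi> \<longleftrightarrow> h \<le> 1 \<and>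
     (\<forall>j\<in>J. convex (\<omega> j) \<and> bounded (\<omega> j) \<and> diameter (\<omega> j) \<le> h \<and>
            \<sigma> * h \<le> diameter (\<omega>s j) \<and> closure (\<omega>s j) \<subseteq> \<omega> j \<and>
            ((\<exists>x\<in>\<Omega>. \<phi> j x \<noteq> 0) \<longrightarrow> \<omega>s j \<subseteq> \<Omega>))"

definition assumption_B ::
    "nat \<Rightarrow> nat \<Rightarrow> (nat \<Rightarrow> real) \<Rightarrow> (real^'n::finite) set \<Rightarrow> nat set \<Rightarrow> (nat \<Rightarrow> (real^'n) set) \<Rightarrow>
     (nat \<Rightarrow> (real^'n) set) \<Rightarrow> (nat \<Rightarrow> real^'n \<Rightarrow> real) \<Rightarrow> bool" where
  "assumption_B \<kappa> m C \<Omega> J \<omega> \<omega>s \<phi> \<longleftrightarrow>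
     (\<forall>K. K \<subseteq> J \<and> card K = \<kappa> + 1 \<longrightarrow> (\<Inter>j\<in>K. \<omega> j) = {}) \<and>
     (\<forall>j\<in>J. \<forall>\<alpha>. length \<alpha> \<le> m \<longrightarrow>
        (\<exists>g. weak_partial \<Omega> \<alpha> (\<phi> j) g \<and>
             (AE x in lborel. x \<in> \<Omega> \<longrightarrow> \<bar>g x\<bar> \<le> C (length \<alpha>) / diameter (\<omega> j) ^ length \<alpha>))) \<and>
     (\<forall>j\<in>J. \<forall>x\<in>\<omega>s j. \<phi> j x = 1)"

definition assumption_C ::
    "nat \<Rightarrow> real \<Rightarrow> nat set \<Rightarrow> (nat \<Rightarrow> (real^'n::finite) set) \<Rightarrow> (nat \<Rightarrow> (real^'n) set) \<Rightarrow>
     (nat \<Rightarrow> (real^'n \<Rightarrow> complex) set) \<Rightarrow> bool" where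
  "assumption_C m A J \<omega> \<omega>s \<Psi> \<longleftrightarrow>
     (\<forall>j\<in>J. restrict_to (\<omega> j) ` polys 1 \<subseteq> \<Psi> j) \<and>
     (\<forall>j\<in>J. \<forall>w\<in>\<Psi> j. \<forall>l. 0 \<le> l \<and> l \<le> real m \<longrightarrow>
        sobolev_norm_on l (\<omega> j) w \<le> A * sobolev_norm_on l (\<omega>s j) w)"

text \<open>The inverse inequality. For \<open>s \<le> t\<close> and \<open>d\<^sub>j \<le> 1\<close> the stronger norm is bounded by the weaker
  one at the cost of the factor \<open>d\<^sub>j\<^bsup>s-t\<^esup> \<ge> 1\<close>. With the opposite sign of the exponent the inequality
  would fail already for \<open>w = 1\<close>, \<open>s = 0\<close>, \<open>t = 1\<close> and small \<open>d\<^sub>j\<close>, because the norms increase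
  with the order.\<close>

definition assumption_D ::
    "nat \<Rightarrow> real \<Rightarrow> nat set \<Rightarrow> (nat \<Rightarrow> (real^'n::finite) set) \<Rightarrow>
     (nat \<Rightarrow> (real^'n \<Rightarrow> complex) set) \<Rightarrow> bool" where
  "assumption_D m B J \<omega> \<Psi> \<longleftrightarrow>
     (\<forall>j\<in>J. \<forall>w\<in>\<Psi> j. \<forall>s t. 0 \<le> s \<and> s \<le> t \<and> t \<le> real m \<longrightarrow>
        sobolev_norm_on t (\<omega> j) w \<le>
          B * diameter (\<omega> j) powr (s - t) * sobolev_norm_on s (\<omega> j) w)"

end

theory Submission
  imports Defs "HOL-Probability.Probability"
begin

text \<open>The theorem is proved with \<open>m = 1\<close>, so that the local spaces consist of affine functions.

  Near its boundary, \<open>\<Omega>\<close> contains together with each point \<open>y\<close> of a cell a ball of radius comparable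
  to \<open>t\<close> at distance at most \<open>t\<close> from \<open>y\<close>: all the functions cutting out the cell increase in the
  directions close to the inward direction. By compactness this holds uniformly. The centres of the
  \<open>\<omega>\<^sub>j\<close> and \<open>\<omega>\<^sub>j\<^sup>*\<close> are a maximal \<open>\<beta>\<close>-separated set of points \<open>z\<close> with \<open>B(z, \<beta>) \<subseteq> \<Omega>\<close>, where \<open>\<beta>\<close> is a
  small multiple of \<open>h\<close>; comparing volumes bounds the overlap.

  Assumptions C and D both follow from the following statement. If \<open>u \<in> H\<^sup>s\<close> agrees with an affine function
  \<open>W\<close> on a ball of radius \<open>\<rho> h\<close>, there is \<open>u' \<in> H\<^sup>t\<close> which agrees with \<open>W\<close> on the concentric ball of radius
  \<open>h\<close> and satisfies \<open>\<parallel>u'\<parallel>\<^sub>t \<le> K h\<^bsup>s-t\<^esup> \<parallel>u\<parallel>\<^sub>s\<close> for \<open>0 \<le> s \<le> t \<le> 1\<close>. A direct comparison of the norms with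
  the coefficients of \<open>W\<close> is not possible, because for \<open>s \<ge> n / 2\<close> the norm of a constant on a ball of radius
  \<open>h\<close> does not scale like a power of \<open>h\<close> uniformly in \<open>s\<close>. Instead, let \<open>P\<close> be \<open>u\<close> smoothed at scale \<open>h\<close> by a
  Gaussian multiplier. Then \<open>P\<close> satisfies the required bound, it is Lipschitz with constant
  \<open>C h\<^bsup>s-1-n/2\<^esup> \<parallel>u\<parallel>\<^sub>s\<close>, and \<open>W - P\<close> is bounded by \<open>h\<^sup>s \<parallel>u\<parallel>\<^sub>s\<close> in \<open>L\<^sup>2\<close> of the small ball. Hence \<open>W - P\<close> and
  its Lipschitz constant are under control on the large ball, and \<open>u'\<close> is \<open>P\<close> plus \<open>W - P\<close> times a
  cutoff function.

  Of Fourier analysis only the inequality \<open>\<parallel>q^\<parallel> \<le> \<parallel>q\<parallel>\<close> for \<open>q \<in> L\<^sup>1 \<inter> L\<^sup>2\<close> is needed. It comes from inserting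
  a Gaussian factor and Fatou's lemma; no density theorem in \<open>L\<^sup>2\<close> enters, since \<open>u\<close> is continuous where
  its smoothings have to converge.\<close>

section \<open>Gaussian functions\<close>

text \<open>The theorem leaves \<open>m\<close> free, and \<open>m = 1\<close> removes two
  difficulties: only first weak derivatives of the partition functions occur, which everywhere
  differentiable Lipschitz functions have classically, and the coefficients of a polynomial in the
  local space can be read off from differences of its values. What remains hard is uniformity in the
  real orders \<open>s\<close> and \<open>t\<close>: one constant must serve the whole range.
  Estimates are therefore made on the weights in frequency space, where
  \<open>x powr p \<le> 1 + x\<close> treats all orders between 0 and 1 at once.

  The quotient norms are infima over extensions, so they are compared extension by extension: each
  competitor on the small set is turned into one on the large set.

  All lengths come from the constant \<open>e\<close> of the interior ball condition. With
  \<open>b = e * h / 8\<close> the sets are balls of radius \<open>h / 2\<close> and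
  \<open>b / 4\<close> with common centres: \<open>b / 4 = e / 32 * h\<close> is the inner radius in
  the norm estimate, its double gives \<open>\<sigma> = e / 16\<close>, and plateaus of radius
  \<open>b / 2\<close> around \<open>b\<close>-separated points do not overlap.\<close>

lemma
  fixes F :: "'a::euclidean_space \<Rightarrow> real \<Rightarrow> 'b::{real_normed_field,banach,second_countable_topology}"
  assumes int: "\<And>b. b \<in> Basis \<Longrightarrow> integrable lborel (F b)"
  shows integrable_prod_Basis: "integrable lborel (\<lambda>x::'a. \<Prod>b\<in>Basis. F b (x \<bullet> b))"
    and integral_prod_Basis: "(LINT x::'a|lborel. (\<Prod>b\<in>Basis. F b (x \<bullet> b))) = (\<Prod>b\<in>Basis. integral\<^sup>L lborel (F b))"
proof -
  interpret product_sigma_finite "\<lambda>_::'a. lborel :: real measure" ..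
  let ?P = "Pi\<^sub>M (Basis::'a set) (\<lambda>_. lborel :: real measure)"
  let ?T = "\<lambda>f. \<Sum>b\<in>(Basis::'a set). f b *\<^sub>R b"
  have T[measurable]: "?T \<in> ?P \<rightarrow>\<^sub>M borel" by measurable
  have meas: "F b \<in> borel_measurable borel" if "b \<in> Basis" for b
    using borel_measurable_integrable[OF int[OF that]] by simp
  have m[measurable]: "(\<lambda>x::'a. \<Prod>b\<in>Basis. F b (x \<bullet> b)) \<in> borel_measurable borel"
    by (intro borel_measurable_prod measurable_compose[OF _ meas]) auto
  have eq: "(\<Prod>b\<in>Basis. F b (?T f \<bullet> b)) = (\<Prod>b\<in>Basis. F b (f b))" for f
    by (intro prod.cong refl) (simp add: inner_sum_left inner_Basis if_distrib sum.delta' cong: if_cong)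
  show "integrable lborel (\<lambda>x::'a. \<Prod>b\<in>Basis. F b (x \<bullet> b))"
    by (subst lborel_eq, subst integrable_distr_eq[OF T m], subst eq)
       (intro product_integrable_prod finite_Basis int)
  show "(LINT x::'a|lborel. (\<Prod>b\<in>Basis. F b (x \<bullet> b))) = (\<Prod>b\<in>Basis. integral\<^sup>L lborel (F b))"
    by (subst lborel_eq, subst integral_distr[OF T m], subst eq)
       (intro product_integral_prod finite_Basis int)
qed

definition gauss :: "real \<Rightarrow> 'a::euclidean_space \<Rightarrow> real" where
  "gauss \<epsilon> x = exp (- (\<epsilon> / 2) * (norm x)\<^sup>2)"

text \<open>The density of the centred normal distribution with variance \<epsilon> in each
  coordinate. The factor \<open>\<epsilon> / 2\<close> in \<open>gauss\<close> is chosen so that the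
  Fourier integral of \<open>gauss \<epsilon>\<close> is \<open>heat \<epsilon>\<close> up to a
  power of \<open>2 * pi\<close>.\<close>

definition heat :: "real \<Rightarrow> 'a::euclidean_space \<Rightarrow> real" where
  "heat \<epsilon> x = (1 / sqrt (2 * pi * \<epsilon>)) ^ DIM('a) * gauss (1 / \<epsilon>) x"

lemma gauss_pos: "0 < gauss \<epsilon> x" and heat_nonneg: "0 < \<epsilon> \<Longrightarrow> 0 \<le> heat \<epsilon> x"
  by (auto simp: gauss_def heat_def)

lemma gauss_le_1: "0 \<le> \<epsilon> \<Longrightarrow> gauss \<epsilon> x \<le> 1"
  by (auto simp: gauss_def)

lemma gauss_measurable[measurable]: "gauss \<epsilon> \<in> borel_measurable borel"
  unfolding gauss_def[abs_def] by measurable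

lemma heat_measurable[measurable]: "heat \<epsilon> \<in> borel_measurable borel"
  unfolding heat_def[abs_def] by measurable

text \<open>Rescaling by \<open>c = sqrt \<epsilon>\<close> turns the integrand into the standard
  normal density times a character, so the value is that of the characteristic function of the
  standard normal distribution at \<open>z / c\<close>.\<close>

lemma
  fixes z :: real
  assumes "0 < \<epsilon>"
  shows integrable_gauss_real: "integrable lborel (\<lambda>t::real. cis (z * t) * of_real (exp (- (\<epsilon> / 2) * t\<^sup>2)))"
    and integral_gauss_real: "(LINT t|lborel. cis (z * t) * of_real (exp (- (\<epsilon> / 2) * t\<^sup>2))) = of_real (sqrt (2 * pi / \<epsilon>) * exp (- (z\<^sup>2) / (2 * \<epsilon>)))"
proof -
  define c where "c = sqrt \<epsilon>"
  have c: "c > 0" "c\<^sup>2 = \<epsilon>" using assms by (auto simp: c_def)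
  let ?g = "\<lambda>x. cis (z / c * x) * of_real (exp (- x\<^sup>2 / 2))"
  have eqd: "(\<lambda>x. std_normal_density x *\<^sub>R iexp (z / c * x)) = (\<lambda>x. of_real (1 / sqrt (2 * pi)) * ?g x)"
    by (auto simp: std_normal_density_def cis_conv_exp scaleR_conv_of_real)
  have id: "integrable lborel (\<lambda>x. std_normal_density x *\<^sub>R iexp (z / c * x))"
  proof (rule Bochner_Integration.integrable_bound[OF integrable_normal_density[of 1 0]])
    show "AE x in lborel. norm (std_normal_density x *\<^sub>R iexp (z / c * x)) \<le> norm (std_normal_density x)"
      by (simp add: norm_exp_i_times)
  qed auto
  have i1: "integrable lborel (\<lambda>x. of_real (1 / sqrt (2 * pi)) * ?g x)"
    using id unfolding eqd .
  have ig: "integrable lborel ?g"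
    using integrable_mult_right[OF i1, of "of_real (sqrt (2 * pi))"] by (simp add: mult.assoc[symmetric] flip: of_real_mult)
  have "complex_of_real (exp (- ((z / c)\<^sup>2) / 2)) = char std_normal_distribution (z / c)"
    by (simp add: char_std_normal_distribution)
  also have "\<dots> = (LINT x|lborel. std_normal_density x *\<^sub>R iexp (z / c * x))"
    unfolding char_def by (subst integral_density) (auto simp: normal_density_nonneg)
  also have "\<dots> = of_real (1 / sqrt (2 * pi)) * (LINT x|lborel. ?g x)"
    unfolding eqd by (rule integral_mult_right_zero)
  finally have Ig: "(LINT x|lborel. ?g x) = of_real (sqrt (2 * pi) * exp (- ((z / c)\<^sup>2) / 2))"
    by (simp add: field_simps)
  have g: "?g (0 + c * t) = cis (z * t) * of_real (exp (- (\<epsilon> / 2) * t\<^sup>2))" for t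
    using c by (simp add: power_mult_distrib)
  show "integrable lborel (\<lambda>t::real. cis (z * t) * of_real (exp (- (\<epsilon> / 2) * t\<^sup>2)))"
    using lborel_integrable_real_affine[OF ig, of c 0] c unfolding g by auto
  have "(LINT x|lborel. ?g x) = of_real c * (LINT t|lborel. cis (z * t) * of_real (exp (- (\<epsilon> / 2) * t\<^sup>2)))"
    using lborel_integral_real_affine[of c ?g 0] c unfolding g by (simp add: scaleR_conv_of_real)
  then have "(LINT t|lborel. cis (z * t) * of_real (exp (- (\<epsilon> / 2) * t\<^sup>2))) = of_real (sqrt (2 * pi) / c * exp (- ((z / c)\<^sup>2) / 2))"
    using Ig c by (simp add: field_simps)
  also have "sqrt (2 * pi) / c = sqrt (2 * pi / \<epsilon>)"
    using c_def by (simp add: real_sqrt_divide)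
  also have "- ((z / c)\<^sup>2) / 2 = - (z\<^sup>2) / (2 * \<epsilon>)"
    using c by (simp add: power_divide)
  finally show "(LINT t|lborel. cis (z * t) * of_real (exp (- (\<epsilon> / 2) * t\<^sup>2))) = of_real (sqrt (2 * pi / \<epsilon>) * exp (- (z\<^sup>2) / (2 * \<epsilon>)))" .
qed

lemma gauss_eq_prod: "gauss \<epsilon> x = (\<Prod>b\<in>Basis. exp (- (\<epsilon> / 2) * (x \<bullet> b)\<^sup>2))"
proof -
  have "(norm x)\<^sup>2 = (\<Sum>b\<in>Basis. (x \<bullet> b)\<^sup>2)"
    unfolding power2_norm_eq_inner euclidean_inner[of x x] by (simp add: power2_eq_square)
  then show ?thesis
    unfolding gauss_def by (simp only: sum_distrib_left exp_sum finite_Basis)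
qed

lemma cis_sum: "finite A \<Longrightarrow> cis (\<Sum>b\<in>A. f b) = (\<Prod>b\<in>A. cis (f b))"
  by (induction A rule: finite_induct) (auto simp: cis_mult[symmetric])

text \<open>Both factors split over the coordinates, the character into characters and the Gaussian
  into Gaussians. Each coordinate contributes one factor \<open>2 * pi\<close> of the
  constant.\<close>

lemma
  fixes z :: "'a::euclidean_space"
  assumes "0 < \<epsilon>"
  shows integrable_cis_gauss: "integrable lborel (\<lambda>x. cis (z \<bullet> x) * of_real (gauss \<epsilon> x))"
    and integral_cis_gauss: "(LINT x|lborel. cis (z \<bullet> x) * of_real (gauss \<epsilon> x)) = of_real ((2 * pi) ^ DIM('a) * heat \<epsilon> z)"
proof -
  let ?F = "\<lambda>(b::'a) t. cis ((z \<bullet> b) * t) * of_real (exp (- (\<epsilon> / 2) * t\<^sup>2))"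
  have eq: "(\<lambda>x. cis (z \<bullet> x) * of_real (gauss \<epsilon> x)) = (\<lambda>x. \<Prod>b\<in>Basis. ?F b (x \<bullet> b))"
    unfolding gauss_eq_prod by (subst euclidean_inner) (auto simp: cis_sum prod.distrib)
  show "integrable lborel (\<lambda>x. cis (z \<bullet> x) * of_real (gauss \<epsilon> x))"
    unfolding eq by (rule integrable_prod_Basis) (rule integrable_gauss_real[OF assms])
  have *: "2 * pi * (1 / sqrt (2 * pi * \<epsilon>)) = sqrt (2 * pi / \<epsilon>)"
    using assms by (simp add: real_sqrt_divide real_sqrt_mult field_simps)
  have "(LINT x|lborel. cis (z \<bullet> x) * of_real (gauss \<epsilon> x)) = (\<Prod>b\<in>(Basis::'a set). of_real (sqrt (2 * pi / \<epsilon>) * exp (- ((z \<bullet> b)\<^sup>2) / (2 * \<epsilon>))))"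
    unfolding eq integral_prod_Basis[OF integrable_gauss_real[OF assms]] integral_gauss_real[OF assms] ..
  also have "\<dots> = of_real (sqrt (2 * pi / \<epsilon>) ^ DIM('a) * gauss (1 / \<epsilon>) z)"
    unfolding gauss_eq_prod by (simp add: prod.distrib mult.commute)
  also have "sqrt (2 * pi / \<epsilon>) ^ DIM('a) * gauss (1 / \<epsilon>) z = (2 * pi) ^ DIM('a) * heat \<epsilon> z"
    unfolding heat_def *[symmetric] power_mult_distrib by simp
  finally show "(LINT x|lborel. cis (z \<bullet> x) * of_real (gauss \<epsilon> x)) = of_real ((2 * pi) ^ DIM('a) * heat \<epsilon> z)" .
qed

lemma
  assumes "0 < \<epsilon>"
  shows integrable_gauss: "integrable lborel (gauss \<epsilon> :: 'a::euclidean_space \<Rightarrow> real)"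
    and integral_gauss: "integral\<^sup>L lborel (gauss \<epsilon> :: 'a \<Rightarrow> real) = sqrt (2 * pi / \<epsilon>) ^ DIM('a)"
proof -
  have i: "integrable lborel (\<lambda>x::'a. complex_of_real (gauss \<epsilon> x))"
    using integrable_cis_gauss[OF assms, of 0] by simp
  then show "integrable lborel (gauss \<epsilon> :: 'a \<Rightarrow> real)"
    unfolding complex_of_real_integrable_eq .
  have *: "2 * pi * (1 / sqrt (2 * pi * \<epsilon>)) = sqrt (2 * pi / \<epsilon>)"
    using assms by (simp add: real_sqrt_divide real_sqrt_mult field_simps)
  have "complex_of_real (integral\<^sup>L lborel (gauss \<epsilon> :: 'a \<Rightarrow> real)) = of_real ((2 * pi) ^ DIM('a) * heat \<epsilon> (0::'a))"
    using integral_cis_gauss[OF assms, of "0::'a"] by simp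
  also have "(2 * pi) ^ DIM('a) * heat \<epsilon> (0::'a) = sqrt (2 * pi / \<epsilon>) ^ DIM('a)"
    unfolding heat_def *[symmetric] power_mult_distrib by (simp add: gauss_def)
  finally show "integral\<^sup>L lborel (gauss \<epsilon> :: 'a \<Rightarrow> real) = sqrt (2 * pi / \<epsilon>) ^ DIM('a)"
    by (simp only: of_real_eq_iff)
qed

lemma
  assumes "0 < \<epsilon>"
  shows integrable_heat: "integrable lborel (heat \<epsilon> :: 'a::euclidean_space \<Rightarrow> real)"
    and integral_heat: "integral\<^sup>L lborel (heat \<epsilon> :: 'a \<Rightarrow> real) = 1"
proof -
  show "integrable lborel (heat \<epsilon> :: 'a \<Rightarrow> real)"
    unfolding heat_def[abs_def] using assms by (intro integrable_mult_right integrable_gauss) auto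
  show "integral\<^sup>L lborel (heat \<epsilon> :: 'a \<Rightarrow> real) = 1"
    unfolding heat_def[abs_def] using assms
    by (simp add: integral_gauss power_mult_distrib[symmetric] real_sqrt_mult)
qed

lemma heat_minus: "heat \<epsilon> (x - y) = heat \<epsilon> (y - x)"
  by (simp add: heat_def gauss_def norm_minus_commute)

section \<open>Fourier integrals and the Bessel inequality\<close>

lemma integral_affine_euclidean:
  fixes f :: "'a::euclidean_space \<Rightarrow> 'b::{banach, second_countable_topology}"
  assumes "c \<noteq> 0" and [measurable]: "f \<in> borel_measurable borel"
  shows "integral\<^sup>L lborel f = \<bar>c\<bar> ^ DIM('a) *\<^sub>R (LINT x|lborel. f (t + c *\<^sub>R x))"
  by (subst lborel_affine[OF assms(1), of t]) (simp add: integral_density integral_distr)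

lemma nn_integral_translate:
  fixes f :: "'a::euclidean_space \<Rightarrow> ennreal"
  assumes [measurable]: "f \<in> borel_measurable borel"
  shows "(\<integral>\<^sup>+x. f (x + t) \<partial>lborel) = (\<integral>\<^sup>+x. f x \<partial>lborel)"
  by (subst (2) lborel_distr_plus[of t, symmetric]) (simp add: nn_integral_distr add.commute)

lemma
  fixes f :: "'a::euclidean_space \<Rightarrow> 'b::{banach, second_countable_topology}"
  shows integrable_translate: "integrable lborel f \<Longrightarrow> integrable lborel (\<lambda>x. f (x + t))"
    and integral_translate: "f \<in> borel_measurable borel \<Longrightarrow> (LINT x|lborel. f (x + t)) = integral\<^sup>L lborel f"
proof -
  assume f: "integrable lborel f"
  then have [measurable]: "f \<in> borel_measurable borel" by simp
  from f have "integrable (distr lborel borel ((+) t)) f"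
    by (simp add: lborel_distr_plus)
  then show "integrable lborel (\<lambda>x. f (x + t))"
    by (simp add: integrable_distr_eq add.commute)
next
  assume "f \<in> borel_measurable borel"
  then show "(LINT x|lborel. f (x + t)) = integral\<^sup>L lborel f"
    by (subst (2) lborel_distr_plus[of t, symmetric]) (simp add: integral_distr add.commute)
qed

lemma norm_mult_le_squares:
  fixes a b :: "'a::real_normed_algebra"
  shows "norm (a * b) \<le> (norm a)\<^sup>2 + (norm b)\<^sup>2"
proof -
  have "0 \<le> (norm a - norm b)\<^sup>2 + (norm a)\<^sup>2 + (norm b)\<^sup>2" by simp
  then show ?thesis
    using norm_mult_ineq[of a b] by (simp add: power2_eq_square algebra_simps)
qed

lemma integrable_mult_square_integrable:
  fixes f g :: "'a \<Rightarrow> complex"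
  assumes "f \<in> borel_measurable M" "g \<in> borel_measurable M"
    "integrable M (\<lambda>x. (norm (f x))\<^sup>2)" "integrable M (\<lambda>x. (norm (g x))\<^sup>2)"
  shows "integrable M (\<lambda>x. f x * g x)"
  by (rule Bochner_Integration.integrable_bound[OF Bochner_Integration.integrable_add[OF assms(3,4)]])
     (use assms norm_mult_le_squares in \<open>auto intro!: AE_I2\<close>)

text \<open>The Fourier integral without normalisation, with the sign of the exponent as a
  parameter: \<open>c = -1\<close> is the transform and \<open>c = 1\<close> its inverse. Every
  estimate for \<open>\<bar>c\<bar> = 1\<close> thus serves both directions.\<close>

definition ft :: "real \<Rightarrow> ('a::euclidean_space \<Rightarrow> complex) \<Rightarrow> 'a \<Rightarrow> complex" where
  "ft c q x = (LINT \<xi>|lborel. cis (c * (\<xi> \<bullet> x)) * q \<xi>)"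

lemma cis_measurable[measurable]: "cis \<in> borel_measurable borel"
  by (intro borel_measurable_continuous_onI continuous_intros)

lemma integrable_cis_mult:
  assumes "integrable lborel q" and [measurable]: "f \<in> borel_measurable borel"
  shows "integrable lborel (\<lambda>x. cis (f x) * q x)"
  by (rule Bochner_Integration.integrable_bound[OF assms(1)])
     (use assms in \<open>auto simp: norm_mult\<close>)

lemma ft_measurable[measurable]:
  assumes [measurable]: "q \<in> borel_measurable borel"
  shows "ft c q \<in> borel_measurable borel"
  unfolding ft_def[abs_def] by measurable

lemma norm_ft_le:
  assumes "integrable lborel q"
  shows "norm (ft c q x) \<le> (LINT \<xi>|lborel. norm (q \<xi>))"
proof -
  have "norm (ft c q x) \<le> (LINT \<xi>|lborel. norm (cis (c * (\<xi> \<bullet> x)) * q \<xi>))"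
    unfolding ft_def by (rule integral_norm_bound)
  then show ?thesis by (simp add: norm_mult)
qed

lemma integrable_ft_mult:
  assumes a: "integrable lborel a" and b: "integrable lborel b"
  shows "integrable lborel (\<lambda>x. ft c a x * b x)"
proof -
  have [measurable]: "a \<in> borel_measurable borel" "b \<in> borel_measurable borel"
    using a b by auto
  show ?thesis
  proof (rule Bochner_Integration.integrable_bound)
    show "integrable lborel (\<lambda>x. (LINT \<xi>|lborel. norm (a \<xi>)) * norm (b x))"
      using b by simp
    show "AE x in lborel. norm (ft c a x * b x) \<le> norm ((LINT \<xi>|lborel. norm (a \<xi>)) * norm (b x))"
      using norm_ft_le[OF a, of c] by (auto simp: norm_mult intro!: AE_I2 mult_right_mono)
  qed measurable
qed

text \<open>Fubini's theorem for the kernel \<open>cis (c * (\<xi> \<bullet> x))\<close>, which is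
  symmetric in the two variables. The inversion, Parseval and Bessel statements below are derived
  from this multiplication formula.\<close>

lemma integral_ft_mult:
  assumes a: "integrable lborel a" and b: "integrable lborel b"
  shows "(LINT x|lborel. ft c a x * b x) = (LINT \<xi>|lborel. a \<xi> * ft c b \<xi>)"
proof -
  have [measurable]: "a \<in> borel_measurable borel" "b \<in> borel_measurable borel"
    using a b by auto
  let ?f = "\<lambda>(x, \<xi>). cis (c * (\<xi> \<bullet> x)) * a \<xi> * b x"
  have int: "integrable (lborel \<Otimes>\<^sub>M lborel) ?f"
  proof (rule lborel_pair.Fubini_integrable)
    show "?f \<in> borel_measurable (lborel \<Otimes>\<^sub>M lborel)" by measurable
    show "integrable lborel (\<lambda>x. LINT y|lborel. norm (?f (x, y)))"
      using a b by (simp add: norm_mult)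
    show "AE x in lborel. integrable lborel (\<lambda>y. ?f (x, y))"
      using a by (auto intro!: AE_I2 integrable_cis_mult)
  qed
  have "(LINT x|lborel. ft c a x * b x) = (LINT x|lborel. LINT \<xi>|lborel. ?f (x, \<xi>))"
    by (simp add: ft_def)
  also have "\<dots> = (LINT \<xi>|lborel. LINT x|lborel. ?f (x, \<xi>))"
    using lborel_pair.Fubini_integral[of "\<lambda>x \<xi>. ?f (x, \<xi>)"] int by simp
  also have "\<dots> = (LINT \<xi>|lborel. a \<xi> * ft c b \<xi>)"
    unfolding ft_def by (simp flip: integral_mult_right_zero) (simp add: mult_ac inner_commute)
  finally show ?thesis .
qed

text \<open>Inversion regularised by a Gaussian: the multiplication formula moves the transform onto
  the modulated Gaussian, where it is explicit, and leaves \<open>q\<close> averaged with the heat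
  kernel around \<xi>.\<close>

lemma ft_ft_gauss:
  fixes q :: "'a::euclidean_space \<Rightarrow> complex"
  assumes q: "integrable lborel q" and "0 < \<epsilon>" and c: "\<bar>c\<bar> = 1"
  shows "ft (- c) (\<lambda>x. ft c q x * of_real (gauss \<epsilon> x)) \<xi> =
    of_real ((2 * pi) ^ DIM('a)) * (LINT \<eta>|lborel. q \<eta> * of_real (heat \<epsilon> (\<eta> - \<xi>)))"
proof -
  let ?b = "\<lambda>x. cis (- c * (x \<bullet> \<xi>)) * complex_of_real (gauss \<epsilon> x)"
  have b: "integrable lborel ?b"
    using integrable_cis_gauss[OF \<open>0 < \<epsilon>\<close>, of "- c *\<^sub>R \<xi>"] by (simp add: inner_commute)
  have fb: "ft c ?b \<eta> = of_real ((2 * pi) ^ DIM('a) * heat \<epsilon> (\<eta> - \<xi>))" for \<eta>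
  proof -
    have "ft c ?b \<eta> = (LINT x|lborel. cis ((c *\<^sub>R (\<eta> - \<xi>)) \<bullet> x) * of_real (gauss \<epsilon> x))"
      unfolding ft_def
      by (intro Bochner_Integration.integral_cong refl)
         (simp add: cis_mult mult.assoc[symmetric], simp add: algebra_simps inner_commute)
    also have "\<dots> = of_real ((2 * pi) ^ DIM('a) * heat \<epsilon> (c *\<^sub>R (\<eta> - \<xi>)))"
      by (rule integral_cis_gauss[OF \<open>0 < \<epsilon>\<close>])
    finally show ?thesis using c by (simp add: heat_def gauss_def)
  qed
  have "ft (- c) (\<lambda>x. ft c q x * of_real (gauss \<epsilon> x)) \<xi> = (LINT x|lborel. ft c q x * ?b x)"
    unfolding ft_def[of "- c"] by (simp add: mult_ac)
  also have "\<dots> = (LINT \<eta>|lborel. q \<eta> * ft c ?b \<eta>)"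
    by (rule integral_ft_mult[OF q b])
  finally show ?thesis
    unfolding fb by (simp add: mult_ac flip: integral_mult_right_zero)
qed

lemma nn_integral_heat:
  fixes \<xi> :: "'a::euclidean_space"
  assumes "0 < \<epsilon>"
  shows "(\<integral>\<^sup>+\<eta>. ennreal (heat \<epsilon> (\<eta> - \<xi>)) \<partial>lborel) = 1" "(\<integral>\<^sup>+\<eta>. ennreal (heat \<epsilon> (\<xi> - \<eta>)) \<partial>lborel) = 1"
proof -
  have "(\<integral>\<^sup>+\<eta>. ennreal (heat \<epsilon> (\<eta> - \<xi>)) \<partial>lborel) = integral\<^sup>N lborel (\<lambda>\<eta>::'a. ennreal (heat \<epsilon> \<eta>))"
    using nn_integral_translate[of "\<lambda>x::'a. ennreal (heat \<epsilon> x)" "- \<xi>"] by simp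
  also have "\<dots> = 1"
    using assms by (subst nn_integral_eq_integral) (auto simp: integral_heat heat_nonneg intro: integrable_heat)
  finally show "(\<integral>\<^sup>+\<eta>. ennreal (heat \<epsilon> (\<eta> - \<xi>)) \<partial>lborel) = 1" .
  then show "(\<integral>\<^sup>+\<eta>. ennreal (heat \<epsilon> (\<xi> - \<eta>)) \<partial>lborel) = 1"
    by (simp add: heat_minus)
qed

text \<open>Schur's test for the heat kernel: the product
  \<open>norm (q \<xi>) * norm (q \<eta>)\<close> is at most half the sum of the squares, and the
  kernel has integral 1 in either variable.\<close>

lemma heat_form_le:
  fixes q :: "'a::euclidean_space \<Rightarrow> complex"
  assumes [measurable]: "q \<in> borel_measurable borel" and e: "0 < \<epsilon>"
  shows "(\<integral>\<^sup>+\<xi>. (\<integral>\<^sup>+\<eta>. ennreal (norm (q \<xi>) * norm (q \<eta>) * heat \<epsilon> (\<eta> - \<xi>)) \<partial>lborel) \<partial>lborel)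
    \<le> (\<integral>\<^sup>+\<xi>. ennreal ((norm (q \<xi>))\<^sup>2) \<partial>lborel)" (is "?L \<le> ?R")
proof -
  let ?h = "\<lambda>\<xi> \<eta>. ennreal (heat \<epsilon> (\<eta> - \<xi>))"
  let ?g = "\<lambda>\<xi>. ennreal ((norm (q \<xi>))\<^sup>2 / 2)"
  have "?L \<le> (\<integral>\<^sup>+\<xi>. (\<integral>\<^sup>+\<eta>. ?g \<xi> * ?h \<xi> \<eta> + ?g \<eta> * ?h \<xi> \<eta> \<partial>lborel) \<partial>lborel)"
  proof (intro nn_integral_mono)
    fix \<xi> \<eta> :: 'a
    have "0 \<le> (norm (q \<xi>) - norm (q \<eta>))\<^sup>2" by simp
    then have "norm (q \<xi>) * norm (q \<eta>) \<le> (norm (q \<xi>))\<^sup>2 / 2 + (norm (q \<eta>))\<^sup>2 / 2"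
      by (simp add: power2_eq_square field_simps)
    then have "norm (q \<xi>) * norm (q \<eta>) * heat \<epsilon> (\<eta> - \<xi>) \<le> ((norm (q \<xi>))\<^sup>2 / 2 + (norm (q \<eta>))\<^sup>2 / 2) * heat \<epsilon> (\<eta> - \<xi>)"
      by (rule mult_right_mono) (rule heat_nonneg[OF e])
    then show "ennreal (norm (q \<xi>) * norm (q \<eta>) * heat \<epsilon> (\<eta> - \<xi>)) \<le> ?g \<xi> * ?h \<xi> \<eta> + ?g \<eta> * ?h \<xi> \<eta>"
      using heat_nonneg[OF e, of "\<eta> - \<xi>"]
      by (simp add: ennreal_mult[symmetric] ennreal_plus[symmetric] ring_distribs del: ennreal_plus)
  qed
  also have "\<dots> = (\<integral>\<^sup>+\<xi>. (\<integral>\<^sup>+\<eta>. ?g \<xi> * ?h \<xi> \<eta> \<partial>lborel) \<partial>lborel) + (\<integral>\<^sup>+\<xi>. (\<integral>\<^sup>+\<eta>. ?g \<eta> * ?h \<xi> \<eta> \<partial>lborel) \<partial>lborel)"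
    by (simp add: nn_integral_add)
  also have "(\<integral>\<^sup>+\<xi>. (\<integral>\<^sup>+\<eta>. ?g \<eta> * ?h \<xi> \<eta> \<partial>lborel) \<partial>lborel) = (\<integral>\<^sup>+\<eta>. (\<integral>\<^sup>+\<xi>. ?g \<eta> * ?h \<xi> \<eta> \<partial>lborel) \<partial>lborel)"
    by (rule lborel_pair.Fubini') measurable
  also have "\<dots> = (\<integral>\<^sup>+\<eta>. ?g \<eta> \<partial>lborel)"
    by (simp add: nn_integral_cmult nn_integral_heat e)
  also have "(\<integral>\<^sup>+\<xi>. (\<integral>\<^sup>+\<eta>. ?g \<xi> * ?h \<xi> \<eta> \<partial>lborel) \<partial>lborel) = (\<integral>\<^sup>+\<eta>. ?g \<eta> \<partial>lborel)"
    by (simp add: nn_integral_cmult nn_integral_heat e)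
  also have "(\<integral>\<^sup>+\<eta>. ?g \<eta> \<partial>lborel) + (\<integral>\<^sup>+\<eta>. ?g \<eta> \<partial>lborel) = ?R"
    by (subst nn_integral_add[symmetric]) (auto intro!: nn_integral_cong simp: ennreal_plus[symmetric] simp del: ennreal_plus)
  finally show ?thesis .
qed

lemma cnj_ft: "cnj (ft c q x) = ft (- c) (\<lambda>\<xi>. cnj (q \<xi>)) x"
proof -
  have "cnj (ft c q x) = (LINT \<xi>|lborel. cnj (cis (c * (\<xi> \<bullet> x)) * q \<xi>))"
    unfolding ft_def by (rule Bochner_Integration.integral_cnj[symmetric])
  then show ?thesis by (simp only: ft_def complex_cnj_mult cis_cnj mult_minus_left)
qed

lemma real_le_if_of_real_eq:
  assumes "complex_of_real a = of_real b * z" "0 \<le> b"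
  shows "a \<le> b * norm z"
proof -
  have "norm (complex_of_real a) = b * norm z"
    unfolding assms(1) using assms(2) by (simp add: norm_mult)
  then show ?thesis by simp
qed

text \<open>The integrand is the conjugate of \<open>ft c q\<close> times the product of
  \<open>ft c q\<close> with the Gaussian. Moving the first transform across the integral leaves the
  quadratic form of the heat kernel in \<open>q\<close>, up to the factor
  \<open>(2 * pi) ^ DIM('a)\<close>.\<close>

lemma bessel_gauss:
  fixes q :: "'a::euclidean_space \<Rightarrow> complex"
  assumes q: "integrable lborel q" and e: "0 < \<epsilon>" and c: "\<bar>c\<bar> = 1"
  shows "(\<integral>\<^sup>+x. ennreal ((norm (ft c q x))\<^sup>2 * gauss \<epsilon> x) \<partial>lborel)
    \<le> ennreal ((2 * pi) ^ DIM('a)) * (\<integral>\<^sup>+\<xi>. ennreal ((norm (q \<xi>))\<^sup>2) \<partial>lborel)"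
proof -
  have [measurable]: "q \<in> borel_measurable borel" using q by auto
  let ?G = "\<lambda>x. complex_of_real (gauss \<epsilon> x)" and ?\<pi> = "(2 * pi) ^ DIM('a)"
  have G: "integrable lborel (\<lambda>x. ft c q x * ?G x)"
    by (rule integrable_ft_mult[OF q]) (simp add: complex_of_real_integrable_eq integrable_gauss e)
  have q': "integrable lborel (\<lambda>\<xi>. cnj (q \<xi>))" using q by simp
  have eq: "ft (- c) (\<lambda>\<xi>. cnj (q \<xi>)) x * (ft c q x * ?G x) = of_real ((norm (ft c q x))\<^sup>2 * gauss \<epsilon> x)" for x
    unfolding cnj_ft[symmetric]
    by (simp add: complex_norm_square mult.commute mult.left_commute flip: of_real_power)
  have int: "integrable lborel (\<lambda>x. (norm (ft c q x))\<^sup>2 * gauss \<epsilon> x)"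
    using integrable_ft_mult[OF q' G, of "- c"] unfolding eq complex_of_real_integrable_eq .
  let ?K = "\<lambda>\<xi>. (LINT \<eta>|lborel. q \<eta> * of_real (heat \<epsilon> (\<eta> - \<xi>)))"
  have "of_real (LINT x|lborel. (norm (ft c q x))\<^sup>2 * gauss \<epsilon> x) = (LINT x|lborel. ft (- c) (\<lambda>\<xi>. cnj (q \<xi>)) x * (ft c q x * ?G x))"
    unfolding eq integral_complex_of_real ..
  also have "\<dots> = (LINT \<xi>|lborel. cnj (q \<xi>) * (of_real ?\<pi> * ?K \<xi>))"
    by (subst integral_ft_mult[OF q' G]) (simp add: ft_ft_gauss[OF q e c])
  also have "\<dots> = of_real ?\<pi> * (LINT \<xi>|lborel. cnj (q \<xi>) * ?K \<xi>)"
    by (simp add: mult_ac flip: integral_mult_right_zero)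
  finally have "(LINT x|lborel. (norm (ft c q x))\<^sup>2 * gauss \<epsilon> x) \<le> ?\<pi> * norm (LINT \<xi>|lborel. cnj (q \<xi>) * ?K \<xi>)"
    by (rule real_le_if_of_real_eq) simp
  then have *: "(\<integral>\<^sup>+x. ennreal ((norm (ft c q x))\<^sup>2 * gauss \<epsilon> x) \<partial>lborel) \<le> ennreal ?\<pi> * ennreal (norm (LINT \<xi>|lborel. cnj (q \<xi>) * ?K \<xi>))"
    by (subst nn_integral_eq_integral[OF int])
       (auto simp: gauss_pos less_imp_le ennreal_mult[symmetric] intro!: ennreal_leI)
  have "ennreal (norm (LINT \<xi>|lborel. cnj (q \<xi>) * ?K \<xi>)) \<le> (\<integral>\<^sup>+\<xi>. ennreal (norm (cnj (q \<xi>) * ?K \<xi>)) \<partial>lborel)"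
  proof (rule integral_norm_bound_ennreal)
    have "integrable lborel (\<lambda>\<xi>. ft (- c) (\<lambda>x. ft c q x * ?G x) \<xi> * cnj (q \<xi>))"
      by (rule integrable_ft_mult[OF G q'])
    then have "integrable lborel (\<lambda>\<xi>. of_real ?\<pi> * (cnj (q \<xi>) * ?K \<xi>))"
      unfolding ft_ft_gauss[OF q e c] by (simp add: mult_ac)
    from integrable_mult_right[OF this, of "of_real (1 / ?\<pi>)"]
    show "integrable lborel (\<lambda>\<xi>. cnj (q \<xi>) * ?K \<xi>)"
      by (simp flip: mult.assoc of_real_mult)
  qed
  also have "\<dots> \<le> (\<integral>\<^sup>+\<xi>. (\<integral>\<^sup>+\<eta>. ennreal (norm (q \<xi>) * norm (q \<eta>) * heat \<epsilon> (\<eta> - \<xi>)) \<partial>lborel) \<partial>lborel)"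
  proof (rule nn_integral_mono)
    fix \<xi>
    have i: "integrable lborel (\<lambda>\<eta>. q \<eta> * of_real (heat \<epsilon> (\<eta> - \<xi>)))"
    proof (rule Bochner_Integration.integrable_bound)
      show "integrable lborel (\<lambda>\<eta>. (1 / sqrt (2 * pi * \<epsilon>)) ^ DIM('a) * norm (q \<eta>))"
        using q by simp
      show "AE x in lborel. norm (q x * complex_of_real (heat \<epsilon> (x - \<xi>))) \<le> norm ((1 / sqrt (2 * pi * \<epsilon>)) ^ DIM('a) * norm (q x))"
      proof (rule AE_I2)
        fix x
        have "heat \<epsilon> (x - \<xi>) \<le> (1 / sqrt (2 * pi * \<epsilon>)) ^ DIM('a) * 1"
          unfolding heat_def using e by (intro mult_left_mono gauss_le_1) auto
        then show "norm (q x * complex_of_real (heat \<epsilon> (x - \<xi>))) \<le> norm ((1 / sqrt (2 * pi * \<epsilon>)) ^ DIM('a) * norm (q x))"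
          using heat_nonneg[OF e, of "x - \<xi>"] e
          by (simp add: norm_mult abs_mult mult.commute[of "norm (q x)"] mult_right_mono)
      qed
    qed measurable
    have "ennreal (norm (cnj (q \<xi>) * ?K \<xi>)) = ennreal (norm (q \<xi>)) * ennreal (norm (?K \<xi>))"
      by (simp add: norm_mult ennreal_mult)
    also have "\<dots> \<le> ennreal (norm (q \<xi>)) * (\<integral>\<^sup>+\<eta>. ennreal (norm (q \<eta> * of_real (heat \<epsilon> (\<eta> - \<xi>)))) \<partial>lborel)"
      by (intro mult_left_mono integral_norm_bound_ennreal i) auto
    also have "\<dots> = (\<integral>\<^sup>+\<eta>. ennreal (norm (q \<xi>) * norm (q \<eta>) * heat \<epsilon> (\<eta> - \<xi>)) \<partial>lborel)"
      by (subst nn_integral_cmult[symmetric]) (auto simp: heat_nonneg[OF e] norm_mult ennreal_mult mult_ac intro!: nn_integral_cong)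
    finally show "ennreal (norm (cnj (q \<xi>) * ?K \<xi>)) \<le> (\<integral>\<^sup>+\<eta>. ennreal (norm (q \<xi>) * norm (q \<eta>) * heat \<epsilon> (\<eta> - \<xi>)) \<partial>lborel)" .
  qed
  also have "\<dots> \<le> (\<integral>\<^sup>+\<xi>. ennreal ((norm (q \<xi>))\<^sup>2) \<partial>lborel)"
    by (rule heat_form_le[OF _ e]) measurable
  finally show ?thesis
    using * by (blast intro: order_trans mult_left_mono zero_le)
qed

lemma tendsto_gauss: "(e \<longlongrightarrow> 0) F \<Longrightarrow> ((\<lambda>k. gauss (e k) x) \<longlongrightarrow> 1) F"
  unfolding gauss_def by (auto intro!: tendsto_eq_intros)

text \<open>The integrals are taken in \<open>ennreal\<close>, so that the inequality has a meaning
  for every integrable \<open>q\<close>; if \<open>q\<close> is not square integrable, the right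
  side is infinite.\<close>

lemma bessel:
  fixes q :: "'a::euclidean_space \<Rightarrow> complex"
  assumes q: "integrable lborel q" and c: "\<bar>c\<bar> = 1"
  shows "(\<integral>\<^sup>+x. ennreal ((norm (ft c q x))\<^sup>2) \<partial>lborel)
    \<le> ennreal ((2 * pi) ^ DIM('a)) * (\<integral>\<^sup>+\<xi>. ennreal ((norm (q \<xi>))\<^sup>2) \<partial>lborel)" (is "_ \<le> ?R")
proof -
  have [measurable]: "q \<in> borel_measurable borel" using q by auto
  let ?e = "\<lambda>k::nat. 1 / real (Suc k)"
  have lim: "(\<lambda>k. ennreal ((norm (ft c q x))\<^sup>2 * gauss (?e k) x)) \<longlonglongrightarrow> ennreal ((norm (ft c q x))\<^sup>2 * 1)" for x
    by (rule tendsto_ennrealI, rule tendsto_mult[OF tendsto_const], rule tendsto_gauss, rule LIMSEQ_Suc[OF lim_1_over_n])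
  have "(\<integral>\<^sup>+x. ennreal ((norm (ft c q x))\<^sup>2) \<partial>lborel) = (\<integral>\<^sup>+x. liminf (\<lambda>k. ennreal ((norm (ft c q x))\<^sup>2 * gauss (?e k) x)) \<partial>lborel)"
    using lim_imp_Liminf[OF _ lim] by simp
  also have "\<dots> \<le> liminf (\<lambda>k. \<integral>\<^sup>+x. ennreal ((norm (ft c q x))\<^sup>2 * gauss (?e k) x) \<partial>lborel)"
    by (rule nn_integral_liminf) measurable
  also have "\<dots> \<le> ?R"
    by (intro Liminf_le always_eventually allI bessel_gauss[OF q _ c]) auto
  finally show ?thesis .
qed

text \<open>The substitution \<open>\<eta> = \<xi> + sqrt (e k) *\<^sub>R z\<close> freezes the
  kernel at the parameter 1 and moves the dependence on \<open>k\<close> into the argument of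
  \<open>f\<close>, so that dominated convergence applies with the majorant
  \<open>C * heat 1 z\<close>.\<close>

lemma heat_tendsto:
  fixes f :: "'a::euclidean_space \<Rightarrow> complex"
  assumes [measurable]: "f \<in> borel_measurable borel" and bnd: "\<And>x. norm (f x) \<le> C" and cont: "isCont f \<xi>"
    and e: "\<And>k::nat. 0 < e k" "e \<longlonglongrightarrow> 0"
  shows "(\<lambda>k. LINT \<eta>|lborel. f \<eta> * of_real (heat (e k) (\<eta> - \<xi>))) \<longlonglongrightarrow> f \<xi>"
proof -
  have eq: "(LINT \<eta>|lborel. f \<eta> * of_real (heat (e k) (\<eta> - \<xi>))) = (LINT z|lborel. f (\<xi> + sqrt (e k) *\<^sub>R z) * of_real (heat 1 z))" for k
  proof -
    let ?s = "sqrt (e k)"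
    have s: "?s > 0" using e by simp
    have h: "\<bar>?s\<bar> ^ DIM('a) * heat (e k) (?s *\<^sub>R z) = heat 1 z" for z :: 'a
      using e(1)[of k] s by (simp add: heat_def gauss_def power_mult_distrib real_sqrt_mult mult.assoc[symmetric] power_divide)
    have "(LINT \<eta>|lborel. f \<eta> * of_real (heat (e k) (\<eta> - \<xi>))) = \<bar>?s\<bar> ^ DIM('a) *\<^sub>R (LINT z|lborel. f (\<xi> + ?s *\<^sub>R z) * of_real (heat (e k) (?s *\<^sub>R z)))"
      using s by (subst integral_affine_euclidean[of ?s _ \<xi>]) auto
    also have "\<dots> = (LINT z|lborel. f (\<xi> + ?s *\<^sub>R z) * of_real (\<bar>?s\<bar> ^ DIM('a) * heat (e k) (?s *\<^sub>R z)))"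
      by (simp add: scaleR_conv_of_real mult_ac flip: integral_mult_right_zero)
    finally show ?thesis unfolding h .
  qed
  have "(\<lambda>k. LINT z|lborel. f (\<xi> + sqrt (e k) *\<^sub>R z) * of_real (heat 1 z)) \<longlonglongrightarrow> (LINT z|lborel. f \<xi> * of_real (heat 1 (z::'a)))"
  proof (rule integral_dominated_convergence)
    show "integrable lborel (\<lambda>z::'a. C * heat 1 z)"
      by (intro integrable_mult_right integrable_heat) simp
    show "AE z in lborel. norm (f (\<xi> + sqrt (e k) *\<^sub>R z) * complex_of_real (heat 1 z)) \<le> C * heat 1 z" for k
      using bnd by (auto simp: norm_mult heat_nonneg intro!: AE_I2 mult_right_mono)
    show "AE z in lborel. (\<lambda>k. f (\<xi> + sqrt (e k) *\<^sub>R z) * complex_of_real (heat 1 z)) \<longlonglongrightarrow> f \<xi> * complex_of_real (heat 1 z)"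
    proof (rule AE_I2)
      fix z :: 'a
      have "(\<lambda>k. \<xi> + sqrt (e k) *\<^sub>R z) \<longlonglongrightarrow> \<xi> + sqrt 0 *\<^sub>R z"
        by (intro tendsto_intros e)
      then have "(\<lambda>k. f (\<xi> + sqrt (e k) *\<^sub>R z)) \<longlonglongrightarrow> f \<xi>"
        using isCont_tendsto_compose[OF cont] by simp
      then show "(\<lambda>k. f (\<xi> + sqrt (e k) *\<^sub>R z) * complex_of_real (heat 1 z)) \<longlonglongrightarrow> f \<xi> * complex_of_real (heat 1 z)"
        by (intro tendsto_intros)
    qed
  qed measurable
  also have "(LINT z|lborel. f \<xi> * complex_of_real (heat 1 (z::'a))) = f \<xi>"
    using integral_heat[of 1, where 'a='a] by simp
  finally show ?thesis unfolding eq .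
qed

section \<open>Schwartz functions and injectivity of the Fourier integral\<close>

text \<open>Polynomials times one fixed modulated Gaussian, generated as a closure instead of
  through explicit polynomials: stability under partial derivatives and rapid decay are then one
  induction each. Being Schwartz functions, these Gaussians are admissible test functions in
  \<open>has_fourier\<close>.\<close>

inductive modulated_gauss_class :: "real \<Rightarrow> real^'n::finite \<Rightarrow> (real^'n \<Rightarrow> complex) \<Rightarrow> bool" for \<epsilon> z where
  base: "modulated_gauss_class \<epsilon> z (\<lambda>x. cis (z \<bullet> x) * of_real (gauss \<epsilon> x))"
| add: "modulated_gauss_class \<epsilon> z f \<Longrightarrow> modulated_gauss_class \<epsilon> z g \<Longrightarrow> modulated_gauss_class \<epsilon> z (\<lambda>x. f x + g x)"
| scale: "modulated_gauss_class \<epsilon> z f \<Longrightarrow> modulated_gauss_class \<epsilon> z (\<lambda>x. c * f x)"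
| coord: "modulated_gauss_class \<epsilon> z f \<Longrightarrow> modulated_gauss_class \<epsilon> z (\<lambda>x. of_real (x $ i) * f x)"

lemma modulated_gauss_class_derivative:
  assumes "modulated_gauss_class \<epsilon> z f"
  shows "\<exists>f'. (\<forall>x. (f has_derivative f' x) (at x)) \<and> (\<forall>i. modulated_gauss_class \<epsilon> z (\<lambda>x. f' x (axis i 1)))"
  using assms
proof induction
  case base
  let ?f = "\<lambda>x. cis (z \<bullet> x) * complex_of_real (gauss \<epsilon> x)"
  let ?f' = "\<lambda>x v. (\<i> * of_real (z \<bullet> v) - of_real (\<epsilon> * (x \<bullet> v))) * ?f x"
  have "(?f has_derivative ?f' x) (at x)" for x
    unfolding gauss_def power2_norm_eq_inner
    by (rule derivative_eq_intros refl | simp)+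
       (auto simp: fun_eq_iff scaleR_conv_of_real algebra_simps inner_commute)
  moreover have "modulated_gauss_class \<epsilon> z (\<lambda>x. ?f' x (axis i 1))" for i
  proof -
    have "modulated_gauss_class \<epsilon> z (\<lambda>x. (\<i> * of_real (z $ i)) * ?f x + (- of_real \<epsilon>) * (of_real (x $ i) * ?f x))"
      by (intro modulated_gauss_class.intros)
    then show ?thesis by (simp add: inner_axis algebra_simps)
  qed
  ultimately show ?case by (intro exI[of _ ?f']) blast
next
  case (add f g)
  then obtain f' g' where "\<And>x. (f has_derivative f' x) (at x)" "\<And>i. modulated_gauss_class \<epsilon> z (\<lambda>x. f' x (axis i 1))"
    "\<And>x. (g has_derivative g' x) (at x)" "\<And>i. modulated_gauss_class \<epsilon> z (\<lambda>x. g' x (axis i 1))" by metis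
  then show ?case
    by (intro exI[of _ "\<lambda>x v. f' x v + g' x v"]) (auto intro!: derivative_intros modulated_gauss_class.intros)
next
  case (scale f c)
  then obtain f' where "\<And>x. (f has_derivative f' x) (at x)" "\<And>i. modulated_gauss_class \<epsilon> z (\<lambda>x. f' x (axis i 1))" by metis
  then show ?case
    by (intro exI[of _ "\<lambda>x v. c * f' x v"]) (auto intro!: derivative_intros modulated_gauss_class.intros)
next
  case (coord f i)
  then obtain f' where f': "\<And>x. (f has_derivative f' x) (at x)" "\<And>i. modulated_gauss_class \<epsilon> z (\<lambda>x. f' x (axis i 1))" by metis
  let ?g' = "\<lambda>x v. of_real (v $ i) * f x + of_real (x $ i) * f' x v"
  have "((\<lambda>x. complex_of_real (x $ i)) has_derivative (\<lambda>v. of_real (v $ i))) (at x)" for x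
    by (intro bounded_linear_imp_has_derivative bounded_linear_compose[OF bounded_linear_of_real] bounded_linear_vec_nth)
  then have "((\<lambda>x. complex_of_real (x $ i) * f x) has_derivative ?g' x) (at x)" for x
    using has_derivative_mult[OF _ f'(1)] by (fastforce simp: add.commute)
  moreover have "modulated_gauss_class \<epsilon> z (\<lambda>x. ?g' x (axis j 1))" for j
    by (intro modulated_gauss_class.intros f' coord)
  ultimately show ?case by (intro exI[of _ ?g']) blast
qed

lemma partial_deriv_eq:
  assumes "(f has_derivative f') (at x)"
  shows "partial_deriv i f x = f' (axis i 1)"
proof -
  have "((\<lambda>t. x + t *\<^sub>R axis i 1) has_derivative (\<lambda>t. t *\<^sub>R axis i 1)) (at 0)"
    by (auto intro!: derivative_eq_intros)
  from has_derivative_compose[OF this, of f f'] assms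
  have "((\<lambda>t. f (x + t *\<^sub>R axis i 1)) has_derivative (\<lambda>t. f' (t *\<^sub>R axis i 1))) (at 0)" by simp
  then have "((\<lambda>t. f (x + t *\<^sub>R axis i 1)) has_vector_derivative f' (axis i 1)) (at 0)"
    unfolding has_vector_derivative_def using has_derivative_bounded_linear[OF assms]
    by (simp add: linear_simps)
  then show ?thesis unfolding partial_deriv_def by (rule vector_derivative_at)
qed

lemma iter_partial_modulated_gauss:
  "modulated_gauss_class \<epsilon> z f \<Longrightarrow> modulated_gauss_class \<epsilon> z (iter_partial \<alpha> f)"
proof (induction \<alpha>)
  case (Cons i \<alpha>)
  then obtain f' where f': "\<And>x. (iter_partial \<alpha> f has_derivative f' x) (at x)"
    "\<And>i. modulated_gauss_class \<epsilon> z (\<lambda>x. f' x (axis i 1))"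
    using modulated_gauss_class_derivative by metis
  have "iter_partial (i # \<alpha>) f = (\<lambda>x. f' x (axis i 1))"
    using partial_deriv_eq[OF f'(1)] by auto
  then show ?case using f' by simp
qed auto

text \<open>With \<open>y = \<epsilon> / 2 * (norm x)\<^sup>2\<close> a single term of the
  exponential series gives \<open>y ^ k \<le> fact k * exp y\<close>. This controls the power
  \<open>2 * k\<close> of the norm, and \<open>a \<le> 1 + a\<^sup>2\<close> brings it down to the
  power \<open>k\<close>.\<close>

lemma power_mult_gauss_bounded:
  assumes "0 < \<epsilon>"
  shows "norm x ^ k * gauss \<epsilon> x \<le> 1 + fact k * (2 / \<epsilon>) ^ k"
proof -
  let ?y = "\<epsilon> / 2 * (norm x)\<^sup>2"
  have y: "?y \<ge> 0" using assms by simp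
  have "?y ^ k / fact k \<le> (\<Sum>j\<in>{k}. ?y ^ j /\<^sub>R fact j)" by (simp add: field_simps)
  also have "\<dots> \<le> (\<Sum>j. ?y ^ j /\<^sub>R fact j)"
    by (rule sum_le_suminf[OF summable_exp_generic]) (use y in auto)
  finally have "?y ^ k / fact k \<le> exp ?y" unfolding exp_def .
  then have "?y ^ k \<le> fact k * exp ?y" by (simp add: field_simps)
  then have "?y ^ k * gauss \<epsilon> x \<le> fact k"
    unfolding gauss_def by (simp add: exp_minus field_simps)
  then have "(2 / \<epsilon>) ^ k * (?y ^ k * gauss \<epsilon> x) \<le> (2 / \<epsilon>) ^ k * fact k"
    using assms by (intro mult_left_mono) auto
  also have "(2 / \<epsilon>) ^ k * (?y ^ k * gauss \<epsilon> x) = (norm x ^ k)\<^sup>2 * gauss \<epsilon> x"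
    using assms by (simp add: power_mult_distrib[symmetric] mult.assoc[symmetric] flip: power_mult) (simp add: mult.commute)
  finally have *: "(norm x ^ k)\<^sup>2 * gauss \<epsilon> x \<le> (2 / \<epsilon>) ^ k * fact k" .
  have "norm x ^ k \<le> 1 + (norm x ^ k)\<^sup>2"
  proof -
    have "0 \<le> norm x ^ k" by simp
    moreover have "0 \<le> (norm x ^ k)\<^sup>2 - 2 * norm x ^ k * 1 + 1\<^sup>2"
      using zero_le_power2[of "norm x ^ k - 1"] unfolding power2_diff by simp
    ultimately show ?thesis unfolding power_one mult_1_right by linarith
  qed
  then have "norm x ^ k * gauss \<epsilon> x \<le> (1 + (norm x ^ k)\<^sup>2) * gauss \<epsilon> x"
    by (intro mult_right_mono) (auto simp: gauss_pos less_imp_le)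
  also have "\<dots> \<le> 1 + fact k * (2 / \<epsilon>) ^ k"
    using * gauss_le_1[of \<epsilon> x] assms by (simp add: ring_distribs mult.commute)
  finally show ?thesis .
qed

lemma modulated_gauss_class_decay:
  assumes "modulated_gauss_class \<epsilon> z f" and "0 < \<epsilon>"
  shows "\<exists>C. \<forall>x. norm x ^ k * norm (f x) \<le> C"
  using assms(1)
\<comment> \<open>The exponent is generalised because multiplication by a coordinate uses the
  hypothesis at \<open>Suc k\<close>.\<close>
proof (induction arbitrary: k)
  case base
  show ?case using power_mult_gauss_bounded[OF assms(2)]
    by (intro exI[of _ "1 + fact k * (2 / \<epsilon>) ^ k"]) (auto simp: norm_mult gauss_pos less_imp_le)
next
  case (add f g)
  obtain C D where *: "\<And>x. norm x ^ k * norm (f x) \<le> C" "\<And>x. norm x ^ k * norm (g x) \<le> D"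
    using add by metis
  have "norm x ^ k * norm (f x + g x) \<le> C + D" for x
    using mult_left_mono[OF norm_triangle_ineq[of "f x" "g x"], of "norm x ^ k"] *[of x] by (simp add: ring_distribs)
  then show ?case by blast
next
  case (scale f c)
  obtain C where *: "\<And>x. norm x ^ k * norm (f x) \<le> C" using scale by metis
  have "norm x ^ k * norm (c * f x) \<le> norm c * C" for x
    using mult_left_mono[OF *[of x], of "norm c"] by (simp add: norm_mult mult_ac)
  then show ?case by blast
next
  case (coord f i)
  obtain C where *: "\<And>x. norm x ^ Suc k * norm (f x) \<le> C" using coord by metis
  have "norm x ^ k * norm (of_real (x $ i) * f x) \<le> C" for x
  proof -
    have "\<bar>x $ i\<bar> * (norm x ^ k * norm (f x)) \<le> norm x * (norm x ^ k * norm (f x))"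
      by (intro mult_right_mono component_le_norm_cart) auto
    then show ?thesis using *[of x] by (simp add: norm_mult mult_ac)
  qed
  then show ?case by blast
qed

lemma schwartz_modulated_gauss:
  assumes "0 < \<epsilon>"
  shows "schwartz (\<lambda>x::real^'n::finite. cis (z \<bullet> x) * of_real (gauss \<epsilon> x))"
proof -
  let ?f = "\<lambda>x::real^'n. cis (z \<bullet> x) * complex_of_real (gauss \<epsilon> x)"
  have c: "modulated_gauss_class \<epsilon> z (iter_partial \<alpha> ?f)" for \<alpha>
    by (intro iter_partial_modulated_gauss modulated_gauss_class.base)
  have "smooth ?f"
    unfolding smooth_def differentiable_def using modulated_gauss_class_derivative[OF c] by blast
  moreover have "bounded (range (\<lambda>x. norm x ^ k *\<^sub>R iter_partial \<alpha> ?f x))" for \<alpha> k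
    using modulated_gauss_class_decay[OF c assms, of k] unfolding bounded_iff by auto
  ultimately show ?thesis unfolding schwartz_def by blast
qed

section \<open>Integrability of Schwartz functions, the Parseval pairing and injectivity\<close>

lemma integrable_inverse_polynomial: "integrable lborel (\<lambda>t::real. inverse (1 + t\<^sup>2))"
  using integrable_inverse_1_plus_square unfolding set_integrable_def by simp

text \<open>The majorant is a product of one-dimensional functions
  \<open>inverse (1 + t\<^sup>2)\<close>, whose integral factorises. Two decay exponents suffice:
  twice the dimension for large arguments and 0 for bounded ones.\<close>

lemma integrable_rapid_decay:
  fixes f :: "real^'n::finite \<Rightarrow> complex"
  assumes [measurable]: "f \<in> borel_measurable borel" and "\<And>k. \<exists>C. \<forall>x. norm x ^ k * norm (f x) \<le> C"
  shows "integrable lborel f"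
proof -
  let ?n = "CARD('n)"
  obtain C D where C: "\<And>x. norm x ^ (2 * ?n) * norm (f x) \<le> C" and D: "\<And>x. norm x ^ 0 * norm (f x) \<le> D"
    using assms(2) by metis
  let ?w = "\<lambda>x::real^'n. \<Prod>b\<in>Basis. inverse (1 + (x \<bullet> b)\<^sup>2)"
  have i: "integrable lborel ?w"
    by (rule integrable_prod_Basis) (rule integrable_inverse_polynomial)
  have "norm (f x) \<le> 2 ^ ?n * (C + D) * ?w x" for x
  proof -
    have pos: "0 < (\<Prod>b\<in>Basis. 1 + (x \<bullet> b)\<^sup>2)"
      by (intro prod_pos) (auto intro: add_pos_nonneg)
    have "(\<Prod>b\<in>Basis. 1 + (x \<bullet> b)\<^sup>2) \<le> (\<Prod>b\<in>(Basis::(real^'n) set). 1 + (norm x)\<^sup>2)"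
    proof (intro prod_mono conjI)
      fix b :: "real^'n" assume "b \<in> Basis"
      then have "\<bar>x \<bullet> b\<bar> \<le> norm x" by (rule Basis_le_norm)
      then show "1 + (x \<bullet> b)\<^sup>2 \<le> 1 + (norm x)\<^sup>2" using abs_le_square_iff[of "x \<bullet> b" "norm x"] by simp
    qed (auto intro: add_nonneg_nonneg)
    also have "\<dots> = (1 + (norm x)\<^sup>2) ^ ?n" by simp
    also have "\<dots> \<le> (2 * max 1 ((norm x)\<^sup>2)) ^ ?n" by (intro power_mono) auto
    also have "\<dots> = 2 ^ ?n * (max 1 ((norm x)\<^sup>2)) ^ ?n" by (simp add: power_mult_distrib)
    also have "(max 1 ((norm x)\<^sup>2)) ^ ?n \<le> 1 + norm x ^ (2 * ?n)"
      by (auto simp: max_def power_mult)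
    finally have "(\<Prod>b\<in>Basis. 1 + (x \<bullet> b)\<^sup>2) * norm (f x) \<le> 2 ^ ?n * (1 + norm x ^ (2 * ?n)) * norm (f x)"
      by (auto intro: mult_right_mono)
    also have "\<dots> = 2 ^ ?n * ((1 + norm x ^ (2 * ?n)) * norm (f x))" by simp
    also have "\<dots> \<le> 2 ^ ?n * (C + D)"
      using C[of x] D[of x] by (intro mult_left_mono) (auto simp: ring_distribs)
    finally show ?thesis
      using pos unfolding prod_inversef[of "\<lambda>b. 1 + (x \<bullet> b)\<^sup>2" Basis, unfolded o_def]
      by (simp add: field_simps)
  qed
  then show ?thesis
    by (intro Bochner_Integration.integrable_bound[OF integrable_mult_right[OF i, of "2 ^ ?n * (C + D)"]])
       (auto intro!: AE_I2 intro: order_trans[OF _ abs_ge_self])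
qed

lemma schwartzD:
  assumes "schwartz f"
  shows schwartz_isCont: "isCont f x" and schwartz_bounded: "\<exists>C. \<forall>x. norm (f x) \<le> C"
    and schwartz_measurable: "f \<in> borel_measurable borel" and schwartz_integrable: "integrable lborel f"
    and schwartz_integrable_square: "integrable lborel (\<lambda>x. (norm (f x))\<^sup>2)"
proof -
  have "f differentiable (at x)" for x
    using assms unfolding schwartz_def smooth_def by (metis iter_partial.simps(1))
  then show c: "isCont f x" for x by (rule differentiable_imp_continuous_within)
  then show m[measurable]: "f \<in> borel_measurable borel"
    by (intro borel_measurable_continuous_onI) (simp add: continuous_at_imp_continuous_on)
  have *: "\<exists>C. \<forall>x. norm x ^ k * norm (f x) \<le> C" for k
  proof -
    have "bounded (range (\<lambda>x. norm x ^ k *\<^sub>R iter_partial [] f x))"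
      using assms unfolding schwartz_def by blast
    then show ?thesis unfolding bounded_iff by auto
  qed
  from *[of 0] show b: "\<exists>C. \<forall>x. norm (f x) \<le> C" by simp
  show i: "integrable lborel f" by (rule integrable_rapid_decay[OF m *])
  obtain C where C: "\<And>x. norm (f x) \<le> C" using b by metis
  show "integrable lborel (\<lambda>x. (norm (f x))\<^sup>2)"
    by (rule Bochner_Integration.integrable_bound[OF integrable_mult_right[OF integrable_norm[OF i], of C]])
       (use C in \<open>auto simp: power2_eq_square intro!: AE_I2 mult_right_mono intro: order_trans[OF _ abs_ge_self]\<close>)
qed

lemma integrable_ft_square:
  fixes q :: "'a::euclidean_space \<Rightarrow> complex"
  assumes q: "integrable lborel q" and q2: "integrable lborel (\<lambda>x. (norm (q x))\<^sup>2)" and c: "\<bar>c\<bar> = 1"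
  shows "integrable lborel (\<lambda>x. (norm (ft c q x))\<^sup>2)"
proof (rule integrableI_bounded)
  have [measurable]: "q \<in> borel_measurable borel" using q by auto
  show "(\<lambda>x. (norm (ft c q x))\<^sup>2) \<in> borel_measurable lborel" by measurable
  have "(\<integral>\<^sup>+x. ennreal (norm ((norm (ft c q x))\<^sup>2)) \<partial>lborel) \<le> ennreal ((2 * pi) ^ DIM('a)) * (\<integral>\<^sup>+\<xi>. ennreal ((norm (q \<xi>))\<^sup>2) \<partial>lborel)"
    using bessel[OF q c] by simp
  also have "\<dots> < \<infinity>"
    using q2 by (simp add: integrable_iff_bounded ennreal_mult_less_top)
  finally show "(\<integral>\<^sup>+x. ennreal (norm ((norm (ft c q x))\<^sup>2)) \<partial>lborel) < \<infinity>" .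
qed

text \<open>Parseval's identity in bilinear form. With a Gaussian factor on the right it is the
  regularised inversion of \<open>f\<close>. That factor is then removed by dominated convergence:
  on the right both transforms are square integrable by Bessel's inequality, on the left the heat
  averages of \<open>f\<close> converge pointwise and are bounded by \<open>C\<close>, while
  \<open>q\<close> is integrable.\<close>

lemma ft_pairing:
  fixes q f :: "'a::euclidean_space \<Rightarrow> complex"
  assumes q: "integrable lborel q" and q2: "integrable lborel (\<lambda>x. (norm (q x))\<^sup>2)"
    and f: "integrable lborel f" and f2: "integrable lborel (\<lambda>x. (norm (f x))\<^sup>2)"
    and bnd: "\<And>x. norm (f x) \<le> C" and cont: "\<And>x. isCont f x"
  shows "of_real ((2 * pi) ^ DIM('a)) * (LINT x|lborel. q x * f x) = (LINT x|lborel. ft 1 q x * ft (-1) f x)"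
proof -
  have [measurable]: "q \<in> borel_measurable borel" "f \<in> borel_measurable borel" using q f by auto
  define e where "e k = 1 / real (Suc k)" for k
  have e: "e k > 0" "e \<longlonglongrightarrow> 0" for k
    unfolding e_def using LIMSEQ_Suc[OF lim_1_over_n] by auto
  let ?\<pi> = "(2 * pi) ^ DIM('a)"
  let ?A = "\<lambda>k. LINT x|lborel. ft 1 q x * (ft (-1) f x * of_real (gauss (e k) x))"
  have int: "integrable lborel (\<lambda>x. ft 1 q x * ft (-1) f x)"
    by (intro integrable_mult_square_integrable integrable_ft_square q f q2 f2) auto
  have l1: "?A \<longlonglongrightarrow> (LINT x|lborel. ft 1 q x * ft (-1) f x)"
  proof (rule integral_dominated_convergence)
    show "integrable lborel (\<lambda>x. norm (ft 1 q x * ft (-1) f x))" using int by (rule integrable_norm)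
    show "AE x in lborel. norm (ft 1 q x * (ft (-1) f x * of_real (gauss (e k) x))) \<le> norm (ft 1 q x * ft (-1) f x)" for k
    proof (rule AE_I2)
      fix x
      have "norm (ft 1 q x * ft (-1) f x) * gauss (e k) x \<le> norm (ft 1 q x * ft (-1) f x) * 1"
        by (intro mult_left_mono gauss_le_1) (use e(1)[of k] in auto)
      then show "norm (ft 1 q x * (ft (-1) f x * of_real (gauss (e k) x))) \<le> norm (ft 1 q x * ft (-1) f x)"
        by (simp add: norm_mult gauss_pos less_imp_le)
    qed
    show "AE x in lborel. (\<lambda>k. ft 1 q x * (ft (-1) f x * of_real (gauss (e k) x))) \<longlonglongrightarrow> ft 1 q x * ft (-1) f x"
    proof (rule AE_I2)
      fix x :: 'a
      have "(\<lambda>k. ft 1 q x * (ft (-1) f x * of_real (gauss (e k) x))) \<longlonglongrightarrow> ft 1 q x * (ft (-1) f x * of_real 1)"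
        by (rule tendsto_mult[OF tendsto_const], rule tendsto_mult[OF tendsto_const], rule tendsto_of_real, rule tendsto_gauss, rule e)
      then show "(\<lambda>k. ft 1 q x * (ft (-1) f x * of_real (gauss (e k) x))) \<longlonglongrightarrow> ft 1 q x * ft (-1) f x"
        by simp
    qed
  qed measurable
  have A: "?A k = of_real ?\<pi> * (LINT \<xi>|lborel. q \<xi> * (LINT \<eta>|lborel. f \<eta> * of_real (heat (e k) (\<eta> - \<xi>))))" for k
  proof -
    have i: "integrable lborel (\<lambda>x. ft (-1) f x * of_real (gauss (e k) x))"
      by (rule integrable_ft_mult[OF f]) (simp add: complex_of_real_integrable_eq integrable_gauss e)
    have "?A k = (LINT \<xi>|lborel. q \<xi> * ft 1 (\<lambda>x. ft (-1) f x * of_real (gauss (e k) x)) \<xi>)"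
      by (rule integral_ft_mult[OF q i])
    also have "\<dots> = (LINT \<xi>|lborel. of_real ?\<pi> * (q \<xi> * (LINT \<eta>|lborel. f \<eta> * of_real (heat (e k) (\<eta> - \<xi>)))))"
      using ft_ft_gauss[OF f e(1), of "-1"] by (simp add: mult_ac)
    finally show ?thesis by (simp only: integral_mult_right_zero)
  qed
  have "(\<lambda>k. LINT \<xi>|lborel. q \<xi> * (LINT \<eta>|lborel. f \<eta> * of_real (heat (e k) (\<eta> - \<xi>)))) \<longlonglongrightarrow> (LINT \<xi>|lborel. q \<xi> * f \<xi>)"
  proof (rule integral_dominated_convergence)
    show "integrable lborel (\<lambda>\<xi>. norm (q \<xi>) * C)" using q by simp
    show "AE \<xi> in lborel. norm (q \<xi> * (LINT \<eta>|lborel. f \<eta> * of_real (heat (e k) (\<eta> - \<xi>)))) \<le> norm (q \<xi>) * C" for k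
    proof (rule AE_I2)
      fix \<xi> :: 'a
      have h: "integrable lborel (\<lambda>\<eta>. heat (e k) (\<eta> - \<xi>))"
        using integrable_translate[OF integrable_heat[OF e(1)], where t="- \<xi>"] by simp
      have "norm (LINT \<eta>|lborel. f \<eta> * of_real (heat (e k) (\<eta> - \<xi>))) \<le> (LINT \<eta>|lborel. norm (f \<eta> * of_real (heat (e k) (\<eta> - \<xi>))))"
        by (rule integral_norm_bound)
      also have "\<dots> \<le> (LINT \<eta>|lborel. C * heat (e k) (\<eta> - \<xi>))"
        using h bnd e(1) order_trans[OF norm_ge_zero bnd]
        by (intro integral_mono_AE') (auto simp: norm_mult heat_nonneg intro!: AE_I2 mult_right_mono)
      also have "\<dots> = C"
        using integral_translate[where f="heat (e k)" and t="- \<xi>"] integral_heat[OF e(1), where 'a='a, of k] by simp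
      finally show "norm (q \<xi> * (LINT \<eta>|lborel. f \<eta> * of_real (heat (e k) (\<eta> - \<xi>)))) \<le> norm (q \<xi>) * C"
        by (simp add: norm_mult mult_left_mono)
    qed
    show "AE \<xi> in lborel. (\<lambda>k. q \<xi> * (LINT \<eta>|lborel. f \<eta> * of_real (heat (e k) (\<eta> - \<xi>)))) \<longlonglongrightarrow> q \<xi> * f \<xi>"
      by (intro AE_I2 tendsto_mult[OF tendsto_const] heat_tendsto[OF _ bnd cont e]) measurable
  qed measurable
  then have "?A \<longlonglongrightarrow> of_real ?\<pi> * (LINT \<xi>|lborel. q \<xi> * f \<xi>)"
    unfolding A by (rule tendsto_mult[OF tendsto_const])
  with l1 show ?thesis using LIMSEQ_unique by blast
qed

text \<open>By the pairing, \<open>q\<close> annihilates continuous functions dominated by the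
  Gaussian. They approximate the Gaussian restricted to a closed set, and closed sets form an
  intersection-stable generator of the Borel sets, so \<open>q\<close> times the Gaussian has
  integral 0 over every Borel set. The Gaussian keeps the test functions integrable when the closed
  set is unbounded, in particular for \<open>UNIV\<close>, on which the complement step
  rests.\<close>

lemma ft_eq_0_imp_AE_0:
  fixes q :: "'a::euclidean_space \<Rightarrow> complex"
  assumes q: "integrable lborel q" and q2: "integrable lborel (\<lambda>x. (norm (q x))\<^sup>2)"
    and zero: "\<And>x. ft 1 q x = 0"
  shows "AE x in lborel. q x = 0"
proof -
  have [measurable]: "q \<in> borel_measurable borel" using q by auto
  let ?q = "\<lambda>x. q x * of_real (gauss 1 x)"
  have iq: "integrable lborel ?q"
    by (rule Bochner_Integration.integrable_bound[OF q]) 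
       (auto simp: norm_mult gauss_pos less_imp_le intro!: AE_I2 mult_left_le gauss_le_1)
  have closed: "(LINT x|lborel. indicator K x *\<^sub>R ?q x) = 0" if "closed K" for K
  proof (cases "K = {}")
    case False
    have [measurable]: "K \<in> sets borel" using \<open>closed K\<close> by simp
    \<comment> \<open>Lipschitz functions decreasing to the indicator of \<open>K\<close>. The empty
      set is treated apart because \<open>infdist x {} = 0\<close> would make them constantly
      1.\<close>
    define g where "g k x = max 0 (1 - real k * infdist x K)" for k x
    have g01: "0 \<le> g k x" "g k x \<le> 1" for k x by (auto simp: g_def infdist_nonneg)
    have gc: "isCont (g k) x" for k x unfolding g_def[abs_def] by (intro continuous_intros)
    have gm[measurable]: "g k \<in> borel_measurable borel" for k
      using gc by (intro borel_measurable_continuous_onI) (simp add: continuous_at_imp_continuous_on)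
    have z: "(LINT x|lborel. q x * (of_real (g k x) * of_real (gauss 1 x))) = 0" for k
    proof -
      let ?f = "\<lambda>x. complex_of_real (g k x) * complex_of_real (gauss 1 x)"
      have nf: "norm (?f x) \<le> gauss 1 x" for x
        using g01[of k x] gauss_pos[of 1 x] by (simp add: norm_mult mult_left_le_one_le less_imp_le)
      have f: "integrable lborel ?f"
        by (rule Bochner_Integration.integrable_bound[OF integrable_gauss[of 1]])
           (auto simp only: real_norm_def abs_of_pos[OF gauss_pos] nf intro!: AE_I2, measurable)
      have f2: "integrable lborel (\<lambda>x. (norm (?f x))\<^sup>2)"
      proof (rule Bochner_Integration.integrable_bound[OF integrable_gauss[of 1]])
        show "AE x in lborel. norm ((norm (?f x))\<^sup>2) \<le> norm (gauss 1 x)"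
        proof (rule AE_I2)
          fix x
          have "norm (?f x) * norm (?f x) \<le> gauss 1 x * 1"
            by (intro mult_mono nf order_trans[OF nf gauss_le_1]) (auto simp: gauss_pos less_imp_le)
          then show "norm ((norm (?f x))\<^sup>2) \<le> norm (gauss 1 x)"
            by (simp add: power2_eq_square gauss_pos less_imp_le)
        qed
      qed auto
      have "isCont ?f x" for x
        unfolding gauss_def by (intro continuous_intros gc)
      then have "of_real ((2 * pi) ^ DIM('a)) * (LINT x|lborel. q x * ?f x) = (LINT x|lborel. ft 1 q x * ft (-1) ?f x)"
        using order_trans[OF nf gauss_le_1] by (intro ft_pairing[OF q q2 f f2]) auto
      then show ?thesis by (simp add: zero)
    qed
    have "(\<lambda>k. LINT x|lborel. q x * (of_real (g k x) * of_real (gauss 1 x))) \<longlonglongrightarrow> (LINT x|lborel. indicator K x *\<^sub>R ?q x)"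
    proof (rule integral_dominated_convergence)
      show "integrable lborel (\<lambda>x. norm (?q x))" using iq by (rule integrable_norm)
      show "AE x in lborel. norm (q x * (of_real (g k x) * of_real (gauss 1 x))) \<le> norm (?q x)" for k
        using g01 gauss_pos[of 1] by (auto simp: norm_mult mult_left_le_one_le less_imp_le intro!: AE_I2 mult_left_mono)
      show "AE x in lborel. (\<lambda>k. q x * (of_real (g k x) * of_real (gauss 1 x))) \<longlonglongrightarrow> indicator K x *\<^sub>R ?q x"
      proof (rule AE_I2)
        fix x :: 'a
        have "(\<lambda>k. g k x) \<longlonglongrightarrow> indicator K x"
        proof (cases "x \<in> K")
          case True
          then show ?thesis by (simp add: g_def)
        next
          case notin: False
          then have "infdist x K > 0"
            using \<open>closed K\<close> False by (simp add: infdist_pos_not_in_closed)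
          then obtain N where N: "1 / infdist x K < real N" using reals_Archimedean2 by blast
          have "\<forall>k\<ge>N. g k x = 0"
          proof (intro allI impI)
            fix k assume "k \<ge> N"
            then have "1 / infdist x K < real k" using N by linarith
            then show "g k x = 0" using \<open>infdist x K > 0\<close> by (simp add: g_def field_simps)
          qed
          then have "\<forall>\<^sub>F k in sequentially. g k x = indicator K x"
            using notin unfolding eventually_sequentially by (intro exI[of _ N]) simp
          then show ?thesis by (rule tendsto_eventually)
        qed
        then have "(\<lambda>k. q x * (of_real (g k x) * of_real (gauss 1 x))) \<longlonglongrightarrow> q x * (of_real (indicator K x) * of_real (gauss 1 x))"
          by (intro tendsto_intros)
        then show "(\<lambda>k. q x * (of_real (g k x) * of_real (gauss 1 x))) \<longlonglongrightarrow> indicator K x *\<^sub>R ?q x"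
          by (cases "x \<in> K") simp_all
      qed
    qed measurable
    then show ?thesis unfolding z by (simp add: LIMSEQ_const_iff)
  qed simp
  have "AE x in lborel. ?q x = 0"
  proof (rule sigma_finite_measure.density_zero[OF sigma_finite_lborel iq])
    fix A :: "'a set" assume "A \<in> sets lborel"
    then have "Int_stable (Collect closed)" "Collect closed \<subseteq> Pow UNIV" "A \<in> sigma_sets UNIV (Collect closed)"
      by (auto simp: Int_stable_def borel_eq_closed)
    then show "set_lebesgue_integral lborel A ?q = 0"
    proof (induction A rule: sigma_sets_induct_disjoint)
      case (basic A)
      then show ?case using closed unfolding set_lebesgue_integral_def by simp
    next
      case empty
      then show ?case unfolding set_lebesgue_integral_def by simp
    next
      case (compl A)
      then have m: "A \<in> sets borel" by (simp add: borel_eq_closed)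
      have "integral\<^sup>L lborel ?q = (LINT x|lborel. indicator A x *\<^sub>R ?q x + indicator (UNIV - A) x *\<^sub>R ?q x)"
        by (intro Bochner_Integration.integral_cong refl) (auto simp: indicator_def)
      also have "\<dots> = (LINT x|lborel. indicator A x *\<^sub>R ?q x) + (LINT x|lborel. indicator (UNIV - A) x *\<^sub>R ?q x)"
        using m by (intro Bochner_Integration.integral_add integrable_mult_indicator iq) auto
      also have "integral\<^sup>L lborel ?q = 0" using closed[of UNIV] by simp
      finally show ?case using compl unfolding set_lebesgue_integral_def by simp
    next
      case (union A)
      then have m: "A i \<in> sets borel" for i by (auto simp: borel_eq_closed)
      have "set_lebesgue_integral lborel (\<Union>i. A i) ?q = (\<Sum>i. set_lebesgue_integral lborel (A i) ?q)"
        using m union(1) iq unfolding set_integrable_def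
        by (intro lebesgue_integral_countable_add) (auto simp: disjoint_family_on_def set_integrable_def intro!: integrable_mult_indicator)
      then show ?case using union by simp
    qed
  qed
  then show ?thesis by (auto simp: less_imp_neq[OF gauss_pos, symmetric])
qed

section \<open>Fourier pairs and Sobolev norms\<close>

text \<open>The factor in \<open>fourier\<close>. Its square cancels the power of
  \<open>2 * pi\<close> in Bessel's inequality and in the Parseval pairing.\<close>

definition fourier_const :: "nat \<Rightarrow> real" where
  "fourier_const n = (2 * pi) powr (- real n / 2)"

lemma fourier_const_pos: "0 < fourier_const n"
  by (simp add: fourier_const_def)

lemma fourier_const_square: "(fourier_const n)\<^sup>2 * (2 * pi) ^ n = 1"
proof -
  have "(fourier_const n)\<^sup>2 = (2 * pi) powr (- real n)"
    by (simp add: fourier_const_def power2_eq_square flip: powr_add)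
  then have "(fourier_const n)\<^sup>2 * (2 * pi) ^ n = (2 * pi) powr (- real n) * (2 * pi) powr (real n)"
    by (simp add: powr_realpow)
  then show ?thesis by (simp flip: powr_add)
qed

lemma fourier_eq_ft: "fourier f \<xi> = of_real (fourier_const CARD('n)) * ft (-1) f \<xi>"
  for f :: "real^'n::finite \<Rightarrow> complex"
  by (simp add: fourier_def ft_def fourier_const_def inner_commute)

lemma square_integrableI:
  "integrable lborel q \<Longrightarrow> integrable lborel (\<lambda>x. (norm (q x))\<^sup>2) \<Longrightarrow> square_integrable q"
  unfolding square_integrable_def by auto

lemma square_integrableD:
  assumes "square_integrable u"
  shows "u \<in> borel_measurable borel" "integrable lborel (\<lambda>x. (norm (u x))\<^sup>2)"
  using assms unfolding square_integrable_def by auto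

lemma square_integrable_ft:
  fixes q :: "real^'n::finite \<Rightarrow> complex"
  assumes "integrable lborel q" "integrable lborel (\<lambda>x. (norm (q x))\<^sup>2)" "\<bar>c\<bar> = 1"
  shows "square_integrable (\<lambda>x. of_real a * ft c q x)"
  using integrable_ft_square[OF assms] assms(1) unfolding square_integrable_def
  by (auto simp: norm_mult power_mult_distrib)

lemma bessel_normalized:
  fixes q :: "real^'n::finite \<Rightarrow> complex"
  assumes q: "integrable lborel q" and c: "\<bar>c\<bar> = 1"
  shows "(\<integral>\<^sup>+x. ennreal ((norm (of_real (fourier_const CARD('n)) * ft c q x))\<^sup>2) \<partial>lborel)
    \<le> (\<integral>\<^sup>+\<xi>. ennreal ((norm (q \<xi>))\<^sup>2) \<partial>lborel)"
proof -
  have [measurable]: "q \<in> borel_measurable borel" using q by auto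
  let ?k = "fourier_const CARD('n)"
  have "(\<integral>\<^sup>+x. ennreal ((norm (of_real ?k * ft c q x))\<^sup>2) \<partial>lborel) = (\<integral>\<^sup>+x. ennreal (?k\<^sup>2) * ennreal ((norm (ft c q x))\<^sup>2) \<partial>lborel)"
    by (intro nn_integral_cong) (simp add: norm_mult power_mult_distrib ennreal_mult)
  also have "\<dots> = ennreal (?k\<^sup>2) * (\<integral>\<^sup>+x. ennreal ((norm (ft c q x))\<^sup>2) \<partial>lborel)"
    by (rule nn_integral_cmult) measurable
  also have "\<dots> \<le> ennreal (?k\<^sup>2) * (ennreal ((2 * pi) ^ CARD('n)) * (\<integral>\<^sup>+\<xi>. ennreal ((norm (q \<xi>))\<^sup>2) \<partial>lborel))"
    using bessel[OF q c] by (intro mult_left_mono) auto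
  also have "\<dots> = ennreal (?k\<^sup>2 * (2 * pi) ^ CARD('n)) * (\<integral>\<^sup>+\<xi>. ennreal ((norm (q \<xi>))\<^sup>2) \<partial>lborel)"
    by (simp add: ennreal_mult mult.assoc)
  finally show ?thesis unfolding fourier_const_square by simp
qed

text \<open>Pairs built from the frequency side: the defining identity is the Parseval pairing with
  a Schwartz function. The smoothed function is obtained in this way.\<close>

lemma has_fourier_ft:
  fixes q :: "real^'n::finite \<Rightarrow> complex"
  assumes q: "integrable lborel q" and q2: "integrable lborel (\<lambda>x. (norm (q x))\<^sup>2)"
  shows "has_fourier (\<lambda>x. of_real (fourier_const CARD('n)) * ft 1 q x) q"
  unfolding has_fourier_def
proof (intro conjI allI impI square_integrable_ft square_integrableI q q2)
  let ?k = "fourier_const CARD('n)"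
  fix f :: "real^'n \<Rightarrow> complex" assume f: "schwartz f"
  obtain C where C: "\<And>x. norm (f x) \<le> C" using schwartz_bounded[OF f] by blast
  have "(LINT x|lborel. (of_real ?k * ft 1 q x) * fourier f x) = (LINT x|lborel. of_real (?k\<^sup>2) * (ft 1 q x * ft (-1) f x))"
    by (simp add: fourier_eq_ft power2_eq_square mult_ac)
  also have "\<dots> = of_real (?k\<^sup>2) * (LINT x|lborel. ft 1 q x * ft (-1) f x)"
    by (rule integral_mult_right_zero)
  also have "\<dots> = of_real (?k\<^sup>2 * (2 * pi) ^ CARD('n)) * (LINT x|lborel. q x * f x)"
    using ft_pairing[OF q q2 schwartz_integrable[OF f] schwartz_integrable_square[OF f] C schwartz_isCont[OF f]]
    by (simp add: mult_ac)
  finally show "(LINT \<xi>|lborel. q \<xi> * f \<xi>) = (LINT x|lborel. (of_real ?k * ft 1 q x) * fourier f x)"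
    unfolding fourier_const_square by simp
qed simp

text \<open>Pairs built from the space side, where the multiplication formula is enough. The cut off
  correction is obtained in this way.\<close>

lemma has_fourier_fourier:
  fixes r :: "real^'n::finite \<Rightarrow> complex"
  assumes r: "integrable lborel r" and r2: "integrable lborel (\<lambda>x. (norm (r x))\<^sup>2)"
  shows "has_fourier r (fourier r)"
  unfolding has_fourier_def
proof (intro conjI allI impI)
  show "square_integrable r" using r r2 by (rule square_integrableI)
  show "square_integrable (fourier r)"
    using square_integrable_ft[OF r r2, of "-1"] unfolding fourier_eq_ft[abs_def] by simp
  fix f :: "real^'n \<Rightarrow> complex" assume f: "schwartz f"
  have "(LINT x|lborel. ft (-1) r x * f x) = (LINT x|lborel. r x * ft (-1) f x)"
    by (rule integral_ft_mult[OF r schwartz_integrable[OF f]])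
  then have "of_real (fourier_const CARD('n)) * (LINT x|lborel. ft (-1) r x * f x) = of_real (fourier_const CARD('n)) * (LINT x|lborel. r x * ft (-1) f x)"
    by simp
  then show "(LINT x|lborel. fourier r x * f x) = (LINT x|lborel. r x * fourier f x)"
    unfolding fourier_eq_ft integral_mult_right_zero[symmetric] by (simp add: mult_ac)
qed

lemma square_integrable_mult_schwartz:
  assumes "square_integrable u" "schwartz f"
  shows "integrable lborel (\<lambda>x. u x * f x)" "integrable lborel (\<lambda>x. u x * fourier f x)"
proof -
  note u = square_integrableD[OF assms(1)]
  note f = schwartz_measurable[OF assms(2)] schwartz_integrable[OF assms(2)] schwartz_integrable_square[OF assms(2)]
  show "integrable lborel (\<lambda>x. u x * f x)"
    by (rule integrable_mult_square_integrable) (use u f in auto)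
  have "square_integrable (fourier f)"
    using square_integrable_ft[OF f(2,3), of "-1"] unfolding fourier_eq_ft[abs_def] by simp
  then show "integrable lborel (\<lambda>x. u x * fourier f x)"
    by (intro integrable_mult_square_integrable) (use u in \<open>auto dest: square_integrableD\<close>)
qed

lemma square_integrable_add:
  assumes "square_integrable u" "square_integrable v"
  shows "square_integrable (\<lambda>x. u x + v x)"
  unfolding square_integrable_def
proof (intro conjI)
  note u = square_integrableD[OF assms(1)] and v = square_integrableD[OF assms(2)]
  note [measurable] = u(1) v(1)
  show "(\<lambda>x. u x + v x) \<in> borel_measurable lborel" by measurable
  show "integrable lborel (\<lambda>x. (norm (u x + v x))\<^sup>2)"
  proof (rule Bochner_Integration.integrable_bound)
    show "integrable lborel (\<lambda>x. 2 * (norm (u x))\<^sup>2 + 2 * (norm (v x))\<^sup>2)"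
      using u v by auto
    show "AE x in lborel. norm ((norm (u x + v x))\<^sup>2) \<le> norm (2 * (norm (u x))\<^sup>2 + 2 * (norm (v x))\<^sup>2)"
    proof (rule AE_I2)
      fix x
      have "(norm (u x + v x))\<^sup>2 \<le> (norm (u x) + norm (v x))\<^sup>2"
        by (intro power_mono norm_triangle_ineq) auto
      also have "\<dots> \<le> 2 * (norm (u x))\<^sup>2 + 2 * (norm (v x))\<^sup>2"
        using zero_le_power2[of "norm (u x) - norm (v x)"] unfolding power2_diff power2_sum by simp
      finally show "norm ((norm (u x + v x))\<^sup>2) \<le> norm (2 * (norm (u x))\<^sup>2 + 2 * (norm (v x))\<^sup>2)" by simp
    qed
  qed measurable
qed

lemma square_integrable_uminus: "square_integrable u \<Longrightarrow> square_integrable (\<lambda>x. - u x)"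
  unfolding square_integrable_def by auto

lemma square_integrable_diff:
  "square_integrable u \<Longrightarrow> square_integrable v \<Longrightarrow> square_integrable (\<lambda>x. u x - v x)"
  using square_integrable_add[OF _ square_integrable_uminus] by simp

lemma has_fourier_add:
  assumes "has_fourier u v" "has_fourier u' v'"
  shows "has_fourier (\<lambda>x. u x + u' x) (\<lambda>x. v x + v' x)"
  using assms unfolding has_fourier_def
  by (auto intro: square_integrable_add simp: ring_distribs square_integrable_mult_schwartz Bochner_Integration.integral_add)

lemma integrable_mult_gauss:
  fixes v :: "real^'n::finite \<Rightarrow> complex"
  assumes "square_integrable v" "0 < \<epsilon>"
  shows "integrable lborel (\<lambda>\<xi>. v \<xi> * of_real (gauss \<epsilon> \<xi>))"
    and "integrable lborel (\<lambda>\<xi>. (norm (v \<xi> * of_real (gauss \<epsilon> \<xi>)))\<^sup>2)"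
proof -
  note v = square_integrableD[OF assms(1)]
  note [measurable] = v(1)
  have g2: "integrable lborel (\<lambda>\<xi>::real^'n. (norm (complex_of_real (gauss \<epsilon> \<xi>)))\<^sup>2)"
  proof -
    have "(\<lambda>\<xi>::real^'n. (norm (complex_of_real (gauss \<epsilon> \<xi>)))\<^sup>2) = gauss (2 * \<epsilon>)"
      by (auto simp: gauss_def fun_eq_iff power2_eq_square mult_exp_exp)
    then show ?thesis using integrable_gauss[of "2 * \<epsilon>"] assms(2) by simp
  qed
  show "integrable lborel (\<lambda>\<xi>. v \<xi> * of_real (gauss \<epsilon> \<xi>))"
    by (rule integrable_mult_square_integrable[OF _ _ _ g2]) (use v in auto)
  show "integrable lborel (\<lambda>\<xi>. (norm (v \<xi> * of_real (gauss \<epsilon> \<xi>)))\<^sup>2)"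
  proof (rule Bochner_Integration.integrable_bound[OF v(2)])
    show "AE x in lborel. norm ((norm (v x * complex_of_real (gauss \<epsilon> x)))\<^sup>2) \<le> norm ((norm (v x))\<^sup>2)"
    proof (rule AE_I2)
      fix x
      have "norm (v x) * gauss \<epsilon> x \<le> norm (v x) * 1"
        using assms by (intro mult_left_mono gauss_le_1) auto
      then show "norm ((norm (v x * complex_of_real (gauss \<epsilon> x)))\<^sup>2) \<le> norm ((norm (v x))\<^sup>2)"
        by (auto simp: norm_mult gauss_pos less_imp_le intro!: power_mono)
    qed
  qed measurable
qed

text \<open>Testing the pair against a Gaussian modulated by \<open>x\<close> turns the
  distributional definition into a pointwise identity. It is the bridge from \<open>v\<close> back
  to the values of \<open>u\<close>.\<close>

lemma has_fourier_heat:
  fixes u v :: "real^'n::finite \<Rightarrow> complex"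
  assumes uv: "has_fourier u v" and e: "0 < \<epsilon>"
  shows "of_real (fourier_const CARD('n)) * ft 1 (\<lambda>\<xi>. v \<xi> * of_real (gauss \<epsilon> \<xi>)) x = (LINT y|lborel. u y * of_real (heat \<epsilon> (y - x)))"
proof -
  let ?k = "fourier_const CARD('n)"
  let ?f = "\<lambda>\<xi>. cis (x \<bullet> \<xi>) * complex_of_real (gauss \<epsilon> \<xi>)"
  have ff: "fourier ?f y = of_real (?k * ((2 * pi) ^ CARD('n) * heat \<epsilon> (y - x)))" for y
  proof -
    have "ft (-1) ?f y = (LINT \<xi>|lborel. cis ((x - y) \<bullet> \<xi>) * of_real (gauss \<epsilon> \<xi>))"
      unfolding ft_def
      by (intro Bochner_Integration.integral_cong refl)
         (simp add: cis_mult mult.assoc[symmetric], simp add: algebra_simps inner_commute)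
    also have "\<dots> = of_real ((2 * pi) ^ CARD('n) * heat \<epsilon> (x - y))"
      using integral_cis_gauss[OF e, of "x - y"] by simp
    finally show ?thesis by (simp add: fourier_eq_ft heat_minus)
  qed
  have "(LINT \<xi>|lborel. v \<xi> * ?f \<xi>) = (LINT y|lborel. u y * fourier ?f y)"
    using uv schwartz_modulated_gauss[OF e, of x] unfolding has_fourier_def by blast
  also have "(LINT \<xi>|lborel. v \<xi> * ?f \<xi>) = ft 1 (\<lambda>\<xi>. v \<xi> * of_real (gauss \<epsilon> \<xi>)) x"
    unfolding ft_def by (simp add: mult_ac inner_commute)
  finally have "of_real ?k * ft 1 (\<lambda>\<xi>. v \<xi> * of_real (gauss \<epsilon> \<xi>)) x = (LINT y|lborel. of_real (?k\<^sup>2 * (2 * pi) ^ CARD('n)) * (u y * of_real (heat \<epsilon> (y - x))))"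
    unfolding ff by (simp add: power2_eq_square mult_ac flip: integral_mult_right_zero)
  then show ?thesis unfolding fourier_const_square by simp
qed

text \<open>The heat averages depend on \<open>u\<close> only, so the Fourier integrals of
  \<open>v\<close> and \<open>v'\<close> with a Gaussian factor coincide. With that factor the
  difference is integrable, injectivity applies, and the positive Gaussian can be divided
  out.\<close>

lemma has_fourier_unique:
  fixes u v v' :: "real^'n::finite \<Rightarrow> complex"
  assumes "has_fourier u v" "has_fourier u v'"
  shows "AE \<xi> in lborel. v \<xi> = v' \<xi>"
proof -
  have sq: "square_integrable v" "square_integrable v'" using assms unfolding has_fourier_def by auto
  let ?q = "\<lambda>\<xi>. (v \<xi> - v' \<xi>) * of_real (gauss 1 \<xi>)"
  note d = integrable_mult_gauss[OF square_integrable_diff[OF sq] zero_less_one]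
  have "ft 1 ?q x = 0" for x
  proof -
    have i: "integrable lborel (\<lambda>\<xi>. cis (1 * (\<xi> \<bullet> x)) * (w \<xi> * of_real (gauss 1 \<xi>)))"
      if "square_integrable w" for w :: "real^'n \<Rightarrow> complex"
      by (rule integrable_cis_mult[OF integrable_mult_gauss(1)[OF that]]) auto
    have "ft 1 ?q x = ft 1 (\<lambda>\<xi>. v \<xi> * of_real (gauss 1 \<xi>)) x - ft 1 (\<lambda>\<xi>. v' \<xi> * of_real (gauss 1 \<xi>)) x"
      unfolding ft_def Bochner_Integration.integral_diff[OF i[OF sq(1)] i[OF sq(2)], symmetric]
      by (intro Bochner_Integration.integral_cong refl) (simp add: algebra_simps)
    moreover have "of_real (fourier_const CARD('n)) * ft 1 (\<lambda>\<xi>. v \<xi> * of_real (gauss 1 \<xi>)) x =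
      of_real (fourier_const CARD('n)) * ft 1 (\<lambda>\<xi>. v' \<xi> * of_real (gauss 1 \<xi>)) x"
      unfolding has_fourier_heat[OF assms(1) zero_less_one] has_fourier_heat[OF assms(2) zero_less_one] ..
    ultimately show ?thesis using fourier_const_pos[of "CARD('n)"] by simp
  qed
  then have "AE \<xi> in lborel. ?q \<xi> = 0"
    by (rule ft_eq_0_imp_AE_0[OF d])
  then show ?thesis by eventually_elim (simp add: less_imp_neq[OF gauss_pos, symmetric])
qed

lemma sobolev_weight_measurable:
  assumes [measurable]: "v \<in> borel_measurable borel"
  shows "sobolev_weight s v \<in> borel_measurable borel"
  unfolding sobolev_weight_def[abs_def] by measurable

text \<open>The transform picked by \<open>SOME\<close> in \<open>sobolev_norm\<close> may differ
  from \<open>v\<close> on a null set, which the integrals do not see. Norms can now be computed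
  from whichever transform is at hand.\<close>

lemma
  assumes "has_fourier u v"
  shows sobolev_iff: "u \<in> sobolev s \<longleftrightarrow> integrable lborel (sobolev_weight s v)"
    and sobolev_norm_eq: "sobolev_norm s u = sqrt (LINT \<xi>|lborel. sobolev_weight s v \<xi>)"
proof -
  have eq: "integrable lborel (sobolev_weight s v') \<longleftrightarrow> integrable lborel (sobolev_weight s v)"
    "(LINT \<xi>|lborel. sobolev_weight s v' \<xi>) = (LINT \<xi>|lborel. sobolev_weight s v \<xi>)" if v': "has_fourier u v'" for v'
  proof -
    have [measurable]: "v \<in> borel_measurable borel" "v' \<in> borel_measurable borel"
      using assms v' unfolding has_fourier_def square_integrable_def by auto
    have m: "sobolev_weight s v \<in> borel_measurable lborel" "sobolev_weight s v' \<in> borel_measurable lborel"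
      by (simp_all add: sobolev_weight_measurable)
    have ae: "AE \<xi> in lborel. sobolev_weight s v' \<xi> = sobolev_weight s v \<xi>"
      using has_fourier_unique[OF v' assms] by eventually_elim (simp add: sobolev_weight_def)
    show "integrable lborel (sobolev_weight s v') \<longleftrightarrow> integrable lborel (sobolev_weight s v)"
      by (rule integrable_cong_AE[OF m(2,1) ae])
    show "(LINT \<xi>|lborel. sobolev_weight s v' \<xi>) = (LINT \<xi>|lborel. sobolev_weight s v \<xi>)"
      by (rule integral_cong_AE[OF m(2,1) ae])
  qed
  show "u \<in> sobolev s \<longleftrightarrow> integrable lborel (sobolev_weight s v)"
    unfolding sobolev_def mem_Collect_eq using assms eq(1) by blast
  show "sobolev_norm s u = sqrt (LINT \<xi>|lborel. sobolev_weight s v \<xi>)"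
    using eq(2)[OF someI[of "has_fourier u", OF assms]] by (simp only: sobolev_norm_def)
qed

section \<open>Pointwise convergence of the heat averages\<close>

lemma heat_tail_tendsto_0:
  assumes "0 < \<delta>"
  shows "(\<lambda>k. (1 / sqrt (2 * pi * (1 / real (Suc k)))) ^ n * exp (- (\<delta> * real (Suc k)))) \<longlonglongrightarrow> 0"
proof (rule tendsto_sandwich[of "\<lambda>_. 0" _ _ "\<lambda>k. (1 / \<delta>) ^ n * ((\<delta> * real (Suc k)) ^ n / exp (\<delta> * real (Suc k)))"])
  let ?X = "\<lambda>k. \<delta> * real (Suc k)"
  have "filterlim ?X at_top sequentially"
    by (rule filterlim_tendsto_pos_mult_at_top[OF tendsto_const assms])
       (rule filterlim_compose[OF filterlim_real_sequentially filterlim_Suc])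
  then have "(\<lambda>k. ?X k ^ n / exp (?X k)) \<longlonglongrightarrow> 0"
    by (rule filterlim_compose[OF tendsto_power_div_exp_0])
  then show "(\<lambda>k. (1 / \<delta>) ^ n * (?X k ^ n / exp (?X k))) \<longlonglongrightarrow> 0"
    by (rule tendsto_mult_right_zero)
  show "\<forall>\<^sub>F k in sequentially. (1 / sqrt (2 * pi * (1 / real (Suc k)))) ^ n * exp (- ?X k) \<le> (1 / \<delta>) ^ n * (?X k ^ n / exp (?X k))"
  proof (rule always_eventually, rule allI)
    fix k
    \<comment> \<open>Because of this, the prefactor of the heat kernel is at most
      \<open>real (Suc k) ^ n\<close>, which the exponential beats.\<close>
    have "1 \<le> 2 * pi" using pi_ge_two by simp
    then have "1 / real (Suc k) \<le> 2 * pi" by (simp add: order_trans[of _ 1])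
    then have "(1 / real (Suc k))\<^sup>2 \<le> 2 * pi * (1 / real (Suc k))"
      unfolding power2_eq_square by (rule mult_right_mono) simp
    then have "1 / real (Suc k) \<le> sqrt (2 * pi * (1 / real (Suc k)))"
      by (rule real_le_rsqrt)
    then have "1 / sqrt (2 * pi * (1 / real (Suc k))) \<le> real (Suc k)"
      using pi_gt_zero by (simp add: field_simps)
    then have "(1 / sqrt (2 * pi * (1 / real (Suc k)))) ^ n \<le> real (Suc k) ^ n"
      by (intro power_mono) auto
    then have "(1 / sqrt (2 * pi * (1 / real (Suc k)))) ^ n * exp (- ?X k) \<le> real (Suc k) ^ n * exp (- ?X k)"
      by (rule mult_right_mono) simp
    also have "\<dots> = (1 / \<delta>) ^ n * (?X k ^ n / exp (?X k))"
    proof -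
      have "(1 / \<delta>) ^ n * ?X k ^ n = real (Suc k) ^ n"
        using assms by (simp flip: power_mult_distrib del: of_nat_Suc)
      then show ?thesis by (simp only: exp_minus divide_inverse mult.assoc[symmetric])
    qed
    finally show "(1 / sqrt (2 * pi * (1 / real (Suc k)))) ^ n * exp (- ?X k) \<le> (1 / \<delta>) ^ n * (?X k ^ n / exp (?X k))" .
  qed
qed auto

text \<open>Near \<open>x\<close> the function is bounded and continuous up to a null set, and there
  the heat kernel is an approximate identity. The remainder \<open>u2\<close> vanishes almost
  everywhere on the ball, so it sees the kernel only at distance at least \<delta> from its centre,
  where the kernel is at most a null sequence times a fixed square integrable Gaussian.\<close>

lemma heat_tendsto_square_integrable:
  fixes u w :: "real^'n::finite \<Rightarrow> complex"
  assumes u: "square_integrable u" and w: "continuous_on UNIV w" and bnd: "\<And>y. y \<in> ball c r \<Longrightarrow> norm (w y) \<le> C"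
    and eq: "AE y in lborel. y \<in> ball c r \<longrightarrow> u y = w y" and x: "x \<in> ball c r"
  shows "(\<lambda>k. LINT y|lborel. u y * of_real (heat (1 / real (Suc k)) (y - x))) \<longlonglongrightarrow> w x"
proof -
  note [measurable] = square_integrableD(1)[OF u]
  let ?e = "\<lambda>k. 1 / real (Suc k)"
  have wm[measurable]: "w \<in> borel_measurable borel" using w by (rule borel_measurable_continuous_onI)
  have [measurable]: "ball c r \<in> sets borel" by simp
  define u1 where "u1 y = (if y \<in> ball c r then w y else 0)" for y
  define u2 where "u2 y = u y - u1 y" for y
  have m1[measurable]: "u1 \<in> borel_measurable borel" unfolding u1_def by measurable
  have m2[measurable]: "u2 \<in> borel_measurable borel" unfolding u2_def by measurable
  have C0: "0 \<le> C" using bnd[OF x] norm_ge_zero order_trans by blast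
  have b1: "norm (u1 y) \<le> C" for y using bnd C0 by (simp add: u1_def)
  have c1: "isCont u1 x"
  proof -
    have "isCont w x" using w by (simp add: continuous_on_eq_continuous_at)
    moreover have "\<forall>\<^sub>F y in nhds x. w y = u1 y"
      using eventually_nhds_in_open[OF open_ball x] by eventually_elim (simp add: u1_def)
    ultimately show ?thesis using isCont_cong by blast
  qed
  have l1: "(\<lambda>k. LINT y|lborel. u1 y * of_real (heat (?e k) (y - x))) \<longlonglongrightarrow> u1 x"
    using LIMSEQ_Suc[OF lim_1_over_n] by (intro heat_tendsto[OF m1 b1 c1]) auto
  have sq1: "square_integrable u1"
    unfolding square_integrable_def
  proof (intro conjI)
    show "integrable lborel (\<lambda>y. (norm (u1 y))\<^sup>2)"
    proof (rule Bochner_Integration.integrable_bound)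
      show "integrable lborel (\<lambda>y. C\<^sup>2 * indicator (ball c r) y)"
        by (intro integrable_mult_right integrable_real_indicator) (use emeasure_lborel_ball_finite[of c r] in auto)
      show "AE y in lborel. norm ((norm (u1 y))\<^sup>2) \<le> norm (C\<^sup>2 * indicator (ball c r) y)"
        using bnd by (auto simp: u1_def intro!: AE_I2 power_mono)
    qed measurable
  qed measurable
  have sq2: "square_integrable u2" unfolding u2_def using u sq1 by (rule square_integrable_diff)
  define \<delta> where "\<delta> = r - dist c x"
  have d: "0 < \<delta>" using x by (simp add: \<delta>_def)
  let ?a = "\<lambda>k. (1 / sqrt (2 * pi * ?e k)) ^ CARD('n) * exp (- (\<delta>\<^sup>2 / 4 * real (Suc k)))"
  \<comment> \<open>One half of the exponent is spent on the factor \<open>?a k\<close>, which tends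
    to 0; the other half is kept, at its value for \<open>k = 0\<close>, as a fixed Gaussian that
    can be paired with \<open>u2\<close>.\<close>
  have h: "heat (?e k) z \<le> ?a k * gauss (1/2) z" if "\<delta> \<le> norm z" for k and z :: "real^'n"
  proof -
    have "\<delta>\<^sup>2 \<le> (norm z)\<^sup>2" using that d by (intro power_mono) auto
    then have "\<delta>\<^sup>2 * real (Suc k) \<le> (norm z)\<^sup>2 * real (Suc k)" by (rule mult_right_mono) simp
    moreover have "(norm z)\<^sup>2 * 1 \<le> (norm z)\<^sup>2 * real (Suc k)" by (intro mult_left_mono) auto
    ultimately have "exp (- ((norm z)\<^sup>2 * real (Suc k) / 2)) \<le> exp (- (\<delta>\<^sup>2 * real (Suc k) / 4) + - ((norm z)\<^sup>2 / 4))"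
      unfolding exp_le_cancel_iff mult_1_right by linarith
    then have "gauss (1 / ?e k) z \<le> exp (- (\<delta>\<^sup>2 / 4 * real (Suc k))) * gauss (1/2) z"
      unfolding gauss_def mult_exp_exp by (simp add: mult_ac del: of_nat_Suc)
    then show ?thesis
      unfolding heat_def using pi_gt_zero by (simp add: mult.assoc mult_left_mono)
  qed
  have ig: "integrable lborel (\<lambda>y. u2 y * of_real (gauss (1/2) (y - x)))"
  proof (rule integrable_mult_square_integrable)
    have "(\<lambda>y. (norm (complex_of_real (gauss (1/2) (y - x))))\<^sup>2) = (\<lambda>y. gauss 1 (y - x))"
      by (auto simp: gauss_def fun_eq_iff power2_eq_square mult_exp_exp)
    then show "integrable lborel (\<lambda>y. (norm (complex_of_real (gauss (1/2) (y - x))))\<^sup>2)"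
      using integrable_translate[OF integrable_gauss[of 1], where t="- x"] by simp
  qed (use square_integrableD[OF sq2] in auto)
  have ae2: "AE y in lborel. norm (u2 y * of_real (heat (?e k) (y - x))) \<le> ?a k * norm (u2 y * of_real (gauss (1/2) (y - x)))" for k
    using eq
  proof eventually_elim
    case (elim y)
    show ?case
    proof (cases "y \<in> ball c r")
      case True
      then show ?thesis using elim by (simp add: u2_def u1_def)
    next
      case False
      have "dist c y \<le> dist c x + norm (y - x)"
        using dist_triangle[of c y x] by (simp add: dist_norm norm_minus_commute)
      then have "\<delta> \<le> norm (y - x)" using False by (simp add: \<delta>_def)
      then have "norm (u2 y) * heat (?e k) (y - x) \<le> norm (u2 y) * (?a k * gauss (1/2) (y - x))"
        by (intro mult_left_mono h) auto
      then show ?thesis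
        by (simp add: norm_mult heat_nonneg gauss_pos less_imp_le mult_ac)
    qed
  qed
  have i2: "integrable lborel (\<lambda>y. u2 y * of_real (heat (?e k) (y - x)))" for k
    by (rule Bochner_Integration.integrable_bound[OF integrable_mult_right[OF integrable_norm[OF ig], of "?a k"]])
       (use ae2[of k] in \<open>auto simp del: of_nat_Suc\<close>)
  have n2: "norm (LINT y|lborel. u2 y * of_real (heat (?e k) (y - x))) \<le> ?a k * (LINT y|lborel. norm (u2 y * of_real (gauss (1/2) (y - x))))" for k
  proof -
    have "norm (LINT y|lborel. u2 y * of_real (heat (?e k) (y - x))) \<le> (LINT y|lborel. norm (u2 y * of_real (heat (?e k) (y - x))))"
      by (rule integral_norm_bound)
    also have "\<dots> \<le> (LINT y|lborel. ?a k * norm (u2 y * of_real (gauss (1/2) (y - x))))"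
      by (intro integral_mono_AE integrable_norm integrable_mult_right i2 ig ae2)
    finally show ?thesis by simp
  qed
  have a0: "(\<lambda>k. ?a k * (LINT y|lborel. norm (u2 y * of_real (gauss (1/2) (y - x))))) \<longlonglongrightarrow> 0"
    using d by (intro tendsto_mult_left_zero heat_tail_tendsto_0) auto
  have l2: "(\<lambda>k. LINT y|lborel. u2 y * of_real (heat (?e k) (y - x))) \<longlonglongrightarrow> 0"
    by (rule Lim_null_comparison[OF always_eventually[OF allI[OF n2]] a0])
  have i1: "integrable lborel (\<lambda>y. u1 y * of_real (heat (?e k) (y - x)))" for k
  proof (rule Bochner_Integration.integrable_bound)
    show "integrable lborel (\<lambda>y. C * heat (?e k) (y - x))"
      using integrable_translate[OF integrable_heat[of "?e k"], where t="- x"] by (intro integrable_mult_right) simp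
    show "AE y in lborel. norm (u1 y * of_real (heat (?e k) (y - x))) \<le> norm (C * heat (?e k) (y - x))"
      using b1 C0 by (auto simp: norm_mult heat_nonneg abs_mult intro!: AE_I2 mult_right_mono)
  qed measurable
  have "(LINT y|lborel. u y * of_real (heat (?e k) (y - x))) = (LINT y|lborel. u1 y * of_real (heat (?e k) (y - x))) + (LINT y|lborel. u2 y * of_real (heat (?e k) (y - x)))" for k
    unfolding Bochner_Integration.integral_add[OF i1 i2, symmetric]
    by (intro Bochner_Integration.integral_cong refl) (simp add: u2_def algebra_simps)
  with tendsto_add[OF l1 l2] show ?thesis using x by (simp add: u1_def)
qed

section \<open>Fourier transforms of Lipschitz functions\<close>

lemma nn_integral_square_ball_le:
  fixes f :: "'a::euclidean_space \<Rightarrow> complex"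
  assumes "\<And>x. norm (f x) \<le> M" "\<And>x. x \<notin> ball c r \<Longrightarrow> f x = 0" "0 \<le> r"
  shows "(\<integral>\<^sup>+x. ennreal ((norm (f x))\<^sup>2) \<partial>lborel) \<le> ennreal (M\<^sup>2 * (unit_ball_vol (DIM('a)) * r ^ DIM('a)))"
proof -
  have "(\<integral>\<^sup>+x. ennreal ((norm (f x))\<^sup>2) \<partial>lborel) \<le> (\<integral>\<^sup>+x. ennreal (M\<^sup>2) * indicator (ball c r) x \<partial>lborel)"
    using assms(1,2) by (intro nn_integral_mono) (auto simp: indicator_def intro!: power_mono)
  also have "\<dots> = ennreal (M\<^sup>2) * emeasure lborel (ball c r)"
    by (simp add: nn_integral_cmult_indicator)
  finally show ?thesis using assms(3) by (simp add: emeasure_ball ennreal_mult)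
qed

lemma
  fixes f :: "'a::euclidean_space \<Rightarrow> complex"
  assumes [measurable]: "f \<in> borel_measurable borel" and M: "\<And>x. norm (f x) \<le> M" and z: "\<And>x. x \<notin> ball c r \<Longrightarrow> f x = 0"
  shows integrable_bounded_ball: "integrable lborel f"
    and integrable_square_bounded_ball: "integrable lborel (\<lambda>x. (norm (f x))\<^sup>2)"
proof -
  have i: "integrable lborel (\<lambda>x. K * indicator (ball c r) x :: real)" for K
    by (intro integrable_mult_right integrable_real_indicator) (use emeasure_lborel_ball_finite[of c r] in auto)
  show "integrable lborel f"
    by (rule Bochner_Integration.integrable_bound[OF i[of M]])
       (use M z in \<open>auto intro!: AE_I2 simp: indicator_def intro: order_trans[OF _ abs_ge_self]\<close>)
  show "integrable lborel (\<lambda>x. (norm (f x))\<^sup>2)"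
    by (rule Bochner_Integration.integrable_bound[OF i[of "M\<^sup>2"]])
       (use M z in \<open>auto intro!: AE_I2 power_mono simp: indicator_def\<close>)
qed

lemma fourier_translate:
  fixes r :: "real^'n::finite \<Rightarrow> complex"
  assumes [measurable]: "r \<in> borel_measurable borel"
  shows "fourier (\<lambda>x. r (x + t)) \<xi> = cis (\<xi> \<bullet> t) * fourier r \<xi>"
proof -
  have "ft (-1) (\<lambda>x. r (x + t)) \<xi> = (LINT x|lborel. cis (- ((x + t - t) \<bullet> \<xi>)) * r (x + t))"
    by (simp add: ft_def)
  also have "\<dots> = (LINT x|lborel. cis (- ((x - t) \<bullet> \<xi>)) * r x)"
    by (rule integral_translate) measurable
  also have "\<dots> = (LINT x|lborel. cis (\<xi> \<bullet> t) * (cis (-1 * (x \<bullet> \<xi>)) * r x))"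
    by (intro Bochner_Integration.integral_cong refl)
       (simp add: mult.assoc[symmetric] cis_mult inner_diff_left inner_diff_right inner_commute)
  also have "\<dots> = cis (\<xi> \<bullet> t) * ft (-1) r \<xi>"
    unfolding ft_def by (rule integral_mult_right_zero)
  finally show ?thesis by (simp add: fourier_eq_ft)
qed

lemma norm_cis_minus_one_le: "norm (cis t - 1) \<le> \<bar>t\<bar>"
  using iexp_approx1[of t 0] by (simp add: cis_conv_exp)

lemma norm_cis_diff_le: "norm (cis a - cis b) \<le> \<bar>a - b\<bar>"
proof -
  have "cis a - cis b = cis b * (cis (a - b) - 1)"
    by (simp add: algebra_simps cis_mult)
  then show ?thesis using norm_cis_minus_one_le[of "a - b"] by (simp add: norm_mult)
qed

lemma cis_difference_quotient:
  assumes "\<And>k::nat. e k \<noteq> 0" "e \<longlonglongrightarrow> 0"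
  shows "(\<lambda>k. (cis (e k * y) - 1) /\<^sub>R e k) \<longlonglongrightarrow> \<i> * of_real y"
proof -
  let ?f = "\<lambda>z. exp (\<i> * of_real y * z)"
  have "(?f has_field_derivative \<i> * of_real y) (at 0)"
    by (auto intro!: derivative_eq_intros)
  then have "((\<lambda>z. (?f z - 1) / z) \<longlongrightarrow> \<i> * of_real y) (at 0)"
    by (simp add: DERIV_def)
  moreover have "filterlim (\<lambda>k. complex_of_real (e k)) (at 0) sequentially"
    using assms tendsto_of_real[OF assms(2)] by (auto simp: filterlim_at)
  ultimately have "(\<lambda>k. (?f (of_real (e k)) - 1) / of_real (e k)) \<longlonglongrightarrow> \<i> * of_real y"
    by (rule filterlim_compose)
  then show ?thesis
    by (simp add: cis_conv_exp scaleR_conv_of_real divide_inverse mult_ac)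
qed

text \<open>In the third estimate difference quotients replace derivatives: along an axis they are
  bounded by \<open>L\<close> and supported in a ball of radius \<open>2 * \<rho>\<close>, and their
  transforms are that of \<open>r\<close> times
  \<open>(cis (e k * \<xi> $ i) - 1) /\<^sub>R e k\<close>. Bessel's inequality for each quotient
  and Fatou's lemma give the bound for the component \<open>\<xi> $ i\<close>; summing over the
  components gives the factor \<open>CARD('n)\<close>.\<close>

lemma fourier_lipschitz_bounds:
  fixes r :: "real^'n::finite \<Rightarrow> complex"
  assumes M: "\<And>x. norm (r x) \<le> M" and L: "\<And>x y. norm (r x - r y) \<le> L * norm (x - y)"
    and z: "\<And>x. x \<notin> ball c \<rho> \<Longrightarrow> r x = 0" and \<rho>: "0 < \<rho>"
  shows "has_fourier r (fourier r)"
    and "(\<integral>\<^sup>+\<xi>. ennreal ((norm (fourier r \<xi>))\<^sup>2) \<partial>lborel) \<le> ennreal (M\<^sup>2 * (unit_ball_vol CARD('n) * \<rho> ^ CARD('n)))"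
    and "(\<integral>\<^sup>+\<xi>. ennreal ((norm \<xi>)\<^sup>2 * (norm (fourier r \<xi>))\<^sup>2) \<partial>lborel) \<le> ennreal (CARD('n) * (L\<^sup>2 * (unit_ball_vol CARD('n) * (2 * \<rho>) ^ CARD('n))))"
proof -
  have cont: "continuous_on UNIV r"
  proof (rule lipschitz_on_continuous_on)
    show "\<bar>L\<bar>-lipschitz_on UNIV r"
      using L by (intro lipschitz_onI) (auto simp: dist_norm intro: order_trans[OF L mult_right_mono])
  qed
  have [measurable]: "r \<in> borel_measurable borel" using cont by (rule borel_measurable_continuous_onI)
  note ir = integrable_bounded_ball[OF _ M z] integrable_square_bounded_ball[OF _ M z]
  show "has_fourier r (fourier r)" by (intro has_fourier_fourier ir) measurable
  have bess: "(\<integral>\<^sup>+\<xi>. ennreal ((norm (fourier f \<xi>))\<^sup>2) \<partial>lborel) \<le> (\<integral>\<^sup>+\<xi>. ennreal ((norm (f \<xi>))\<^sup>2) \<partial>lborel)"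
    if "integrable lborel f" for f :: "real^'n \<Rightarrow> complex"
    using bessel_normalized[OF that, of "-1"] unfolding fourier_eq_ft by simp
  show "(\<integral>\<^sup>+\<xi>. ennreal ((norm (fourier r \<xi>))\<^sup>2) \<partial>lborel) \<le> ennreal (M\<^sup>2 * (unit_ball_vol CARD('n) * \<rho> ^ CARD('n)))"
    using order_trans[OF bess[OF ir(1)] nn_integral_square_ball_le[OF M z]] \<rho> by simp
  have fm[measurable]: "fourier r \<in> borel_measurable borel"
    unfolding fourier_eq_ft[abs_def] by measurable
  let ?B = "ennreal (L\<^sup>2 * (unit_ball_vol CARD('n) * (2 * \<rho>) ^ CARD('n)))"
  \<comment> \<open>Steps of at most \<rho> keep the shifted supports inside the ball of radius
    \<open>2 * \<rho>\<close>.\<close>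
  define e where "e k = \<rho> / real (Suc k)" for k
  have e: "e k > 0" "e k \<le> \<rho>" for k using \<rho> by (auto simp: e_def field_simps)
  have e0: "e \<longlonglongrightarrow> 0"
    using tendsto_mult_right_zero[OF LIMSEQ_Suc[OF lim_1_over_n], of \<rho>] unfolding e_def by simp
  have comp: "(\<integral>\<^sup>+\<xi>. ennreal ((\<xi> $ i)\<^sup>2 * (norm (fourier r \<xi>))\<^sup>2) \<partial>lborel) \<le> ?B" for i
  proof -
    define g where "g k x = (r (x + e k *\<^sub>R axis i 1) - r x) * of_real (1 / e k)" for k x
    have gL: "norm (g k x) \<le> L" for k x
      using L[of "x + e k *\<^sub>R axis i 1" x] e(1)[of k] by (simp add: g_def norm_mult norm_divide field_simps)
    have gz: "g k x = 0" if x: "x \<notin> ball c (2 * \<rho>)" for k x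
    proof -
      have "dist c x \<le> dist c (x + e k *\<^sub>R axis i 1) + dist (x + e k *\<^sub>R axis i 1) x" by (rule dist_triangle)
      then have "\<rho> \<le> dist c (x + e k *\<^sub>R axis i 1)" using x e[of k] by (simp add: dist_norm[of "x + _" x])
      then show ?thesis using x \<rho> by (simp add: g_def z)
    qed
    have ig: "integrable lborel (g k)" for k
      by (rule integrable_bounded_ball[OF _ gL gz]) (unfold g_def, measurable)
    have fg: "fourier (g k) \<xi> = ((cis (e k * \<xi> $ i) - 1) /\<^sub>R e k) * fourier r \<xi>" for k \<xi>
    proof -
      have i1: "integrable lborel (\<lambda>x. cis (-1 * (x \<bullet> \<xi>)) * r (x + e k *\<^sub>R axis i 1))"
        by (rule integrable_cis_mult[OF integrable_translate[OF ir(1)]]) measurable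
      have i2: "integrable lborel (\<lambda>x. cis (-1 * (x \<bullet> \<xi>)) * r x)"
        by (rule integrable_cis_mult[OF ir(1)]) measurable
      have "ft (-1) (g k) \<xi> = (LINT x|lborel. (cis (-1 * (x \<bullet> \<xi>)) * r (x + e k *\<^sub>R axis i 1) - cis (-1 * (x \<bullet> \<xi>)) * r x) * of_real (1 / e k))"
        unfolding ft_def g_def by (intro Bochner_Integration.integral_cong refl) (simp add: algebra_simps)
      also have "\<dots> = (ft (-1) (\<lambda>x. r (x + e k *\<^sub>R axis i 1)) \<xi> - ft (-1) r \<xi>) * of_real (1 / e k)"
        unfolding ft_def Bochner_Integration.integral_diff[OF i1 i2, symmetric] by (rule integral_mult_left_zero)
      finally have "fourier (g k) \<xi> = (fourier (\<lambda>x. r (x + e k *\<^sub>R axis i 1)) \<xi> - fourier r \<xi>) * of_real (1 / e k)"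
        unfolding fourier_eq_ft by (simp only: right_diff_distrib[symmetric] mult.assoc)
      also have "\<dots> = ((cis (e k * \<xi> $ i) - 1) /\<^sub>R e k) * fourier r \<xi>"
      proof -
        have "fourier (\<lambda>x. r (x + e k *\<^sub>R axis i 1)) \<xi> = cis (e k * \<xi> $ i) * fourier r \<xi>"
          by (simp add: fourier_translate inner_axis)
        then show ?thesis by (simp add: scaleR_conv_of_real divide_inverse algebra_simps)
      qed
      finally show ?thesis .
    qed
    have lim: "(\<lambda>k. ennreal ((norm (fourier (g k) \<xi>))\<^sup>2)) \<longlonglongrightarrow> ennreal ((\<xi> $ i)\<^sup>2 * (norm (fourier r \<xi>))\<^sup>2)" for \<xi>
    proof -
      have "(\<lambda>k. (norm (fourier (g k) \<xi>))\<^sup>2) \<longlonglongrightarrow> (norm (\<i> * of_real (\<xi> $ i) * fourier r \<xi>))\<^sup>2"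
        unfolding fg using e(1) by (intro tendsto_intros cis_difference_quotient e0) (simp add: less_imp_neq[symmetric])
      also have "(norm (\<i> * of_real (\<xi> $ i) * fourier r \<xi>))\<^sup>2 = (\<xi> $ i)\<^sup>2 * (norm (fourier r \<xi>))\<^sup>2"
        by (simp add: norm_mult power_mult_distrib)
      finally show ?thesis by (rule tendsto_ennrealI)
    qed
    have "(\<integral>\<^sup>+\<xi>. ennreal ((\<xi> $ i)\<^sup>2 * (norm (fourier r \<xi>))\<^sup>2) \<partial>lborel) = (\<integral>\<^sup>+\<xi>. liminf (\<lambda>k. ennreal ((norm (fourier (g k) \<xi>))\<^sup>2)) \<partial>lborel)"
      using lim_imp_Liminf[OF _ lim] by simp
    also have "\<dots> \<le> liminf (\<lambda>k. \<integral>\<^sup>+\<xi>. ennreal ((norm (fourier (g k) \<xi>))\<^sup>2) \<partial>lborel)"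
      by (rule nn_integral_liminf) (unfold fg, measurable)
    also have "\<dots> \<le> ?B"
    proof (intro Liminf_le always_eventually allI)
      fix k
      show "(\<integral>\<^sup>+\<xi>. ennreal ((norm (fourier (g k) \<xi>))\<^sup>2) \<partial>lborel) \<le> ?B"
      proof -
        have "(\<integral>\<^sup>+\<xi>. ennreal ((norm (g k \<xi>))\<^sup>2) \<partial>lborel) \<le> ennreal (L\<^sup>2 * (unit_ball_vol (DIM(real^'n)) * (2 * \<rho>) ^ DIM(real^'n)))"
          using \<rho> by (intro nn_integral_square_ball_le[of _ _ c] gL gz) auto
        from order_trans[OF bess[OF ig] this] show ?thesis by simp
      qed
    qed simp
    finally show ?thesis .
  qed
  have "(\<integral>\<^sup>+\<xi>. ennreal ((norm \<xi>)\<^sup>2 * (norm (fourier r \<xi>))\<^sup>2) \<partial>lborel) = (\<integral>\<^sup>+\<xi>. (\<Sum>i\<in>UNIV. ennreal ((\<xi> $ i)\<^sup>2 * (norm (fourier r \<xi>))\<^sup>2)) \<partial>lborel)"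
    by (intro nn_integral_cong) (simp add: norm_vec_def L2_set_def sum_nonneg sum_distrib_right)
  also have "\<dots> = (\<Sum>i\<in>UNIV. \<integral>\<^sup>+\<xi>. ennreal ((\<xi> $ i)\<^sup>2 * (norm (fourier r \<xi>))\<^sup>2) \<partial>lborel)"
    by (rule nn_integral_sum) measurable
  also have "\<dots> \<le> (\<Sum>i\<in>(UNIV::'n set). ?B)"
    by (intro sum_mono comp)
  also have "\<dots> = ennreal (CARD('n) * (L\<^sup>2 * (unit_ball_vol CARD('n) * (2 * \<rho>) ^ CARD('n))))"
    using \<rho> by (simp add: ennreal_mult ennreal_of_nat_eq_real_of_nat)
  finally show "(\<integral>\<^sup>+\<xi>. ennreal ((norm \<xi>)\<^sup>2 * (norm (fourier r \<xi>))\<^sup>2) \<partial>lborel) \<le> ennreal (CARD('n) * (L\<^sup>2 * (unit_ball_vol CARD('n) * (2 * \<rho>) ^ CARD('n))))" .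
qed

section \<open>Scalar inequalities between Sobolev weights and Gaussian multipliers\<close>

lemma powr_le_one_add:
  assumes "0 \<le> x" "0 \<le> p" "p \<le> 1"
  shows "x powr p \<le> 1 + (x::real)"
proof (cases "x \<le> 1")
  case True
  then have "x powr p \<le> 1" using assms by (intro powr_le1) auto
  then show ?thesis using assms by simp
next
  case False
  then have "x powr p \<le> x powr 1" using assms by (intro powr_mono) auto
  then show ?thesis using assms by simp
qed

text \<open>\<open>y\<close> stands for the squared frequency. The previous inequality at
  \<open>h\<^sup>2 * (1 + y)\<close> dominates the weight of order \<open>p\<close> by those of
  orders 0 and 1 at scale \<open>h\<close>, with a constant that does not depend on
  \<open>p\<close>; this takes the place of an interpolation theorem.\<close>

lemma powr_mult_one_add_le:
  fixes h y p :: real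
  assumes h: "0 < h" "h \<le> 1" and y: "0 \<le> y" and p: "0 \<le> p" "p \<le> 1"
  shows "(1 + y) powr p \<le> h powr (- 2 * p) * (2 + h\<^sup>2 * y)"
proof -
  have h2: "h\<^sup>2 \<le> 1" using h by (simp add: power_le_one)
  have "(h\<^sup>2 * (1 + y)) powr p \<le> 1 + h\<^sup>2 * (1 + y)"
    using p y by (intro powr_le_one_add) auto
  also have "\<dots> \<le> 2 + h\<^sup>2 * y" using h2 by (simp add: algebra_simps)
  finally have "(h\<^sup>2 * (1 + y)) powr p \<le> 2 + h\<^sup>2 * y" .
  moreover have "(h\<^sup>2 * (1 + y)) powr p = h powr (2 * p) * (1 + y) powr p"
  proof -
    have "h\<^sup>2 = h powr 2" using h by simp
    then show ?thesis using h y by (simp only: powr_mult powr_powr)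
  qed
  moreover have "h powr (- 2 * p) * h powr (2 * p) = 1"
    using h by (simp flip: powr_add)
  ultimately show ?thesis
    using mult_left_mono[of "(h\<^sup>2 * (1 + y)) powr p" "2 + h\<^sup>2 * y" "h powr (- 2 * p)"]
    by (simp add: mult.assoc[symmetric])
qed

text \<open>The price of raising the order from \<open>s\<close> to \<open>t\<close>. The
  exponential is the square of the multiplier \<open>gauss (h\<^sup>2)\<close>; it absorbs the
  growth of the weight of order \<open>t - s\<close> because \<open>2 + x \<le> 2 * exp x\<close>
  for nonnegative \<open>x\<close>.\<close>

lemma weight_mult_gauss_le:
  fixes h y s t :: real
  assumes h: "0 < h" "h \<le> 1" and y: "0 \<le> y" and st: "0 \<le> s" "s \<le> t" "t \<le> 1"
  shows "(1 + y) powr t * exp (- (h\<^sup>2 * y)) \<le> 2 * h powr (2 * (s - t)) * (1 + y) powr s"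
proof -
  have "(1 + y) powr (t - s) \<le> h powr (- 2 * (t - s)) * (2 + h\<^sup>2 * y)"
    using assms by (intro powr_mult_one_add_le) auto
  then have "(1 + y) powr (t - s) * exp (- (h\<^sup>2 * y)) \<le> h powr (- 2 * (t - s)) * (2 + h\<^sup>2 * y) * exp (- (h\<^sup>2 * y))"
    by (rule mult_right_mono) simp
  also have "\<dots> \<le> h powr (- 2 * (t - s)) * 2"
  proof -
    have "(2 + h\<^sup>2 * y) \<le> 2 * exp (h\<^sup>2 * y)"
    proof -
      have "0 \<le> h\<^sup>2 * y" using y by simp
      then show ?thesis using exp_ge_add_one_self[of "h\<^sup>2 * y"] by linarith
    qed
    then have "(2 + h\<^sup>2 * y) * exp (- (h\<^sup>2 * y)) \<le> 2" by (simp add: exp_minus field_simps)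
    then show ?thesis by (simp add: mult.assoc mult_left_mono)
  qed
  finally have "(1 + y) powr s * ((1 + y) powr (t - s) * exp (- (h\<^sup>2 * y))) \<le> (1 + y) powr s * (h powr (- 2 * (t - s)) * 2)"
    by (rule mult_left_mono) simp
  moreover have "(1 + y) powr s * ((1 + y) powr (t - s) * exp (- (h\<^sup>2 * y))) = (1 + y) powr t * exp (- (h\<^sup>2 * y))"
    by (simp only: mult.assoc[symmetric]) (simp flip: powr_add)
  moreover have "- 2 * (t - s) = 2 * (s - t)" by simp
  ultimately show ?thesis by (simp only: mult_ac)
qed

text \<open>The error of smoothing at scale \<open>h\<close>, measured against a smoothing with a
  smaller parameter \<epsilon> that later tends to 0. The difference of the exponentials is
  nonnegative and at most the minimum of 1 and \<open>h\<^sup>2 * (1 + y)\<close>, hence at most the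
  power of order \<open>s\<close> of the latter, and so is its square.\<close>

lemma gauss_diff_square_le:
  fixes h y s \<epsilon> :: real
  assumes h: "0 < h" "h \<le> 1" and y: "0 \<le> y" and s: "0 \<le> s" "s \<le> 1" and e: "0 \<le> \<epsilon>" "\<epsilon> \<le> h\<^sup>2"
  shows "(exp (- (\<epsilon> / 2) * y) - exp (- (h\<^sup>2 / 2) * y))\<^sup>2 \<le> h powr (2 * s) * (1 + y) powr s"
proof -
  let ?z = "h\<^sup>2 * (1 + y)" and ?d = "exp (- (\<epsilon> / 2) * y) - exp (- (h\<^sup>2 / 2) * y)"
  have z: "0 \<le> ?z" using y by simp
  have d0: "0 \<le> ?d" using e y by (simp add: mult_right_mono)
  have "exp (- (\<epsilon> / 2) * y) \<le> 1" using e y by simp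
  moreover have "1 - h\<^sup>2 / 2 * y \<le> exp (- (h\<^sup>2 / 2) * y)"
    using exp_ge_add_one_self[of "- (h\<^sup>2 / 2) * y"] by simp
  moreover have "h\<^sup>2 / 2 * y \<le> ?z" using y by (simp add: algebra_simps)
  moreover have "0 \<le> exp (- (h\<^sup>2 / 2) * y)" by simp
  ultimately have d: "?d \<le> 1" "?d \<le> ?z" by linarith+
  have "?d \<le> ?z powr s"
  proof (cases "?z \<le> 1")
    case True
    have "?z > 0" using h y by (simp add: add_pos_nonneg)
    then have "?z powr 1 \<le> ?z powr s" using True s by (intro powr_mono') auto
    then show ?thesis using d z by simp
  next
    case False
    then have "1 \<le> ?z powr s" using s by (intro ge_one_powr_ge_zero) auto
    then show ?thesis using d by simp
  qed
  moreover have "?d\<^sup>2 \<le> ?d" using d d0 by (simp add: power2_eq_square mult_left_le)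
  moreover have "?z powr s = h powr (2 * s) * (1 + y) powr s"
  proof -
    have "h\<^sup>2 = h powr 2" using h by simp
    then show ?thesis using h y by (simp only: powr_mult powr_powr)
  qed
  ultimately show ?thesis by linarith
qed

section \<open>Gaussian smoothing\<close>

lemma nn_integral_sobolev_weight:
  assumes "integrable lborel (sobolev_weight s v)"
  shows "(\<integral>\<^sup>+\<xi>. ennreal (sobolev_weight s v \<xi>) \<partial>lborel) = ennreal (LINT \<xi>|lborel. sobolev_weight s v \<xi>)"
  by (rule nn_integral_eq_integral[OF assms]) (simp add: sobolev_weight_def)

lemma ennreal_le_sqrt:
  assumes "(x::ennreal)\<^sup>2 \<le> ennreal B"
  shows "x \<le> ennreal (sqrt B)"
proof (cases x rule: ennreal_cases)
  case (real r)
  show ?thesis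
  proof (cases "0 \<le> B")
    case True
    then have "r\<^sup>2 \<le> B" using assms real by (simp add: ennreal_power)
    then have "r \<le> sqrt B" using real by (intro real_le_rsqrt)
    then show ?thesis using real by (simp add: ennreal_leI)
  next
    case False
    then have "r\<^sup>2 \<le> 0" using assms real by (simp add: ennreal_power ennreal_neg)
    then show ?thesis using real by simp
  qed
next
  case top
  then show ?thesis using assms by (simp add: power2_eq_square ennreal_top_mult top_unique)
qed

text \<open>The expression left over by the Cauchy-Schwarz inequality in the Lipschitz estimate.
  Half of the exponential pays for \<open>2 + x \<le> 2 * exp (x / 2)\<close>, and the other half
  keeps the expression integrable.\<close>

lemma first_moment_gauss_le:
  fixes h y s :: real
  assumes h: "0 < h" "h \<le> 1" and y: "0 \<le> y" and s: "0 \<le> s" "s \<le> 1"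
  shows "y * (1 + y) powr (- s) * exp (- (h\<^sup>2 * y)) \<le> 2 * h powr (2 * s - 2) * exp (- (h\<^sup>2 / 2) * y)"
proof -
  have "y * (1 + y) powr (- s) \<le> (1 + y) powr 1 * (1 + y) powr (- s)"
    using y by (intro mult_right_mono) auto
  also have "\<dots> = (1 + y) powr (1 - s)"
    using powr_add[of "1 + y" 1 "- s"] by (simp only: diff_conv_add_uminus)
  also have "\<dots> \<le> h powr (- 2 * (1 - s)) * (2 + h\<^sup>2 * y)"
    using assms by (intro powr_mult_one_add_le) auto
  also have "\<dots> \<le> h powr (- 2 * (1 - s)) * (2 * exp (h\<^sup>2 / 2 * y))"
  proof (rule mult_left_mono)
    show "2 + h\<^sup>2 * y \<le> 2 * exp (h\<^sup>2 / 2 * y)"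
      using exp_ge_add_one_self[of "h\<^sup>2 / 2 * y"] by linarith
  qed simp
  finally have "y * (1 + y) powr (- s) * exp (- (h\<^sup>2 * y)) \<le> h powr (- 2 * (1 - s)) * (2 * exp (h\<^sup>2 / 2 * y)) * exp (- (h\<^sup>2 * y))"
    by (rule mult_right_mono) simp
  also have "\<dots> = 2 * h powr (2 * s - 2) * exp (- (h\<^sup>2 / 2) * y)"
    by (simp add: mult.assoc mult_exp_exp)
  finally show ?thesis .
qed

text \<open>A Lipschitz bound for a Fourier integral is a bound for the first absolute moment of its
  density. The Cauchy-Schwarz inequality separates the weighted \<open>v\<close> from the moment of
  the Gaussian, and the total mass of the Gaussian brings in the power of \<open>h\<close> that
  depends on the dimension.\<close>

lemma smoothing_lipschitz:
  fixes v :: "real^'n::finite \<Rightarrow> complex"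
  assumes v: "square_integrable v" and w: "integrable lborel (sobolev_weight s v)"
    and h: "0 < h" "h \<le> 1" and s: "0 \<le> s" "s \<le> 1"
  defines "P \<equiv> \<lambda>x. of_real (fourier_const CARD('n)) * ft 1 (\<lambda>\<xi>. v \<xi> * of_real (gauss (h\<^sup>2) \<xi>)) x"
  shows "norm (P x - P y) \<le> fourier_const CARD('n) * sqrt (2 * sqrt (2 * pi) ^ CARD('n)) *
    (h powr (s - real CARD('n) / 2) * sqrt (LINT \<xi>|lborel. sobolev_weight s v \<xi>)) / h * norm (x - y)"
proof -
  let ?n = "CARD('n)"
  let ?N = "LINT \<xi>|lborel. sobolev_weight s v \<xi>"
  note [measurable] = square_integrableD(1)[OF v]
  have N0: "0 \<le> ?N" by (simp add: sobolev_weight_def)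
  \<comment> \<open>The weight of order \<open>s / 2\<close> is put on \<open>v\<close> and its
    inverse on the Gaussian, so that the square of \<open>f\<close> is exactly
    \<open>sobolev_weight s v\<close>.\<close>
  define f where "f \<xi> = (1 + (norm \<xi>)\<^sup>2) powr (s / 2) * norm (v \<xi>)" for \<xi>
  define g where "g \<xi> = norm \<xi> * (1 + (norm \<xi>)\<^sup>2) powr (- s / 2) * gauss (h\<^sup>2) \<xi>" for \<xi> :: "real^'n"
  have [measurable]: "f \<in> borel_measurable borel" "g \<in> borel_measurable borel"
    unfolding f_def g_def by measurable
  have fg: "f \<xi> * g \<xi> = norm \<xi> * norm (v \<xi>) * gauss (h\<^sup>2) \<xi>" for \<xi>
  proof -
    have "(1 + (norm \<xi>)\<^sup>2) powr (s / 2) * (1 + (norm \<xi>)\<^sup>2) powr (- s / 2) = 1"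
      by (simp add: add_nonneg_eq_0_iff flip: powr_add)
    then show ?thesis by (simp add: f_def g_def mult_ac)
  qed
  have f0: "0 \<le> f \<xi>" "0 \<le> g \<xi>" for \<xi> by (auto simp: f_def g_def gauss_pos less_imp_le)
  have f2: "(f \<xi>)\<^sup>2 = sobolev_weight s v \<xi>" for \<xi>
  proof -
    have "((1 + (norm \<xi>)\<^sup>2) powr (s / 2))\<^sup>2 = (1 + (norm \<xi>)\<^sup>2) powr s"
      by (simp add: power2_eq_square flip: powr_add)
    then show ?thesis by (simp add: f_def sobolev_weight_def power_mult_distrib)
  qed
  have g2: "(g \<xi>)\<^sup>2 \<le> 2 * h powr (2 * s - 2) * gauss (h\<^sup>2) \<xi>" for \<xi>
  proof -
    have "(g \<xi>)\<^sup>2 = (norm \<xi>)\<^sup>2 * (1 + (norm \<xi>)\<^sup>2) powr (- s) * exp (- (h\<^sup>2 * (norm \<xi>)\<^sup>2))"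
      by (simp add: g_def gauss_def power_mult_distrib) (simp add: power2_eq_square mult_exp_exp flip: powr_add)
    also have "\<dots> \<le> 2 * h powr (2 * s - 2) * exp (- (h\<^sup>2 / 2) * (norm \<xi>)\<^sup>2)"
      by (rule first_moment_gauss_le[OF h _ s]) simp
    finally show ?thesis by (simp add: gauss_def)
  qed
  let ?I = "\<integral>\<^sup>+\<xi>. ennreal (f \<xi>) * ennreal (g \<xi>) \<partial>lborel"
  let ?B = "2 * h powr (2 * s - 2) * sqrt (2 * pi / h\<^sup>2) ^ ?n"
  have h2: "0 < h\<^sup>2" using h by simp
  have "?I\<^sup>2 \<le> (\<integral>\<^sup>+\<xi>. (ennreal (f \<xi>))\<^sup>2 \<partial>lborel) * (\<integral>\<^sup>+\<xi>. (ennreal (g \<xi>))\<^sup>2 \<partial>lborel)"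
    by (rule Cauchy_Schwarz_nn_integral) measurable
  also have "(\<integral>\<^sup>+\<xi>. (ennreal (f \<xi>))\<^sup>2 \<partial>lborel) = ennreal ?N"
    by (simp add: ennreal_power f0 f2 nn_integral_sobolev_weight[OF w])
  also have "(\<integral>\<^sup>+\<xi>. (ennreal (g \<xi>))\<^sup>2 \<partial>lborel) \<le> (\<integral>\<^sup>+\<xi>. ennreal (2 * h powr (2 * s - 2) * gauss (h\<^sup>2) (\<xi>::real^'n)) \<partial>lborel)"
    by (intro nn_integral_mono) (simp add: ennreal_power f0 ennreal_leI[OF g2])
  also have "\<dots> = ennreal (LINT \<xi>|lborel. 2 * h powr (2 * s - 2) * gauss (h\<^sup>2) (\<xi>::real^'n))"
    by (intro nn_integral_eq_integral integrable_mult_right integrable_gauss h2) (simp add: gauss_pos less_imp_le)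
  also have "\<dots> = ennreal ?B" using integral_gauss[OF h2, where 'a="real^'n"] by simp
  finally have "?I\<^sup>2 \<le> ennreal (?N * ?B)"
    using N0 h by (simp add: ennreal_mult mult_left_mono)
  then have I: "?I \<le> ennreal (sqrt (?N * ?B))" by (rule ennreal_le_sqrt)
  let ?q = "\<lambda>\<xi>. v \<xi> * complex_of_real (gauss (h\<^sup>2) \<xi>)"
  have iq: "integrable lborel (\<lambda>\<xi>. cis (1 * (\<xi> \<bullet> z)) * ?q \<xi>)" for z
    by (intro integrable_cis_mult integrable_mult_gauss v h2) measurable
  have eq: "ft 1 ?q x - ft 1 ?q y = (LINT \<xi>|lborel. cis (1 * (\<xi> \<bullet> x)) * ?q \<xi> - cis (1 * (\<xi> \<bullet> y)) * ?q \<xi>)"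
    unfolding ft_def by (rule Bochner_Integration.integral_diff[OF iq iq, symmetric])
  have "ennreal (norm (ft 1 ?q x - ft 1 ?q y)) \<le> (\<integral>\<^sup>+\<xi>. ennreal (norm (cis (1 * (\<xi> \<bullet> x)) * ?q \<xi> - cis (1 * (\<xi> \<bullet> y)) * ?q \<xi>)) \<partial>lborel)"
    unfolding eq by (intro integral_norm_bound_ennreal Bochner_Integration.integrable_diff iq)
  also have "\<dots> \<le> (\<integral>\<^sup>+\<xi>. ennreal (norm (x - y)) * (ennreal (f \<xi>) * ennreal (g \<xi>)) \<partial>lborel)"
  proof (rule nn_integral_mono)
    fix \<xi>
    have "norm (cis (1 * (\<xi> \<bullet> x)) * ?q \<xi> - cis (1 * (\<xi> \<bullet> y)) * ?q \<xi>) = norm (cis (\<xi> \<bullet> x) - cis (\<xi> \<bullet> y)) * (norm (v \<xi>) * gauss (h\<^sup>2) \<xi>)"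
      unfolding left_diff_distrib[symmetric] norm_mult by (simp add: gauss_pos less_imp_le)
    also have "\<dots> \<le> (norm \<xi> * norm (x - y)) * (norm (v \<xi>) * gauss (h\<^sup>2) \<xi>)"
    proof (rule mult_right_mono)
      have "norm (cis (\<xi> \<bullet> x) - cis (\<xi> \<bullet> y)) \<le> \<bar>\<xi> \<bullet> (x - y)\<bar>"
        using norm_cis_diff_le[of "\<xi> \<bullet> x" "\<xi> \<bullet> y"] by (simp add: inner_diff_right)
      also have "\<dots> \<le> norm \<xi> * norm (x - y)" by (rule Cauchy_Schwarz_ineq2)
      finally show "norm (cis (\<xi> \<bullet> x) - cis (\<xi> \<bullet> y)) \<le> norm \<xi> * norm (x - y)" .
    qed (simp add: gauss_pos less_imp_le)
    also have "\<dots> = norm (x - y) * (f \<xi> * g \<xi>)" unfolding fg by (simp add: mult_ac)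
    finally show "ennreal (norm (cis (1 * (\<xi> \<bullet> x)) * ?q \<xi> - cis (1 * (\<xi> \<bullet> y)) * ?q \<xi>)) \<le> ennreal (norm (x - y)) * (ennreal (f \<xi>) * ennreal (g \<xi>))"
      using f0 by (simp add: ennreal_mult[symmetric] ennreal_leI)
  qed
  also have "\<dots> = ennreal (norm (x - y)) * ?I" by (rule nn_integral_cmult) measurable
  also have "\<dots> \<le> ennreal (norm (x - y)) * ennreal (sqrt (?N * ?B))" by (intro mult_left_mono I) simp
  finally have "norm (ft 1 ?q x - ft 1 ?q y) \<le> norm (x - y) * sqrt (?N * ?B)"
    using N0 h by (simp add: ennreal_mult[symmetric])
  then have "fourier_const ?n * norm (ft 1 ?q x - ft 1 ?q y) \<le> fourier_const ?n * (norm (x - y) * sqrt (?N * ?B))"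
    by (rule mult_left_mono) (simp add: fourier_const_pos less_imp_le)
  moreover have "norm (P x - P y) = fourier_const ?n * norm (ft 1 ?q x - ft 1 ?q y)"
    unfolding P_def right_diff_distrib[symmetric] norm_mult by (simp add: fourier_const_pos less_imp_le)
  moreover have "sqrt (?N * ?B) = sqrt (2 * sqrt (2 * pi) ^ ?n) * (h powr (s - real ?n / 2) * sqrt ?N) / h"
  proof -
    \<comment> \<open>The power from the moment and the power from the mass of the Gaussian combine
      to a perfect square, whose root is the asserted scale.\<close>
    have p1: "h powr (2 * s - 2) * (1 / h) ^ ?n = (h powr (s - real ?n / 2) / h)\<^sup>2"
    proof -
      have "h powr (2 * s - 2) * (1 / h) ^ ?n = h powr (2 * s - 2) * h powr (- real ?n)"
        using h by (simp add: powr_minus powr_realpow power_one_over inverse_eq_divide)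
      also have "\<dots> = (h powr (s - real ?n / 2 - 1))\<^sup>2"
        unfolding power2_eq_square powr_add[symmetric] by (simp add: algebra_simps)
      also have "h powr (s - real ?n / 2 - 1) = h powr (s - real ?n / 2) / h" using h by (simp add: powr_diff)
      finally show ?thesis .
    qed
    have p2: "sqrt (2 * pi / h\<^sup>2) ^ ?n = sqrt (2 * pi) ^ ?n * (1 / h) ^ ?n"
      using h by (simp add: real_sqrt_divide flip: power_mult_distrib)
    have e: "?N * ?B = ?N * (2 * sqrt (2 * pi) ^ ?n) * (h powr (s - real ?n / 2) / h)\<^sup>2"
      unfolding p2 p1[symmetric] by (simp only: mult_ac)
    show ?thesis unfolding e using h by (simp add: real_sqrt_mult mult_ac)
  qed
  ultimately show ?thesis by (simp add: mult_ac)
qed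

lemma smoothing_L2:
  fixes u v W :: "real^'n::finite \<Rightarrow> complex"
  assumes uv: "has_fourier u v" and w: "integrable lborel (sobolev_weight s v)"
    and h: "0 < h" "h \<le> 1" and s: "0 \<le> s" "s \<le> 1"
    and W: "continuous_on UNIV W" "\<And>y. y \<in> ball c r \<Longrightarrow> norm (W y) \<le> C"
    and eq: "AE y in lborel. y \<in> ball c r \<longrightarrow> u y = W y"
  defines "P \<equiv> \<lambda>x. of_real (fourier_const CARD('n)) * ft 1 (\<lambda>\<xi>. v \<xi> * of_real (gauss (h\<^sup>2) \<xi>)) x"
  shows "(\<integral>\<^sup>+x. ennreal ((norm (W x - P x))\<^sup>2) * indicator (ball c r) x \<partial>lborel)
    \<le> ennreal (h powr (2 * s) * (LINT \<xi>|lborel. sobolev_weight s v \<xi>))"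
proof -
  let ?n = "CARD('n)" and ?k = "complex_of_real (fourier_const CARD('n))"
  have u: "square_integrable u" and v: "square_integrable v" using uv unfolding has_fourier_def by auto
  note [measurable] = square_integrableD(1)[OF v] borel_measurable_continuous_onI[OF W(1)]
  let ?e = "\<lambda>k. 1 / real (Suc k)"
  have h2: "0 < h\<^sup>2" using h by simp
  let ?G = "\<lambda>e \<xi>. v \<xi> * complex_of_real (gauss e \<xi>)"
  define D where "D k x = ?k * ft 1 (\<lambda>\<xi>. ?G (?e k) \<xi> - ?G (h\<^sup>2) \<xi>) x" for k x
  have iG: "integrable lborel (?G e)" if "0 < e" for e by (rule integrable_mult_gauss(1)[OF v that])
  have D: "D k x = (LINT y|lborel. u y * of_real (heat (?e k) (y - x))) - P x" for k x
  proof -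
    have i: "integrable lborel (\<lambda>\<xi>. cis (1 * (\<xi> \<bullet> x)) * ?G e \<xi>)" if "0 < e" for e
      by (intro integrable_cis_mult iG that) measurable
    have "ft 1 (\<lambda>\<xi>. ?G (?e k) \<xi> - ?G (h\<^sup>2) \<xi>) x = ft 1 (?G (?e k)) x - ft 1 (?G (h\<^sup>2)) x"
      unfolding ft_def right_diff_distrib by (rule Bochner_Integration.integral_diff; rule i) (use h2 in auto)
    then have "D k x = ?k * ft 1 (?G (?e k)) x - P x" by (simp only: D_def P_def right_diff_distrib)
    also have "?k * ft 1 (?G (?e k)) x = (LINT y|lborel. u y * of_real (heat (?e k) (y - x)))"
      by (rule has_fourier_heat[OF uv]) simp
    finally show ?thesis .
  qed
  have lim: "(\<lambda>k. D k x) \<longlonglongrightarrow> W x - P x" if "x \<in> ball c r" for x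
    unfolding D by (intro tendsto_diff tendsto_const heat_tendsto_square_integrable[OF u W eq that])
  have m[measurable]: "D k \<in> borel_measurable borel" for k unfolding D_def by measurable
  have "(\<integral>\<^sup>+x. ennreal ((norm (W x - P x))\<^sup>2) * indicator (ball c r) x \<partial>lborel) \<le> (\<integral>\<^sup>+x. liminf (\<lambda>k. ennreal ((norm (D k x))\<^sup>2)) \<partial>lborel)"
  proof (rule nn_integral_mono)
    fix x
    show "ennreal ((norm (W x - P x))\<^sup>2) * indicator (ball c r) x \<le> liminf (\<lambda>k. ennreal ((norm (D k x))\<^sup>2))"
    proof (cases "x \<in> ball c r")
      case True
      have "(\<lambda>k. ennreal ((norm (D k x))\<^sup>2)) \<longlonglongrightarrow> ennreal ((norm (W x - P x))\<^sup>2)"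
        by (intro tendsto_ennrealI tendsto_power tendsto_norm lim True)
      from lim_imp_Liminf[OF _ this] True show ?thesis by simp
    qed simp
  qed
  also have "\<dots> \<le> liminf (\<lambda>k. \<integral>\<^sup>+x. ennreal ((norm (D k x))\<^sup>2) \<partial>lborel)"
    by (rule nn_integral_liminf) measurable
  also have "\<dots> \<le> ennreal (h powr (2 * s) * (LINT \<xi>|lborel. sobolev_weight s v \<xi>))"
  proof (rule Liminf_le)
    \<comment> \<open>From this index on the smoothing parameter is below \<open>h\<^sup>2\<close>,
      as the comparison of the two multipliers requires.\<close>
    obtain K where K: "1 / h\<^sup>2 < real K" using reals_Archimedean2 by blast
    show "\<forall>\<^sub>F k in sequentially. (\<integral>\<^sup>+x. ennreal ((norm (D k x))\<^sup>2) \<partial>lborel) \<le> ennreal (h powr (2 * s) * (LINT \<xi>|lborel. sobolev_weight s v \<xi>))"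
      using eventually_ge_at_top[of K]
    proof eventually_elim
      case (elim k)
      have ek: "0 \<le> ?e k" "?e k \<le> h\<^sup>2"
      proof -
        have "1 / h\<^sup>2 \<le> real (Suc k)" using K elim by linarith
        then show "?e k \<le> h\<^sup>2" using h2 by (simp add: field_simps)
      qed simp
      have "(\<integral>\<^sup>+x. ennreal ((norm (D k x))\<^sup>2) \<partial>lborel) \<le> (\<integral>\<^sup>+\<xi>. ennreal ((norm (?G (?e k) \<xi> - ?G (h\<^sup>2) \<xi>))\<^sup>2) \<partial>lborel)"
        unfolding D_def by (rule bessel_normalized) (use h2 in \<open>auto intro!: iG\<close>)
      also have "\<dots> \<le> (\<integral>\<^sup>+\<xi>. ennreal (h powr (2 * s)) * ennreal (sobolev_weight s v \<xi>) \<partial>lborel)"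
      proof (rule nn_integral_mono)
        fix \<xi>
        have "(norm (?G (?e k) \<xi> - ?G (h\<^sup>2) \<xi>))\<^sup>2 = (norm (v \<xi>))\<^sup>2 * (gauss (?e k) \<xi> - gauss (h\<^sup>2) \<xi>)\<^sup>2"
          unfolding right_diff_distrib[symmetric] norm_mult power_mult_distrib of_real_diff[symmetric] norm_of_real by simp
        also have "\<dots> \<le> (norm (v \<xi>))\<^sup>2 * (h powr (2 * s) * (1 + (norm \<xi>)\<^sup>2) powr s)"
          unfolding gauss_def using ek by (intro mult_left_mono gauss_diff_square_le h s) auto
        finally show "ennreal ((norm (?G (?e k) \<xi> - ?G (h\<^sup>2) \<xi>))\<^sup>2) \<le> ennreal (h powr (2 * s)) * ennreal (sobolev_weight s v \<xi>)"
          by (simp add: ennreal_mult[symmetric] sobolev_weight_def mult_ac ennreal_leI)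
      qed
      also have "\<dots> = ennreal (h powr (2 * s)) * (\<integral>\<^sup>+\<xi>. ennreal (sobolev_weight s v \<xi>) \<partial>lborel)"
        using w by (intro nn_integral_cmult) auto
      also have "\<dots> = ennreal (h powr (2 * s) * (LINT \<xi>|lborel. sobolev_weight s v \<xi>))"
        unfolding nn_integral_sobolev_weight[OF w]
        by (intro ennreal_mult[symmetric]) (auto simp: sobolev_weight_def)
      finally show ?case .
    qed
  qed simp
  finally show ?thesis .
qed

text \<open>Extracts one good point from an integral bound; the affine function will be determined
  from its values near such a point.\<close>

lemma exists_point_le_average:
  fixes F :: "'a::euclidean_space \<Rightarrow> ennreal"
  assumes [measurable]: "F \<in> borel_measurable borel" "A \<in> sets borel"
    and m: "emeasure lborel A = ennreal m" "0 < m" and B: "(\<integral>\<^sup>+x. F x * indicator A x \<partial>lborel) \<le> ennreal B"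
  shows "\<exists>x\<in>A. F x \<le> ennreal (B / m)"
proof (rule ccontr)
  assume "\<not> ?thesis"
  then have *: "\<And>x. x \<in> A \<Longrightarrow> ennreal (B / m) < F x" by (auto simp: not_le)
  have "(\<integral>\<^sup>+x. ennreal (B / m) * indicator A x \<partial>lborel) < (\<integral>\<^sup>+x. F x * indicator A x \<partial>lborel)"
  proof (rule nn_integral_less)
    show "(\<integral>\<^sup>+x. ennreal (B / m) * indicator A x \<partial>lborel) \<noteq> \<infinity>"
      using m by (simp add: nn_integral_cmult_indicator ennreal_mult_eq_top_iff)
    show "AE x in lborel. ennreal (B / m) * indicator A x \<le> F x * indicator A x"
      using * by (auto simp: indicator_def less_imp_le)
    show "\<not> (AE x in lborel. F x * indicator A x \<le> ennreal (B / m) * indicator A x)"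
    proof
      assume "AE x in lborel. F x * indicator A x \<le> ennreal (B / m) * indicator A x"
      then have "AE x in lborel. x \<notin> A"
        by eventually_elim (use * in \<open>auto simp: indicator_def not_le[symmetric] split: if_splits\<close>)
      then have "emeasure lborel A = 0" by (simp add: AE_iff_measurable[OF _ refl])
      then show False using m by simp
    qed
  qed measurable
  also note B
  also have "(\<integral>\<^sup>+x. ennreal (B / m) * indicator A x \<partial>lborel) = ennreal (B / m) * ennreal m"
    using m by (simp add: nn_integral_cmult_indicator)
  finally have lt: "ennreal (B / m) * ennreal m < ennreal B" .
  then have "0 < B" by (metis ennreal_neg not_less not_less_zero)
  then show False using lt m by (simp add: ennreal_mult[symmetric])
qed

section \<open>Affine functions and cutoffs\<close>

definition affine_fun :: "complex \<Rightarrow> ('n \<Rightarrow> complex) \<Rightarrow> real^'n::finite \<Rightarrow> complex" where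
  "affine_fun a b x = a + (\<Sum>i\<in>UNIV. b i * of_real (x $ i))"

lemma affine_fun_continuous: "continuous_on UNIV (affine_fun a b)"
  unfolding affine_fun_def[abs_def] by (intro continuous_intros)

lemma affine_fun_diff: "affine_fun a b x - affine_fun a b y = (\<Sum>i\<in>UNIV. b i * of_real ((x - y) $ i))"
  by (simp add: affine_fun_def ring_distribs sum_subtractf)

lemma affine_fun_diff_axis: "affine_fun a b (x + t *\<^sub>R axis i 1) - affine_fun a b x = b i * of_real t"
  by (simp add: affine_fun_diff axis_def if_distrib if_distribR sum.delta cong: if_cong)

lemma affine_fun_lipschitz:
  fixes b :: "'n::finite \<Rightarrow> complex"
  assumes "\<And>i. norm (b i) \<le> B"
  shows "norm (affine_fun a b x - affine_fun a b y) \<le> real CARD('n) * B * norm (x - y)"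
proof -
  have "norm (affine_fun a b x - affine_fun a b y) \<le> (\<Sum>i\<in>UNIV. norm (b i * of_real ((x - y) $ i)))"
    unfolding affine_fun_diff by (rule norm_sum)
  also have "\<dots> \<le> (\<Sum>i\<in>(UNIV::'n set). B * norm (x - y))"
    unfolding norm_mult norm_of_real
    by (intro sum_mono mult_mono assms component_le_norm_cart) (auto intro: order_trans[OF norm_ge_zero assms])
  finally show ?thesis by simp
qed

text \<open>The values of the difference at two points \<open>x\<close> and \<open>x + d e\<^sub>i\<close> where it is small control the
  \<open>i\<close>-th coefficient of the affine function.\<close>

lemma affine_minus_lipschitz_bound:
  fixes \<rho> C\<^sub>1 :: real
  assumes \<rho>: "0 < \<rho>" "\<rho> \<le> 1" and C1: "0 \<le> C\<^sub>1"
  shows "\<exists>C\<ge>0. \<forall>h M c a b (P :: real^'n::finite \<Rightarrow> complex). 0 < h \<longrightarrow> 0 \<le> M \<longrightarrow>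
    (\<forall>x y. norm (P x - P y) \<le> C\<^sub>1 * M / h * norm (x - y)) \<longrightarrow>
    (\<integral>\<^sup>+x. ennreal ((norm (affine_fun a b x - P x))\<^sup>2) * indicator (ball c (\<rho> * h)) x \<partial>lborel) \<le> ennreal (M\<^sup>2 * h ^ CARD('n)) \<longrightarrow>
    (\<forall>x y. norm ((affine_fun a b x - P x) - (affine_fun a b y - P y)) \<le> C * M / h * norm (x - y)) \<and>
    (\<forall>x \<in> ball c (2 * h). norm (affine_fun a b x - P x) \<le> C * M)"
proof -
  let ?n = "CARD('n)"
  define V where "V = unit_ball_vol (real ?n)"
  have V: "0 < V" by (simp add: V_def)
  \<comment> \<open>In units of \<open>M\<close>, the three constants bound in this order the
    difference at the chosen points, \<open>h\<close> times the coefficients of the affine function,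
    and \<open>h\<close> times the Lipschitz constant of the difference.\<close>
  define C2 where "C2 = sqrt ((1 + real ?n) / (V * (\<rho> / 2) ^ ?n))"
  define C3 where "C3 = 2 * C2 / (\<rho> / 2) + C\<^sub>1"
  define C4 where "C4 = real ?n * C3 + C\<^sub>1"
  have pos: "0 \<le> C2" "0 \<le> C3" "0 \<le> C4"
    using V \<rho> C1 by (auto simp: C2_def C3_def C4_def intro!: add_nonneg_nonneg)
  show ?thesis
  proof (intro exI[of _ "C2 + 3 * C4"] conjI allI impI)
    show "0 \<le> C2 + 3 * C4" using pos by simp
  next
    fix h M c a b and P :: "real^'n \<Rightarrow> complex"
    assume h: "0 < h" and M: "0 \<le> M"
      and P: "\<forall>x y. norm (P x - P y) \<le> C\<^sub>1 * M / h * norm (x - y)"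
      and I: "(\<integral>\<^sup>+x. ennreal ((norm (affine_fun a b x - P x))\<^sup>2) * indicator (ball c (\<rho> * h)) x \<partial>lborel) \<le> ennreal (M\<^sup>2 * h ^ ?n)"
    let ?f = "\<lambda>x. affine_fun a b x - P x" and ?d = "\<rho> * h / 2"
    have "continuous_on UNIV P"
    proof (rule lipschitz_on_continuous_on)
      show "(C\<^sub>1 * M / h)-lipschitz_on UNIV P"
        using P C1 M h by (intro lipschitz_onI) (auto simp: dist_norm)
    qed
    then have [measurable]: "P \<in> borel_measurable borel" by (rule borel_measurable_continuous_onI)
    have [measurable]: "affine_fun a b \<in> borel_measurable borel" "ball c (\<rho> * h) \<in> sets borel" "ball c (\<rho> * h / 2) \<in> sets borel"
      by (auto intro: borel_measurable_continuous_onI affine_fun_continuous)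
    have fm[measurable]: "?f \<in> borel_measurable borel"
      by measurable
    have d: "0 < ?d" "?d < \<rho> * h" using \<rho> h by auto
    \<comment> \<open>All the squares are summed before averaging, so that one point is good
      together with each of its shifts. The shift equals the radius of \<open>?A\<close>, half of
      \<open>\<rho> * h\<close>, so the shifted points stay in the ball where the integral bound
      holds.\<close>
    let ?F = "\<lambda>x. ennreal ((norm (?f x))\<^sup>2) + (\<Sum>i\<in>UNIV. ennreal ((norm (?f (x + ?d *\<^sub>R axis i 1)))\<^sup>2))"
    let ?A = "ball c ?d" and ?m = "V * ?d ^ ?n" and ?B = "(1 + real ?n) * (M\<^sup>2 * h ^ ?n)"
    have shift: "(\<integral>\<^sup>+x. ennreal ((norm (?f (x + z)))\<^sup>2) * indicator ?A x \<partial>lborel) \<le> ennreal (M\<^sup>2 * h ^ ?n)"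
      if z: "norm z \<le> ?d" for z
    proof -
      have "(\<integral>\<^sup>+x. ennreal ((norm (?f (x + z)))\<^sup>2) * indicator ?A x \<partial>lborel) \<le> (\<integral>\<^sup>+x. ennreal ((norm (?f (x + z)))\<^sup>2) * indicator (ball c (\<rho> * h)) (x + z) \<partial>lborel)"
      proof (intro nn_integral_mono mult_left_mono)
        fix x
        have "dist c (x + z) \<le> dist c x + norm z"
          using dist_triangle[of c "x + z" x] by (simp add: dist_norm[of x "x + z"])
        then show "indicator ?A x \<le> (indicator (ball c (\<rho> * h)) (x + z) :: ennreal)"
          using z by (auto simp: indicator_def)
      qed simp
      also have "\<dots> = (\<integral>\<^sup>+x. ennreal ((norm (?f x))\<^sup>2) * indicator (ball c (\<rho> * h)) x \<partial>lborel)"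
        by (rule nn_integral_translate) measurable
      finally show ?thesis using I by (rule order_trans)
    qed
    have "(\<integral>\<^sup>+x. ?F x * indicator ?A x \<partial>lborel) = (\<integral>\<^sup>+x. ennreal ((norm (?f x))\<^sup>2) * indicator ?A x \<partial>lborel)
        + (\<Sum>i\<in>UNIV. \<integral>\<^sup>+x. ennreal ((norm (?f (x + ?d *\<^sub>R axis i 1)))\<^sup>2) * indicator ?A x \<partial>lborel)"
    proof -
      let ?g = "\<lambda>i x. ennreal ((norm (?f (x + ?d *\<^sub>R axis i 1)))\<^sup>2) * indicator ?A x"
      have "(\<integral>\<^sup>+x. ?F x * indicator ?A x \<partial>lborel) = (\<integral>\<^sup>+x. ennreal ((norm (?f x))\<^sup>2) * indicator ?A x + (\<Sum>i\<in>UNIV. ?g i x) \<partial>lborel)"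
        by (simp only: distrib_right sum_distrib_right)
      also have "\<dots> = (\<integral>\<^sup>+x. ennreal ((norm (?f x))\<^sup>2) * indicator ?A x \<partial>lborel) + (\<integral>\<^sup>+x. (\<Sum>i\<in>UNIV. ?g i x) \<partial>lborel)"
        by (rule nn_integral_add) measurable
      also have "(\<integral>\<^sup>+x. (\<Sum>i\<in>UNIV. ?g i x) \<partial>lborel) = (\<Sum>i\<in>UNIV. \<integral>\<^sup>+x. ?g i x \<partial>lborel)"
        by (rule nn_integral_sum) measurable
      finally show ?thesis .
    qed
    also have "\<dots> \<le> ennreal (M\<^sup>2 * h ^ ?n) + (\<Sum>i\<in>(UNIV::'n set). ennreal (M\<^sup>2 * h ^ ?n))"
      using d shift[of 0] by (intro add_mono sum_mono shift) auto
    also have "\<dots> = ennreal ?B"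
      using h by (simp add: ennreal_of_nat_eq_real_of_nat ring_distribs ennreal_plus ennreal_mult)
    finally have IF: "(\<integral>\<^sup>+x. ?F x * indicator ?A x \<partial>lborel) \<le> ennreal ?B" .
    have "\<exists>x\<in>?A. ?F x \<le> ennreal (?B / ?m)"
    proof (rule exists_point_le_average[OF _ _ _ _ IF])
      show "emeasure lborel ?A = ennreal ?m"
        using d by (simp add: emeasure_ball V_def)
    qed (use V d in auto)
    then obtain x0 where x0: "x0 \<in> ?A" "?F x0 \<le> ennreal (?B / ?m)" by blast
    have Bm: "?B / ?m = (C2 * M)\<^sup>2"
    proof -
      have "(\<rho> * h / 2) ^ ?n = (\<rho> / 2) ^ ?n * h ^ ?n" by (simp add: power_mult_distrib power_divide)
      then have m: "?m = V * (\<rho> / 2) ^ ?n * h ^ ?n" by simp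
      have cancel: "x * (y * z) / (w * z) = x / w * y" if "z \<noteq> 0" for x y z w :: real
        using that by simp
      have "?B / ?m = (1 + real ?n) / (V * (\<rho> / 2) ^ ?n) * M\<^sup>2"
        unfolding m by (rule cancel) (use h in simp)
      also have "\<dots> = C2\<^sup>2 * M\<^sup>2" unfolding C2_def using V \<rho> by simp
      finally show ?thesis by (simp only: power_mult_distrib)
    qed
    have le: "norm w \<le> C2 * M" if "ennreal ((norm w)\<^sup>2) \<le> ?F x0" for w :: complex
    proof -
      have "ennreal ((norm w)\<^sup>2) \<le> ennreal ((C2 * M)\<^sup>2)" using that x0(2) unfolding Bm by (rule order_trans)
      then show ?thesis using pos M by (simp add: abs_le_square_iff[symmetric])
    qed
    have f0: "norm (?f x0) \<le> C2 * M" by (rule le) (rule add_increasing2[OF zero_le order_refl])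
    have fi: "norm (?f (x0 + ?d *\<^sub>R axis i 1)) \<le> C2 * M" for i
    proof (rule le)
      have "ennreal ((norm (?f (x0 + ?d *\<^sub>R axis i 1)))\<^sup>2) \<le> (\<Sum>i\<in>UNIV. ennreal ((norm (?f (x0 + ?d *\<^sub>R axis i 1)))\<^sup>2))"
        by (rule member_le_sum) auto
      then show "ennreal ((norm (?f (x0 + ?d *\<^sub>R axis i 1)))\<^sup>2) \<le> ?F x0" by (rule add_increasing[OF zero_le])
    qed
    have b: "norm (b i) \<le> C3 * M / h" for i
    proof -
      let ?x = "x0 + ?d *\<^sub>R axis i 1"
      have "b i * of_real ?d = ?f ?x - ?f x0 + (P ?x - P x0)"
        using affine_fun_diff_axis[of a b x0 ?d i] by simp
      then have "norm (b i * of_real ?d) \<le> norm (?f ?x) + norm (?f x0) + norm (P ?x - P x0)"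
        by (simp only: order_trans[OF norm_triangle_ineq add_right_mono[OF norm_triangle_ineq4]])
      also have "norm (P ?x - P x0) \<le> C\<^sub>1 * M / h * norm (?x - x0)" using P by blast
      also have "norm (?x - x0) = ?d" using d by simp
      finally have "norm (b i) * ?d \<le> 2 * (C2 * M) + C\<^sub>1 * M / h * ?d"
        using f0 fi[of i] unfolding norm_mult norm_of_real abs_of_pos[OF d(1)] by linarith
      then have "norm (b i) \<le> (2 * (C2 * M) + C\<^sub>1 * M / h * ?d) / ?d"
        using d by (simp only: pos_le_divide_eq)
      also have "\<dots> = C3 * M / h" using h \<rho> by (simp add: C3_def field_simps)
      finally show ?thesis .
    qed
    have lip: "norm (?f x - ?f y) \<le> C4 * M / h * norm (x - y)" for x y
    proof -
      have "norm (?f x - ?f y) \<le> norm (affine_fun a b x - affine_fun a b y) + norm (P x - P y)"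
        using norm_triangle_ineq4[of "affine_fun a b x - affine_fun a b y" "P x - P y"] by (simp add: algebra_simps)
      also have "\<dots> \<le> real ?n * (C3 * M / h) * norm (x - y) + C\<^sub>1 * M / h * norm (x - y)"
        by (intro add_mono affine_fun_lipschitz b P[rule_format])
      also have "\<dots> = C4 * M / h * norm (x - y)" using h by (simp add: C4_def field_simps)
      finally show ?thesis .
    qed
    show "norm (?f x - ?f y) \<le> (C2 + 3 * C4) * M / h * norm (x - y)" for x y
    proof -
      have "C4 * M / h * norm (x - y) \<le> (C2 + 3 * C4) * M / h * norm (x - y)"
        using pos M h by (intro mult_right_mono divide_right_mono) auto
      then show ?thesis using lip[of x y] by linarith
    qed
    show "\<forall>x\<in>ball c (2 * h). norm (?f x) \<le> (C2 + 3 * C4) * M"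
    proof
      \<comment> \<open>\<open>x\<close> is within \<open>2 * h\<close> of \<open>c\<close> and
        \<open>x0\<close> within \<open>h\<close>, which is the origin of the factor 3 in the
        constant.\<close>
      fix x assume x: "x \<in> ball c (2 * h)"
      have "?d \<le> h" using h \<rho> by simp
      then have "norm (x - x0) \<le> 3 * h"
        using dist_triangle[of x x0 c] x x0(1) by (simp add: dist_norm norm_minus_commute)
      then have "C4 * M / h * norm (x - x0) \<le> C4 * M / h * (3 * h)"
        using pos M h by (intro mult_left_mono) auto
      moreover have "norm (?f x) \<le> norm (?f x0) + norm (?f x - ?f x0)"
        using norm_triangle_ineq[of "?f x0" "?f x - ?f x0"] by simp
      ultimately show "norm (?f x) \<le> (C2 + 3 * C4) * M"
        using f0 lip[of x x0] h by (simp add: algebra_simps)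
    qed
  qed
qed

section \<open>Cutoff functions and Sobolev bounds for cut off Lipschitz functions\<close>

definition cutoff :: "'a::euclidean_space \<Rightarrow> real \<Rightarrow> 'a \<Rightarrow> real" where
  "cutoff c h x = max 0 (min 1 (2 - dist c x / h))"

lemma cutoff_range: "0 \<le> cutoff c h x" "cutoff c h x \<le> 1"
  by (auto simp: cutoff_def)

lemma cutoff_eq_1: "0 < h \<Longrightarrow> x \<in> ball c h \<Longrightarrow> cutoff c h x = 1"
  by (simp add: cutoff_def field_simps)

lemma cutoff_eq_0: "0 < h \<Longrightarrow> x \<notin> ball c (2 * h) \<Longrightarrow> cutoff c h x = 0"
  by (simp add: cutoff_def field_simps)

lemma cutoff_lipschitz:
  assumes "0 < h"
  shows "\<bar>cutoff c h x - cutoff c h y\<bar> \<le> norm (x - y) / h"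
proof -
  have "\<bar>cutoff c h x - cutoff c h y\<bar> \<le> \<bar>dist c x / h - dist c y / h\<bar>"
    by (auto simp: cutoff_def max_def min_def abs_if)
  also have "\<dots> = \<bar>dist c x - dist c y\<bar> / h"
    using assms by (simp flip: diff_divide_distrib)
  also have "\<dots> \<le> norm (x - y) / h"
    using assms abs_dist_diff_le[of x c y] by (simp add: dist_commute divide_right_mono dist_norm[symmetric])
  finally show ?thesis .
qed

text \<open>\<open>f\<close> is bounded only on the ball of radius \<open>2 * h\<close>, so the
  product rule has to evaluate the bare factor \<open>f\<close> at a point of that ball. If either
  point lies in the ball, symmetry allows this; if neither does, both products vanish.\<close>

lemma cutoff_mult_lipschitz:
  fixes f :: "'a::euclidean_space \<Rightarrow> complex"
  assumes h: "0 < h" and K: "0 \<le> K" and L: "0 \<le> L"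
    and lip: "\<And>x y. norm (f x - f y) \<le> L * norm (x - y)"
    and bnd: "\<And>x. x \<in> ball c (2 * h) \<Longrightarrow> norm (f x) \<le> K"
  shows "norm (of_real (cutoff c h x) * f x) \<le> K"
    and "norm (of_real (cutoff c h x) * f x - of_real (cutoff c h y) * f y) \<le> (K / h + L) * norm (x - y)"
proof -
  show b: "norm (of_real (cutoff c h x) * f x) \<le> K" for x
  proof (cases "x \<in> ball c (2 * h)")
    case True
    have "cutoff c h x * norm (f x) \<le> 1 * K"
      using bnd[OF True] cutoff_range[of c h x] K by (intro mult_mono) auto
    then show ?thesis by (simp add: norm_mult cutoff_range)
  next
    case False
    then show ?thesis using h K by (simp add: cutoff_eq_0)
  qed
  have *: "norm (of_real (cutoff c h x) * f x - of_real (cutoff c h y) * f y) \<le> (K / h + L) * norm (x - y)"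
    if y: "y \<in> ball c (2 * h)" for x y
  proof -
    have "of_real (cutoff c h x) * f x - of_real (cutoff c h y) * f y =
      of_real (cutoff c h x - cutoff c h y) * f y + of_real (cutoff c h x) * (f x - f y)"
      by (simp add: algebra_simps)
    also have "norm \<dots> \<le> \<bar>cutoff c h x - cutoff c h y\<bar> * norm (f y) + cutoff c h x * norm (f x - f y)"
      by (rule order_trans[OF norm_triangle_ineq]) (simp only: norm_mult norm_of_real abs_of_nonneg[OF cutoff_range(1)] order_refl)
    also have "\<dots> \<le> norm (x - y) / h * K + 1 * (L * norm (x - y))"
      using bnd[OF y] cutoff_range[of c h x] lip[of x y] cutoff_lipschitz[OF h, of c x y] h L
      by (intro add_mono mult_mono) auto
    finally show ?thesis by (simp add: algebra_simps)
  qed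
  show "norm (of_real (cutoff c h x) * f x - of_real (cutoff c h y) * f y) \<le> (K / h + L) * norm (x - y)"
  proof (cases "y \<in> ball c (2 * h)")
    case True
    then show ?thesis by (rule *)
  next
    case False
    show ?thesis
    proof (cases "x \<in> ball c (2 * h)")
      case True
      then show ?thesis using *[OF True, of y] by (simp add: norm_minus_commute)
    next
      case x: False
      then show ?thesis using False h K L by (simp add: cutoff_eq_0)
    qed
  qed
qed

lemma ennreal_combine:
  assumes "0 \<le> a" "0 \<le> b" "0 \<le> c" "0 \<le> x" "0 \<le> y"
  shows "ennreal (a * (b * x + c * y)) = ennreal a * (ennreal b * ennreal x + ennreal c * ennreal y)"
  using assms by (simp add: ennreal_mult)

text \<open>The weight of order \<open>t\<close> is dominated by \<open>h powr (- 2 * t)\<close>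
  times a combination of the orders 0 and 1, in which the factor \<open>h\<^sup>2\<close>
  compensates the Lipschitz constant \<open>L / h\<close>. The powers of 2 and 4 come from the
  supports of \<open>r\<close> and of its difference quotients, in balls of radius
  \<open>2 * h\<close> and \<open>4 * h\<close>.\<close>

lemma sobolev_bound_lipschitz:
  fixes r :: "real^'n::finite \<Rightarrow> complex" and K L :: real
  assumes h: "0 < h" "h \<le> 1" and t: "0 \<le> t" "t \<le> 1" and K: "0 \<le> K"
    and bnd: "\<And>x. norm (r x) \<le> K" and lip: "\<And>x y. norm (r x - r y) \<le> L / h * norm (x - y)"
    and z: "\<And>x. x \<notin> ball c (2 * h) \<Longrightarrow> r x = 0"
  shows "(\<integral>\<^sup>+\<xi>. ennreal (sobolev_weight t (fourier r) \<xi>) \<partial>lborel) \<le>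
    ennreal (h powr (- 2 * t) * (unit_ball_vol CARD('n) * (2 * K\<^sup>2 * 2 ^ CARD('n) + CARD('n) * L\<^sup>2 * 4 ^ CARD('n))) * h ^ CARD('n))"
proof -
  let ?n = "CARD('n)"
  have h2: "0 < 2 * h" using h by simp
  note b = fourier_lipschitz_bounds[OF bnd lip z h2]
  have [measurable]: "fourier r \<in> borel_measurable borel"
    using b(1) unfolding has_fourier_def square_integrable_def by simp
  let ?F = "\<lambda>\<xi>. ennreal ((norm (fourier r \<xi>))\<^sup>2)" and ?G = "\<lambda>\<xi>. ennreal ((norm \<xi>)\<^sup>2 * (norm (fourier r \<xi>))\<^sup>2)"
  have "(\<integral>\<^sup>+\<xi>. ennreal (sobolev_weight t (fourier r) \<xi>) \<partial>lborel) \<le> (\<integral>\<^sup>+\<xi>. ennreal (h powr (- 2 * t)) * (ennreal 2 * ?F \<xi> + ennreal (h\<^sup>2) * ?G \<xi>) \<partial>lborel)"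
  proof (rule nn_integral_mono)
    fix \<xi> :: "real^'n"
    have "sobolev_weight t (fourier r) \<xi> \<le> h powr (- 2 * t) * (2 + h\<^sup>2 * (norm \<xi>)\<^sup>2) * (norm (fourier r \<xi>))\<^sup>2"
      unfolding sobolev_weight_def by (intro mult_right_mono powr_mult_one_add_le h t) auto
    also have "\<dots> = h powr (- 2 * t) * (2 * (norm (fourier r \<xi>))\<^sup>2 + h\<^sup>2 * ((norm \<xi>)\<^sup>2 * (norm (fourier r \<xi>))\<^sup>2))"
      by (simp add: algebra_simps)
    finally have le: "sobolev_weight t (fourier r) \<xi> \<le> h powr (- 2 * t) * (2 * (norm (fourier r \<xi>))\<^sup>2 + h\<^sup>2 * ((norm \<xi>)\<^sup>2 * (norm (fourier r \<xi>))\<^sup>2))" .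
    show "ennreal (sobolev_weight t (fourier r) \<xi>) \<le> ennreal (h powr (- 2 * t)) * (ennreal 2 * ?F \<xi> + ennreal (h\<^sup>2) * ?G \<xi>)"
      by (rule ord_le_eq_trans[OF ennreal_leI[OF le] ennreal_combine]) simp_all
  qed
  also have "\<dots> = ennreal (h powr (- 2 * t)) * (ennreal 2 * (\<integral>\<^sup>+\<xi>. ?F \<xi> \<partial>lborel) + ennreal (h\<^sup>2) * (\<integral>\<^sup>+\<xi>. ?G \<xi> \<partial>lborel))"
    by (simp add: nn_integral_cmult nn_integral_add)
  also have "\<dots> \<le> ennreal (h powr (- 2 * t)) * (ennreal 2 * ennreal (K\<^sup>2 * (unit_ball_vol ?n * (2 * h) ^ ?n)) + ennreal (h\<^sup>2) * ennreal (?n * ((L / h)\<^sup>2 * (unit_ball_vol ?n * (2 * (2 * h)) ^ ?n))))"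
    by (intro mult_left_mono add_mono b(2,3)) auto
  also have "\<dots> = ennreal (h powr (- 2 * t) * (2 * (K\<^sup>2 * (unit_ball_vol ?n * (2 * h) ^ ?n)) + h\<^sup>2 * (?n * ((L / h)\<^sup>2 * (unit_ball_vol ?n * (2 * (2 * h)) ^ ?n)))))"
    by (rule ennreal_combine[symmetric]) (use h in simp_all)
  also have "h powr (- 2 * t) * (2 * (K\<^sup>2 * (unit_ball_vol ?n * (2 * h) ^ ?n)) + h\<^sup>2 * (?n * ((L / h)\<^sup>2 * (unit_ball_vol ?n * (2 * (2 * h)) ^ ?n)))) =
    h powr (- 2 * t) * (unit_ball_vol ?n * (2 * K\<^sup>2 * 2 ^ ?n + ?n * L\<^sup>2 * 4 ^ ?n)) * h ^ ?n"
  proof -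
    have e1: "(2 * h) ^ ?n = 2 ^ ?n * h ^ ?n" by (rule power_mult_distrib)
    have "2 * (2 * h) = 4 * h" by simp
    then have e2: "(2 * (2 * h)) ^ ?n = 4 ^ ?n * h ^ ?n" by (simp only: power_mult_distrib)
    have e3: "h\<^sup>2 * (x * ((L / h)\<^sup>2 * y)) = x * (L\<^sup>2 * y)" for x y using h by (simp add: power_divide)
    show ?thesis unfolding e1 e2 e3 by (simp only: distrib_left distrib_right mult_ac)
  qed
  finally show ?thesis .
qed

section \<open>Sobolev norms of affine functions on balls\<close>

lemma sobolev_norm_nonneg: "0 \<le> sobolev_norm s u"
  unfolding sobolev_norm_def by (simp add: sobolev_weight_def)

lemma sobolev_norm_bound:
  assumes uv: "has_fourier u v" and le: "(\<integral>\<^sup>+\<xi>. ennreal (sobolev_weight t v \<xi>) \<partial>lborel) \<le> ennreal B" and B: "0 \<le> B"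
  shows "u \<in> sobolev t" "sobolev_norm t u \<le> sqrt B"
proof -
  have "v \<in> borel_measurable borel" using uv unfolding has_fourier_def square_integrable_def by simp
  then have m: "sobolev_weight t v \<in> borel_measurable lborel" by (simp add: sobolev_weight_measurable)
  have nn: "norm (sobolev_weight t v \<xi>) = sobolev_weight t v \<xi>" for \<xi> by (simp add: sobolev_weight_def)
  have i: "integrable lborel (sobolev_weight t v)"
    using le_less_trans[OF le ennreal_less_top] by (intro integrableI_bounded m) (simp add: nn del: real_norm_def)
  then show "u \<in> sobolev t" by (simp add: sobolev_iff[OF uv])
  show "sobolev_norm t u \<le> sqrt B"
    using le B unfolding nn_integral_sobolev_weight[OF i] sobolev_norm_eq[OF uv] by simp
qed

lemma sobolev_weight_add_le: "sobolev_weight t (\<lambda>\<xi>. v \<xi> + w \<xi>) \<xi> \<le> 2 * sobolev_weight t v \<xi> + 2 * sobolev_weight t w \<xi>"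
proof -
  have "(norm (v \<xi> + w \<xi>))\<^sup>2 \<le> (norm (v \<xi>) + norm (w \<xi>))\<^sup>2"
    by (intro power_mono norm_triangle_ineq) auto
  also have "\<dots> \<le> 2 * (norm (v \<xi>))\<^sup>2 + 2 * (norm (w \<xi>))\<^sup>2"
    using zero_le_power2[of "norm (v \<xi>) - norm (w \<xi>)"] unfolding power2_diff power2_sum by simp
  finally have "(1 + (norm \<xi>)\<^sup>2) powr t * (norm (v \<xi> + w \<xi>))\<^sup>2 \<le> (1 + (norm \<xi>)\<^sup>2) powr t * (2 * (norm (v \<xi>))\<^sup>2 + 2 * (norm (w \<xi>))\<^sup>2)"
    by (rule mult_left_mono) simp
  then show ?thesis by (simp add: sobolev_weight_def algebra_simps)
qed

lemma affine_fun_bounded_ball: "\<exists>B\<ge>0. \<forall>x\<in>ball c r. norm (affine_fun a b x) \<le> B"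
proof -
  have "compact (affine_fun a b ` cball c r)"
    by (rule compact_continuous_image[OF continuous_on_subset[OF affine_fun_continuous]]) auto
  then obtain B where "\<forall>y\<in>affine_fun a b ` cball c r. norm y \<le> B"
    using compact_imp_bounded bounded_iff by blast
  then show ?thesis by (intro exI[of _ "max 0 B"]) (auto simp: le_max_iff_disj)
qed

lemma affine_extension_transfer:
  fixes \<rho> :: real
  assumes \<rho>: "0 < \<rho>" "\<rho> \<le> 1"
  shows "\<exists>K>0. \<forall>h c s t a b. \<forall>u :: real^'n::finite \<Rightarrow> complex. 0 < h \<longrightarrow> h \<le> 1 \<longrightarrow> 0 \<le> s \<longrightarrow> s \<le> t \<longrightarrow> t \<le> 1 \<longrightarrow>
    u \<in> sobolev s \<longrightarrow> (AE x in lborel. x \<in> ball c (\<rho> * h) \<longrightarrow> u x = affine_fun a b x) \<longrightarrow>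
    (\<exists>u'\<in>sobolev t. (\<forall>x\<in>ball c h. u' x = affine_fun a b x) \<and> sobolev_norm t u' \<le> K * h powr (s - t) * sobolev_norm s u)"
proof -
  let ?n = "CARD('n)"
  define C1 where "C1 = fourier_const ?n * sqrt (2 * sqrt (2 * pi) ^ ?n)"
  have C1: "0 \<le> C1" by (simp add: C1_def fourier_const_pos less_imp_le)
  obtain C where C0: "C \<ge> 0" and C: "\<And>h M c a b (P :: real^'n \<Rightarrow> complex). 0 < h \<Longrightarrow> 0 \<le> M \<Longrightarrow>
    (\<forall>x y. norm (P x - P y) \<le> C1 * M / h * norm (x - y)) \<Longrightarrow>
    (\<integral>\<^sup>+x. ennreal ((norm (affine_fun a b x - P x))\<^sup>2) * indicator (ball c (\<rho> * h)) x \<partial>lborel) \<le> ennreal (M\<^sup>2 * h ^ ?n) \<Longrightarrow>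
    (\<forall>x y. norm ((affine_fun a b x - P x) - (affine_fun a b y - P y)) \<le> C * M / h * norm (x - y)) \<and>
    (\<forall>x \<in> ball c (2 * h). norm (affine_fun a b x - P x) \<le> C * M)"
    using affine_minus_lipschitz_bound[OF \<rho> C1, where 'n='n] by blast
  define V where "V = unit_ball_vol (real ?n)"
  \<comment> \<open>The bound for a function of height \<open>C * M\<close> and Lipschitz constant
    \<open>2 * C * M / h\<close>, with \<open>M\<^sup>2\<close> and the powers of \<open>h\<close>
    taken out. The inner 2 arises because the cutoff and the function cut off each contribute
    \<open>C * M / h\<close>.\<close>
  define C7 where "C7 = V * (2 * C\<^sup>2 * 2 ^ ?n + ?n * (2 * C)\<^sup>2 * 4 ^ ?n)"
  have C7: "0 \<le> C7" by (simp add: C7_def V_def)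
  \<comment> \<open>\<open>4 + 2 * C7\<close> is twice the sum of the constant 2 for the smoothed
    part and \<open>C7\<close> for the correction; the doubling comes from the square of a
    sum.\<close>
  define K where "K = sqrt (4 + 2 * C7)"
  show ?thesis
  proof (intro exI[of _ K] conjI allI impI)
    show "0 < K" using C7 by (simp add: K_def)
    fix h c s t a b and u :: "real^'n \<Rightarrow> complex"
    assume h: "0 < h" "h \<le> 1" and s: "0 \<le> s" and st: "s \<le> t" and t: "t \<le> 1"
      and u: "u \<in> sobolev s" and ae: "AE x in lborel. x \<in> ball c (\<rho> * h) \<longrightarrow> u x = affine_fun a b x"
    obtain v where uv: "has_fourier u v" and w: "integrable lborel (sobolev_weight s v)"
      using u unfolding sobolev_def by blast
    have v: "square_integrable v" using uv unfolding has_fourier_def by simp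
    have [measurable]: "v \<in> borel_measurable borel" by (rule square_integrableD(1)[OF v])
    have s1: "s \<le> 1" and t0: "0 \<le> t" using s st t by auto
    define N where "N = (LINT \<xi>|lborel. sobolev_weight s v \<xi>)"
    have N: "0 \<le> N" by (simp add: N_def sobolev_weight_def)
    \<comment> \<open>The height expected of the difference between the affine function and
      \<open>P\<close>: the value for which \<open>M\<^sup>2 * h ^ ?n\<close> is exactly the bound
      for its integrated square on the small ball.\<close>
    define M where "M = h powr (s - real ?n / 2) * sqrt N"
    have M: "0 \<le> M" using N by (simp add: M_def)
    have MN: "M\<^sup>2 * h ^ ?n = h powr (2 * s) * N"
    proof -
      have "(h powr (s - real ?n / 2))\<^sup>2 * h powr (real ?n) = h powr (2 * s)"
        unfolding power2_eq_square powr_add[symmetric] by simp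
      then have "(h powr (s - real ?n / 2))\<^sup>2 * h ^ ?n = h powr (2 * s)" using h by (simp add: powr_realpow)
      then show ?thesis using N by (simp add: M_def power_mult_distrib mult_ac)
    qed
    have h2: "0 < h\<^sup>2" using h by simp
    define q where "q \<xi> = v \<xi> * of_real (gauss (h\<^sup>2) \<xi>)" for \<xi>
    define P where "P x = of_real (fourier_const ?n) * ft 1 q x" for x
    have Pq: "has_fourier P q"
      unfolding P_def[abs_def] q_def[abs_def] by (intro has_fourier_ft integrable_mult_gauss v h2)
    have Plip: "\<forall>x y. norm (P x - P y) \<le> C1 * M / h * norm (x - y)"
      using smoothing_lipschitz[OF v w h s s1] by (simp add: P_def q_def[abs_def] C1_def M_def N_def mult_ac)
    obtain B where B: "\<And>y. y \<in> ball c (\<rho> * h) \<Longrightarrow> norm (affine_fun a b y) \<le> B"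
      using affine_fun_bounded_ball by blast
    have PL2: "(\<integral>\<^sup>+x. ennreal ((norm (affine_fun a b x - P x))\<^sup>2) * indicator (ball c (\<rho> * h)) x \<partial>lborel) \<le> ennreal (M\<^sup>2 * h ^ ?n)"
      using smoothing_L2[OF uv w h s s1 affine_fun_continuous B ae] unfolding MN by (simp add: P_def q_def[abs_def] N_def)
    note f = C[OF h(1) M Plip PL2]
    define r where "r x = of_real (cutoff c h x) * (affine_fun a b x - P x)" for x
    have CM: "0 \<le> C * M" "0 \<le> C * M / h" using C0 M h by auto
    have rb: "norm (r x) \<le> C * M" for x
      unfolding r_def by (rule cutoff_mult_lipschitz(1)[OF h(1) CM]) (use f in auto)
    have rl: "norm (r x - r y) \<le> (2 * C * M) / h * norm (x - y)" for x y
    proof -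
      have "norm (r x - r y) \<le> (C * M / h + C * M / h) * norm (x - y)"
        unfolding r_def by (rule cutoff_mult_lipschitz(2)[OF h(1) CM]) (use f in auto)
      then show ?thesis by (simp add: field_simps)
    qed
    have rz: "r x = 0" if "x \<notin> ball c (2 * h)" for x
      unfolding r_def using cutoff_eq_0[OF h(1) that] by simp
    have h20: "0 < 2 * h" using h by simp
    have rf: "has_fourier r (fourier r)" by (rule fourier_lipschitz_bounds(1)[OF rb rl rz h20])
    have rw: "(\<integral>\<^sup>+\<xi>. ennreal (sobolev_weight t (fourier r) \<xi>) \<partial>lborel) \<le> ennreal (C7 * h powr (2 * (s - t)) * N)"
    proof -
      have "h powr (- 2 * t) * (V * (2 * (C * M)\<^sup>2 * 2 ^ ?n + ?n * (2 * C * M)\<^sup>2 * 4 ^ ?n)) * h ^ ?n = h powr (- 2 * t) * C7 * (M\<^sup>2 * h ^ ?n)"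
        by (simp add: C7_def power_mult_distrib algebra_simps)
      also have "\<dots> = C7 * h powr (2 * (s - t)) * N"
      proof -
        have "h powr (- 2 * t) * h powr (2 * s) = h powr (2 * (s - t))" by (simp add: algebra_simps flip: powr_add)
        then show ?thesis unfolding MN by (simp add: mult_ac)
      qed
      finally show ?thesis
        using sobolev_bound_lipschitz[OF h t0 t CM(1) rb rl rz] by (simp add: V_def)
    qed
    have qw: "(\<integral>\<^sup>+\<xi>. ennreal (sobolev_weight t q \<xi>) \<partial>lborel) \<le> ennreal (2 * h powr (2 * (s - t)) * N)"
    proof -
      have "(\<integral>\<^sup>+\<xi>. ennreal (sobolev_weight t q \<xi>) \<partial>lborel) \<le> (\<integral>\<^sup>+\<xi>. ennreal (2 * h powr (2 * (s - t))) * ennreal (sobolev_weight s v \<xi>) \<partial>lborel)"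
      proof (rule nn_integral_mono)
        fix \<xi> :: "real^'n"
        have "(gauss (h\<^sup>2) \<xi>)\<^sup>2 = exp (- (h\<^sup>2 * (norm \<xi>)\<^sup>2))"
          by (simp add: gauss_def power2_eq_square mult_exp_exp)
        then have "sobolev_weight t q \<xi> = ((1 + (norm \<xi>)\<^sup>2) powr t * exp (- (h\<^sup>2 * (norm \<xi>)\<^sup>2))) * (norm (v \<xi>))\<^sup>2"
          by (simp add: sobolev_weight_def q_def norm_mult power_mult_distrib)
        also have "\<dots> \<le> (2 * h powr (2 * (s - t)) * (1 + (norm \<xi>)\<^sup>2) powr s) * (norm (v \<xi>))\<^sup>2"
          by (intro mult_right_mono weight_mult_gauss_le h s st t) auto
        finally have "sobolev_weight t q \<xi> \<le> 2 * h powr (2 * (s - t)) * sobolev_weight s v \<xi>"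
          by (simp add: sobolev_weight_def mult_ac)
        from ennreal_leI[OF this] show "ennreal (sobolev_weight t q \<xi>) \<le> ennreal (2 * h powr (2 * (s - t))) * ennreal (sobolev_weight s v \<xi>)"
          by (simp add: ennreal_mult sobolev_weight_def)
      qed
      also have "\<dots> = ennreal (2 * h powr (2 * (s - t))) * ennreal N"
        unfolding N_def nn_integral_sobolev_weight[OF w, symmetric] using w by (intro nn_integral_cmult) auto
      also have "\<dots> = ennreal (2 * h powr (2 * (s - t)) * N)" using N by (simp add: ennreal_mult)
      finally show ?thesis .
    qed
    let ?v = "\<lambda>\<xi>. q \<xi> + fourier r \<xi>"
    have [measurable]: "q \<in> borel_measurable borel" "fourier r \<in> borel_measurable borel"
      using Pq rf unfolding has_fourier_def square_integrable_def by auto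
    have [measurable]: "sobolev_weight t q \<in> borel_measurable borel" "sobolev_weight t (fourier r) \<in> borel_measurable borel"
      by (simp_all add: sobolev_weight_measurable)
    have uv': "has_fourier (\<lambda>x. P x + r x) ?v" by (rule has_fourier_add[OF Pq rf])
    have "(\<integral>\<^sup>+\<xi>. ennreal (sobolev_weight t ?v \<xi>) \<partial>lborel) \<le> (\<integral>\<^sup>+\<xi>. ennreal 2 * ennreal (sobolev_weight t q \<xi>) + ennreal 2 * ennreal (sobolev_weight t (fourier r) \<xi>) \<partial>lborel)"
    proof (rule nn_integral_mono)
      fix \<xi>
      from ennreal_leI[OF sobolev_weight_add_le[of t q "fourier r" \<xi>]]
      show "ennreal (sobolev_weight t ?v \<xi>) \<le> ennreal 2 * ennreal (sobolev_weight t q \<xi>) + ennreal 2 * ennreal (sobolev_weight t (fourier r) \<xi>)"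
        by (simp add: ennreal_mult sobolev_weight_def)
    qed
    also have "\<dots> = ennreal 2 * (\<integral>\<^sup>+\<xi>. ennreal (sobolev_weight t q \<xi>) \<partial>lborel) + ennreal 2 * (\<integral>\<^sup>+\<xi>. ennreal (sobolev_weight t (fourier r) \<xi>) \<partial>lborel)"
      by (simp add: nn_integral_add nn_integral_cmult)
    also have "\<dots> \<le> ennreal 2 * ennreal (2 * h powr (2 * (s - t)) * N) + ennreal 2 * ennreal (C7 * h powr (2 * (s - t)) * N)"
      by (intro add_mono mult_left_mono qw rw) auto
    also have "\<dots> = ennreal ((4 + 2 * C7) * h powr (2 * (s - t)) * N)"
    proof -
      let ?X = "h powr (2 * (s - t)) * N"
      have "0 \<le> ?X" using N by simp
      then have "ennreal 2 * ennreal (2 * ?X) + ennreal 2 * ennreal (C7 * ?X) = ennreal (2 * (2 * ?X) + 2 * (C7 * ?X))"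
        using C7 by (simp only: ennreal_mult[symmetric] ennreal_plus[symmetric] zero_le_numeral mult_nonneg_nonneg)
      then show ?thesis by (simp add: algebra_simps)
    qed
    finally have le: "(\<integral>\<^sup>+\<xi>. ennreal (sobolev_weight t ?v \<xi>) \<partial>lborel) \<le> ennreal ((4 + 2 * C7) * h powr (2 * (s - t)) * N)" .
    have "0 \<le> (4 + 2 * C7) * h powr (2 * (s - t)) * N" using C7 N by simp
    note bound = sobolev_norm_bound[OF uv' le this]
    have eq: "sqrt ((4 + 2 * C7) * h powr (2 * (s - t)) * N) = K * h powr (s - t) * sobolev_norm s u"
    proof -
      have "sqrt (h powr (2 * (s - t))) = h powr (s - t)"
      proof (rule real_sqrt_unique)
        show "(h powr (s - t))\<^sup>2 = h powr (2 * (s - t))"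
          by (simp add: power2_eq_square flip: powr_add)
      qed simp
      then show ?thesis unfolding K_def sobolev_norm_eq[OF uv] N_def[symmetric] by (simp only: real_sqrt_mult)
    qed
    show "\<exists>u'\<in>sobolev t. (\<forall>x\<in>ball c h. u' x = affine_fun a b x) \<and> sobolev_norm t u' \<le> K * h powr (s - t) * sobolev_norm s u"
    proof (intro bexI[of _ "\<lambda>x. P x + r x"] conjI ballI)
      show "P x + r x = affine_fun a b x" if "x \<in> ball c h" for x
        using cutoff_eq_1[OF h(1) that] by (simp add: r_def)
    qed (use bound eq in auto)
  qed
qed

text \<open>Cutting off the affine function shows that the set of extensions is nonempty, so that
  the infimum in \<open>sobolev_norm_on\<close> is meaningful and can be bounded from below.\<close>

lemma affine_fun_sobolev_extension:
  assumes h: "0 < h" "h \<le> 1" and t: "0 \<le> t" "t \<le> 1"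
  shows "\<exists>u\<in>sobolev t. \<forall>x\<in>ball (c::real^'n::finite) h. u x = affine_fun a b x"
proof -
  let ?n = "CARD('n)"
  define B where "B = (\<Sum>i\<in>UNIV. norm (b i))"
  have B: "norm (b i) \<le> B" for i unfolding B_def by (rule member_le_sum) auto
  have B0: "0 \<le> B" unfolding B_def by (intro sum_nonneg) auto
  obtain K where K: "0 \<le> K" "\<And>x. x \<in> ball c (2 * h) \<Longrightarrow> norm (affine_fun a b x) \<le> K"
    using affine_fun_bounded_ball by blast
  have nB: "0 \<le> real ?n * B" using B0 by simp
  define r where "r x = of_real (cutoff c h x) * affine_fun a b x" for x
  have rb: "norm (r x) \<le> K" for x
    unfolding r_def by (rule cutoff_mult_lipschitz(1)[OF h(1) K(1) nB affine_fun_lipschitz[OF B] K(2)])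
  \<comment> \<open>The factor \<open>h\<close> over \<open>h\<close> only brings the constant into
    the form \<open>L / h\<close> of the Sobolev bound.\<close>
  have rl: "norm (r x - r y) \<le> ((K / h + real ?n * B) * h) / h * norm (x - y)" for x y
    using cutoff_mult_lipschitz(2)[OF h(1) K(1) nB affine_fun_lipschitz[OF B] K(2)] h unfolding r_def by simp
  have rz: "r x = 0" if "x \<notin> ball c (2 * h)" for x
    unfolding r_def using cutoff_eq_0[OF h(1) that] by simp
  have h20: "0 < 2 * h" using h by simp
  have rf: "has_fourier r (fourier r)" by (rule fourier_lipschitz_bounds(1)[OF rb rl rz h20])
  have "r \<in> sobolev t"
    by (rule sobolev_norm_bound(1)[OF rf sobolev_bound_lipschitz[OF h t K(1) rb rl rz]])
       (use h in \<open>auto intro!: mult_nonneg_nonneg add_nonneg_nonneg\<close>)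
  then show ?thesis
    by (intro bexI[of _ r]) (auto simp: r_def cutoff_eq_1[OF h(1)])
qed

text \<open>The multi-indices of total degree at most 1 are zero and the unit vectors.\<close>

lemma polys_1_affine:
  assumes "p \<in> (polys 1 :: (real^'n::finite \<Rightarrow> complex) set)"
  shows "\<exists>a b. p = affine_fun a b"
proof -
  obtain a :: "('n \<Rightarrow> nat) \<Rightarrow> complex" where p: "p = (\<lambda>x. \<Sum>\<alpha> | (\<Sum>i\<in>UNIV. \<alpha> i) \<le> 1. a \<alpha> * of_real (\<Prod>i\<in>UNIV. (x $ i) ^ \<alpha> i))"
    using assms unfolding polys_def by blast
  let ?\<delta> = "\<lambda>(i::'n) j. if j = i then 1 else 0 :: nat"
  have set: "{\<alpha> :: 'n \<Rightarrow> nat. (\<Sum>i\<in>UNIV. \<alpha> i) \<le> 1} = insert (\<lambda>_. 0) (range ?\<delta>)"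
  proof (intro equalityI subsetI)
    fix \<alpha> :: "'n \<Rightarrow> nat" assume "\<alpha> \<in> {\<alpha>. (\<Sum>i\<in>UNIV. \<alpha> i) \<le> 1}"
    then have s: "(\<Sum>i\<in>UNIV. \<alpha> i) \<le> 1" by simp
    show "\<alpha> \<in> insert (\<lambda>_. 0) (range ?\<delta>)"
    proof (cases "\<forall>i. \<alpha> i = 0")
      case False
      then obtain i where i: "\<alpha> i \<noteq> 0" by blast
      have "\<alpha> i + (\<Sum>j\<in>UNIV - {i}. \<alpha> j) \<le> 1" using s by (simp add: sum.remove[of UNIV i])
      then have "\<alpha> i = 1" "(\<Sum>j\<in>UNIV - {i}. \<alpha> j) = 0" using i by linarith+
      then have "\<alpha> = ?\<delta> i" by (auto simp: fun_eq_iff)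
      then show ?thesis by blast
    qed auto
  qed (auto simp: sum.delta)
  have inj: "inj ?\<delta>" by (auto simp: inj_on_def fun_eq_iff split: if_splits)
  have "p x = affine_fun (a (\<lambda>_. 0)) (\<lambda>i. a (?\<delta> i)) x" for x
  proof -
    have "(\<lambda>_. 0) \<noteq> ?\<delta> i" for i by (metis zero_neq_one)
    then have "(\<lambda>_. 0) \<notin> range ?\<delta>" by blast
    then have "p x = a (\<lambda>_. 0) + (\<Sum>i\<in>UNIV. a (?\<delta> i) * of_real (\<Prod>j\<in>UNIV. (x $ j) ^ ?\<delta> i j))"
      unfolding p set by (simp add: sum.reindex[OF inj])
    moreover have "(\<Prod>j\<in>UNIV. (x $ j) ^ ?\<delta> i j) = x $ i" for i
      by (simp add: if_distrib[of "power _"] prod.delta cong: if_cong)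
    ultimately show ?thesis by (simp add: affine_fun_def)
  qed
  then show ?thesis by blast
qed

text \<open>An inequality between infima follows by turning every extension from \<open>U\<close>
  into one from \<open>U'\<close>. The three sets let one statement serve both assumptions: with
  \<open>s = t\<close> it compares the norms on a set and on its inner ball, with
  \<open>U = U'\<close> it is the inverse inequality.\<close>

lemma sobolev_norm_on_affine_le:
  fixes \<rho> :: real
  assumes \<rho>: "0 < \<rho>" "\<rho> \<le> 1"
  obtains K where "K > 0" and "\<And>h s t c p. \<And>U U' \<omega> :: (real^'n::finite) set. p \<in> polys 1 \<Longrightarrow>
    0 < h \<Longrightarrow> h \<le> 1 \<Longrightarrow> 0 \<le> s \<Longrightarrow> s \<le> t \<Longrightarrow> t \<le> 1 \<Longrightarrow>
    ball c (\<rho> * h) \<subseteq> U \<Longrightarrow> U \<subseteq> \<omega> \<Longrightarrow> U' \<subseteq> \<omega> \<Longrightarrow> \<omega> \<subseteq> ball c h \<Longrightarrow>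
    sobolev_norm_on t U' (restrict_to \<omega> p) \<le> K * h powr (s - t) * sobolev_norm_on s U (restrict_to \<omega> p)"
proof -
  obtain K where K0: "K > 0" and K: "\<And>h c s t a b (u :: real^'n \<Rightarrow> complex). 0 < h \<Longrightarrow> h \<le> 1 \<Longrightarrow> 0 \<le> s \<Longrightarrow> s \<le> t \<Longrightarrow> t \<le> 1 \<Longrightarrow>
    u \<in> sobolev s \<Longrightarrow> (AE x in lborel. x \<in> ball c (\<rho> * h) \<longrightarrow> u x = affine_fun a b x) \<Longrightarrow>
    (\<exists>u'\<in>sobolev t. (\<forall>x\<in>ball c h. u' x = affine_fun a b x) \<and> sobolev_norm t u' \<le> K * h powr (s - t) * sobolev_norm s u)"
    using affine_extension_transfer[OF \<rho>, where 'n='n] by blast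
  show thesis
  proof (rule that[of K])
    fix h s t :: real and c and p :: "real^'n \<Rightarrow> complex" and U U' \<omega> :: "(real^'n) set"
    assume p: "p \<in> polys 1" and h: "0 < h" "h \<le> 1" and s: "0 \<le> s" and st: "s \<le> t" and t: "t \<le> 1"
      and U: "ball c (\<rho> * h) \<subseteq> U" "U \<subseteq> \<omega>" and U': "U' \<subseteq> \<omega>" and \<omega>: "\<omega> \<subseteq> ball c h"
    obtain a b where pab: "p = affine_fun a b" using polys_1_affine[OF p] by blast
    let ?w = "restrict_to \<omega> p" and ?c = "K * h powr (s - t)"
    have c: "0 < ?c" using K0 h by simp
    have "sobolev_extensions s U ?w \<noteq> {}"
    proof -
      obtain u where "u \<in> sobolev s" "\<And>x. x \<in> ball c h \<Longrightarrow> u x = affine_fun a b x"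
        using affine_fun_sobolev_extension[OF h s order_trans[OF st t], of c a b] by blast
      then have "u \<in> sobolev_extensions s U ?w"
        using U \<omega> unfolding sobolev_extensions_def pab restrict_to_def by (auto intro!: AE_I2 simp: subset_iff)
      then show ?thesis by blast
    qed
    moreover have "sobolev_norm_on t U' ?w / ?c \<le> sobolev_norm s u" if "u \<in> sobolev_extensions s U ?w" for u
    proof -
      have us: "u \<in> sobolev s" and ae: "AE x in lborel. x \<in> U \<longrightarrow> u x = ?w x"
        using that unfolding sobolev_extensions_def by auto
      have "AE x in lborel. x \<in> ball c (\<rho> * h) \<longrightarrow> u x = affine_fun a b x"
        using ae by eventually_elim (use U in \<open>auto simp: restrict_to_def pab subset_iff\<close>)
      from K[OF h s st t us this] obtain u' where u': "u' \<in> sobolev t" "\<And>x. x \<in> ball c h \<Longrightarrow> u' x = affine_fun a b x"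
        "sobolev_norm t u' \<le> ?c * sobolev_norm s u" by blast
      have "u' \<in> sobolev_extensions t U' ?w"
        using u' U' \<omega> unfolding sobolev_extensions_def pab restrict_to_def by (auto intro!: AE_I2 simp: subset_iff)
      then have "sobolev_norm_on t U' ?w \<le> sobolev_norm t u'"
        unfolding sobolev_norm_on_def
        by (intro cINF_lower bdd_belowI2[of _ 0]) (auto simp: sobolev_norm_nonneg)
      then have "sobolev_norm_on t U' ?w \<le> ?c * sobolev_norm s u" using u'(3) by linarith
      then show ?thesis using c by (simp add: field_simps)
    qed
    ultimately have "sobolev_norm_on t U' ?w / ?c \<le> sobolev_norm_on s U ?w"
      unfolding sobolev_norm_on_def[of s] by (intro cINF_greatest)
    then show "sobolev_norm_on t U' ?w \<le> ?c * sobolev_norm_on s U ?w"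
      using c by (simp add: pos_divide_le_eq mult_ac)
  qed (rule K0)
qed

lemma restrict_polys_1_sobolev_on:
  assumes "p \<in> polys 1" "\<omega> \<subseteq> ball (c::real^'n::finite) h" "0 < h" "h \<le> 1" "0 \<le> t" "t \<le> 1"
  shows "restrict_to \<omega> p \<in> sobolev_on t \<omega>"
proof -
  obtain a b where pab: "p = affine_fun a b" using polys_1_affine[OF assms(1)] by blast
  obtain u where "u \<in> sobolev t" "\<And>x. x \<in> ball c h \<Longrightarrow> u x = affine_fun a b x"
    using affine_fun_sobolev_extension[OF assms(3-6), of c a b] by blast
  then have "u \<in> sobolev_extensions t \<omega> (restrict_to \<omega> p)"
    using assms(2) unfolding sobolev_extensions_def pab restrict_to_def by (auto intro!: AE_I2 simp: subset_iff)
  then show ?thesis unfolding sobolev_on_def by blast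
qed

lemma linear_subspace_restrict_polys:
  "linear_subspace (restrict_to \<omega> ` (polys k :: (real^'n::finite \<Rightarrow> complex) set))"
  unfolding linear_subspace_def
proof (intro conjI ballI allI)
  show "(\<lambda>x. 0) \<in> restrict_to \<omega> ` (polys k :: (real^'n \<Rightarrow> complex) set)"
  proof
    show "(\<lambda>x. 0) = restrict_to \<omega> (\<lambda>x. 0)" by (simp add: restrict_to_def fun_eq_iff)
    show "(\<lambda>x. 0) \<in> (polys k :: (real^'n \<Rightarrow> complex) set)"
      unfolding polys_def by (rule CollectI, rule exI[of _ "\<lambda>_. 0"]) simp
  qed
  fix w w' :: "real^'n \<Rightarrow> complex" and a b :: complex
  assume "w \<in> restrict_to \<omega> ` polys k" "w' \<in> restrict_to \<omega> ` polys k"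
  then obtain f g :: "('n \<Rightarrow> nat) \<Rightarrow> complex" where
    w: "w = restrict_to \<omega> (\<lambda>x. \<Sum>\<alpha> | (\<Sum>i\<in>UNIV. \<alpha> i) \<le> k. f \<alpha> * of_real (\<Prod>i\<in>UNIV. (x $ i) ^ \<alpha> i))"
      "w' = restrict_to \<omega> (\<lambda>x. \<Sum>\<alpha> | (\<Sum>i\<in>UNIV. \<alpha> i) \<le> k. g \<alpha> * of_real (\<Prod>i\<in>UNIV. (x $ i) ^ \<alpha> i))"
    unfolding polys_def by blast
  let ?p = "\<lambda>x::real^'n. \<Sum>\<alpha> | (\<Sum>i\<in>UNIV. \<alpha> i) \<le> k. (a * f \<alpha> + b * g \<alpha>) * of_real (\<Prod>i\<in>UNIV. (x $ i) ^ \<alpha> i)"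
  have "(\<lambda>x. a * w x + b * w' x) = restrict_to \<omega> ?p"
    unfolding w restrict_to_def by (auto simp: fun_eq_iff sum_distrib_left sum.distrib[symmetric] algebra_simps)
  moreover have "?p \<in> polys k"
    unfolding polys_def by (rule CollectI, rule exI[of _ "\<lambda>\<alpha>. a * f \<alpha> + b * g \<alpha>"]) simp
  ultimately show "(\<lambda>x. a * w x + b * w' x) \<in> restrict_to \<omega> ` polys k" by blast
qed

section \<open>Inner balls and separated sets\<close>

text \<open>Applied to the functions bounding a cell, to the cells at a boundary point and to a
  finite subcover of the closure.\<close>

lemma finite_common_radius:
  fixes Q :: "'i \<Rightarrow> real \<Rightarrow> bool"
  assumes "finite I" and "\<And>i. i \<in> I \<Longrightarrow> \<exists>\<delta>>0. Q i \<delta>"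
    and mono: "\<And>i \<delta> \<delta>'. Q i \<delta> \<Longrightarrow> 0 < \<delta>' \<Longrightarrow> \<delta>' \<le> \<delta> \<Longrightarrow> Q i \<delta>'"
  shows "\<exists>\<delta>>0. \<delta> \<le> 1 \<and> (\<forall>i\<in>I. Q i \<delta>)"
  using assms(1,2)
proof (induction I rule: finite_induct)
  case empty
  show ?case by (intro exI[of _ 1]) auto
next
  case (insert i I)
  then obtain \<delta> \<epsilon> where "\<delta> > 0" "\<delta> \<le> 1" "\<forall>i\<in>I. Q i \<delta>" "\<epsilon> > 0" "Q i \<epsilon>" by (metis insertCI)
  then have "min \<delta> \<epsilon> > 0" "min \<delta> \<epsilon> \<le> 1" "\<forall>j\<in>insert i I. Q j (min \<delta> \<epsilon>)"
    by (auto intro: mono)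
  then show ?case by blast
qed

section \<open>Interior balls near the boundary\<close>

lemma positive_gradient_cone:
  fixes g :: "real^'n::finite \<Rightarrow> real^'n"
  assumes "continuous_on U g" "open U" "x \<in> U" "g x \<bullet> v > 0"
  shows "\<exists>\<delta>>0. \<forall>\<zeta>\<in>ball x \<delta>. \<forall>d\<in>ball v \<delta>. g \<zeta> \<bullet> d > 0"
proof -
  have "isCont g x" using assms by (simp add: continuous_on_eq_continuous_at)
  then have g: "(g \<longlongrightarrow> g x) (nhds x)" by (simp add: tendsto_nhds_iff isCont_def)
  have "((\<lambda>p. g (fst p) \<bullet> snd p) \<longlongrightarrow> g x \<bullet> v) (nhds x \<times>\<^sub>F nhds v)"
    by (intro tendsto_inner filterlim_compose[OF g filterlim_fst] filterlim_snd)
  then have "\<forall>\<^sub>F p in nhds x \<times>\<^sub>F nhds v. 0 < g (fst p) \<bullet> snd p"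
    using assms(4) by (rule order_tendstoD(1))
  then obtain P Q where PQ: "eventually P (nhds x)" "eventually Q (nhds v)" "\<And>\<zeta> d. P \<zeta> \<Longrightarrow> Q d \<Longrightarrow> 0 < g \<zeta> \<bullet> d"
    unfolding eventually_prod_filter by auto
  obtain \<delta> \<epsilon> where "\<delta> > 0" "\<And>\<zeta>. dist \<zeta> x < \<delta> \<Longrightarrow> P \<zeta>" "\<epsilon> > 0" "\<And>d. dist d v < \<epsilon> \<Longrightarrow> Q d"
    using PQ(1,2) unfolding eventually_nhds_metric by blast
  then show ?thesis
    using PQ(3) by (intro exI[of _ "min \<delta> \<epsilon>"]) (auto simp: dist_commute)
qed

lemma C1_increasing_segment:
  fixes f :: "real^'n::finite \<Rightarrow> real"
  assumes C1: "C1_with_gradient U f g" and seg: "closed_segment y w \<subseteq> U"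
    and pos: "\<And>\<zeta>. \<zeta> \<in> closed_segment y w \<Longrightarrow> g \<zeta> \<bullet> (w - y) \<ge> 0"
  shows "f y \<le> f w"
proof -
  let ?p = "\<lambda>t. y + t *\<^sub>R (w - y)"
  have in_seg: "?p t \<in> closed_segment y w" if "0 \<le> t" "t \<le> 1" for t
    using that by (auto simp: in_segment algebra_simps intro!: exI[of _ t])
  have "((\<lambda>t. f (?p t)) has_derivative (\<lambda>s. s * (g (?p t) \<bullet> (w - y)))) (at t within {0..1})" if t: "0 \<le> t" "t \<le> 1" for t
  proof -
    have "(?p has_derivative (\<lambda>s. s *\<^sub>R (w - y))) (at t within {0..1})"
      by (auto intro!: derivative_eq_intros)
    moreover have "(f has_derivative (\<lambda>v. g (?p t) \<bullet> v)) (at (?p t))"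
      using C1 seg in_seg[OF t] unfolding C1_with_gradient_def by blast
    ultimately have "((\<lambda>t. f (?p t)) has_derivative (\<lambda>s. g (?p t) \<bullet> (s *\<^sub>R (w - y)))) (at t within {0..1})"
      by (rule has_derivative_compose)
    then show ?thesis by simp
  qed
  from mvt_simple[OF zero_less_one this]
  obtain t where "t \<in> {0<..<1}" "f (?p 1) - f (?p 0) = (1 - 0) * (g (?p t) \<bullet> (w - y))" by auto
  moreover then have "g (?p t) \<bullet> (w - y) \<ge> 0" using pos in_seg[of t] by auto
  ultimately show ?thesis by simp
qed

text \<open>A form of the interior corkscrew condition. The single parameter bounds the
  neighbourhood, the admissible distances \<open>t\<close> and the ratio of the radii, so that
  shrinking it weakens the condition in every respect and finitely many conditions can share one
  value.\<close>

definition corkscrew_at :: "('a::metric_space) set \<Rightarrow> 'a \<Rightarrow> real \<Rightarrow> bool" where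
  "corkscrew_at \<Omega> x e \<longleftrightarrow> (\<forall>y \<in> \<Omega> \<inter> ball x e. \<forall>t. 0 < t \<and> t < e \<longrightarrow> (\<exists>z. dist z y \<le> t \<and> ball z (e * t) \<subseteq> \<Omega>))"

lemma corkscrew_at_mono: "corkscrew_at \<Omega> x e \<Longrightarrow> 0 < e' \<Longrightarrow> e' \<le> e \<Longrightarrow> corkscrew_at \<Omega> x e'"
proof (unfold corkscrew_at_def, intro ballI allI impI)
  fix y t
  assume c: "\<forall>y \<in> \<Omega> \<inter> ball x e. \<forall>t. 0 < t \<and> t < e \<longrightarrow> (\<exists>z. dist z y \<le> t \<and> ball z (e * t) \<subseteq> \<Omega>)"
    and e: "0 < e'" "e' \<le> e" and y: "y \<in> \<Omega> \<inter> ball x e'" and t: "0 < t \<and> t < e'"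
  have "y \<in> \<Omega> \<inter> ball x e" "0 < t \<and> t < e" using y t e by auto
  then obtain z where z: "dist z y \<le> t" "ball z (e * t) \<subseteq> \<Omega>" using c by blast
  have "e' * t \<le> e * t" using e t by (intro mult_right_mono) auto
  then have "ball z (e' * t) \<subseteq> ball z (e * t)" by (rule subset_ball)
  then show "\<exists>z. dist z y \<le> t \<and> ball z (e' * t) \<subseteq> \<Omega>" using z by blast
qed

lemma corkscrew_at_interior:
  assumes "open \<Omega>" "x \<in> \<Omega>"
  shows "\<exists>e>0. corkscrew_at \<Omega> x e"
proof -
  obtain r where r: "r > 0" "ball x r \<subseteq> \<Omega>" using assms open_contains_ball by blast
  define e where "e = min 1 (r / 2)"
  have e: "0 < e" "e \<le> 1" "2 * e \<le> r" using r by (auto simp: e_def)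
  have "ball y (e * t) \<subseteq> \<Omega>" if "y \<in> ball x e" "0 < t" "t < e" for y t
  proof -
    have "e * t \<le> 1 * e" using that e by (intro mult_mono) auto
    moreover have "dist x y < e" using that by simp
    ultimately have "dist x w < r" if "dist y w < e * t" for w
      using dist_triangle[of x w y] that e by linarith
    then have "ball y (e * t) \<subseteq> ball x r" by auto
    then show ?thesis using r by blast
  qed
  have "corkscrew_at \<Omega> x e"
    unfolding corkscrew_at_def
  proof (intro ballI allI impI)
    fix y t assume "y \<in> \<Omega> \<inter> ball x e" "0 < t \<and> t < e"
    then show "\<exists>z. dist z y \<le> t \<and> ball z (e * t) \<subseteq> \<Omega>"
      using \<open>\<And>y t. y \<in> ball x e \<Longrightarrow> 0 < t \<Longrightarrow> t < e \<Longrightarrow> ball y (e * t) \<subseteq> \<Omega>\<close>[of y t] by (intro exI[of _ y]) auto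
  qed
  then show ?thesis using e by blast
qed

lemma corkscrew_at_frontier:
  fixes \<Omega> :: "(real^'n::finite) set"
  assumes "piecewise_C1_boundary \<Omega>" "x \<in> frontier \<Omega>"
  shows "\<exists>e>0. corkscrew_at \<Omega> x e"
proof -
  from bspec[OF assms(1)[unfolded piecewise_C1_boundary_def] assms(2)]
  obtain U k f g F where *: "open U \<and> x \<in> U \<and> (\<forall>i<k. C1_with_gradient U (f i) (g i) \<and> f i x = 0) \<and> F \<subseteq> Pow {..<k::nat} \<and>
    \<Omega> \<inter> U = (\<Union>I\<in>F. {y \<in> U. \<forall>i\<in>I. f i y > 0}) \<and> (\<forall>I\<in>F. \<exists>v. \<forall>i\<in>I. g i x \<bullet> v > 0)"
    by (elim exE)
  from * have U: "open U" "x \<in> U" and F: "F \<subseteq> Pow {..<k}" by simp_all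
  from * have C1: "C1_with_gradient U (f i) (g i)" if "i < k" for i using that by simp
  from * have \<Omega>: "\<Omega> \<inter> U = (\<Union>I\<in>F. {y \<in> U. \<forall>i\<in>I. f i y > 0})" by (elim conjE)
  from * have dir: "\<exists>v. \<forall>i\<in>I. g i x \<bullet> v > 0" if "I \<in> F" for I using that by simp
  have finF: "finite F" using F by (rule finite_subset) simp
  define cell where "cell I = {y \<in> U. \<forall>i\<in>I. f i y > 0}" for I
  define Q where "Q I e \<longleftrightarrow> (\<forall>y \<in> cell I \<inter> ball x e. \<forall>t. 0 < t \<and> t < e \<longrightarrow> (\<exists>z. dist z y \<le> t \<and> ball z (e * t) \<subseteq> cell I))" for I e
  have cellQ: "\<exists>e>0. Q I e" if I: "I \<in> F" for I
  proof -
    have Ik: "I \<subseteq> {..<k}" using I F by blast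
    obtain v0 where v0: "\<And>i. i \<in> I \<Longrightarrow> g i x \<bullet> v0 > 0" using dir[OF I] by blast
    \<comment> \<open>Rescaling keeps \<open>y + t *\<^sub>R v\<close> within \<open>t\<close> of
      \<open>y\<close>. Dividing by \<open>1 + norm v0\<close> also covers \<open>v0 = 0\<close>,
      which can occur when \<open>I\<close> is empty.\<close>
    define v where "v = (1 / (1 + norm v0)) *\<^sub>R v0"
    have n0: "0 < 1 + norm v0" by (simp add: add_pos_nonneg)
    have v: "norm v \<le> 1" "\<And>i. i \<in> I \<Longrightarrow> g i x \<bullet> v > 0"
      unfolding v_def using n0 v0 by (simp_all add: abs_of_pos)
    have "\<exists>\<delta>>0. \<delta> \<le> 1 \<and> (\<forall>i\<in>I. \<forall>\<zeta>\<in>ball x \<delta>. \<forall>d\<in>ball v \<delta>. g i \<zeta> \<bullet> d > 0)"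
    proof (rule finite_common_radius)
      show "finite I" using Ik finite_subset by blast
      show "\<exists>\<delta>>0. \<forall>\<zeta>\<in>ball x \<delta>. \<forall>d\<in>ball v \<delta>. g i \<zeta> \<bullet> d > 0" if "i \<in> I" for i
        using C1[of i] that Ik U v(2) by (intro positive_gradient_cone[of U]) (auto simp: C1_with_gradient_def)
    qed auto
    then obtain \<delta>0 where \<delta>0: "\<delta>0 > 0" "\<delta>0 \<le> 1" "\<And>i \<zeta> d. i \<in> I \<Longrightarrow> \<zeta> \<in> ball x \<delta>0 \<Longrightarrow> d \<in> ball v \<delta>0 \<Longrightarrow> g i \<zeta> \<bullet> d > 0"
      by blast
    obtain r where r: "r > 0" "ball x r \<subseteq> U" using U open_contains_ball by blast
    define \<delta> where "\<delta> = min \<delta>0 r"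
    have \<delta>: "0 < \<delta>" "\<delta> \<le> 1" "\<delta> \<le> \<delta>0" "\<delta> \<le> r" using \<delta>0 r by (auto simp: \<delta>_def)
    \<comment> \<open>One third is spent on the distance from \<open>x\<close> to \<open>y\<close>
      and two thirds on the distance from \<open>y\<close> to points of the new ball, which is at
      most \<open>2 * t\<close>. All of them stay where the gradients are controlled.\<close>
    have "Q I (\<delta> / 3)"
      unfolding Q_def
    proof (intro ballI allI impI)
      fix y t assume y: "y \<in> cell I \<inter> ball x (\<delta> / 3)" and t: "0 < t \<and> t < \<delta> / 3"
      have "ball (y + t *\<^sub>R v) (\<delta> / 3 * t) \<subseteq> cell I"
      proof
        fix w assume w: "w \<in> ball (y + t *\<^sub>R v) (\<delta> / 3 * t)"
        \<comment> \<open>In units of \<open>t\<close> the displacement is a direction within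
          \<open>\<delta> / 3\<close> of \<open>v\<close>, hence in the cone along which all the
          functions of the cell increase.\<close>
        define d where "d = (1 / t) *\<^sub>R (w - y)"
        have wd: "w - y = t *\<^sub>R d" using t by (simp add: d_def)
        have "t *\<^sub>R (d - v) = w - (y + t *\<^sub>R v)" using wd by (simp add: algebra_simps)
        then have "norm (t *\<^sub>R (d - v)) < \<delta> / 3 * t" using w by (simp add: dist_norm norm_minus_commute)
        then have "t * norm (d - v) < t * (\<delta> / 3)" using t by (simp add: mult.commute)
        then have dv: "norm (d - v) < \<delta> / 3" using t by (simp only: mult_less_cancel_left_pos)
        have "norm d \<le> norm v + norm (d - v)" using norm_triangle_ineq[of v "d - v"] by simp
        then have "norm d \<le> 2" using dv v \<delta> by linarith
        then have "norm (w - y) \<le> t * 2" unfolding wd using t by (simp add: mult_left_mono)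
        then have "dist x w < \<delta>"
        proof -
          have "dist x y < \<delta> / 3" "dist y w \<le> t * 2" using y \<open>norm (w - y) \<le> t * 2\<close> by (auto simp: dist_norm norm_minus_commute)
          then show ?thesis using dist_triangle[of x w y] t by linarith
        qed
        then have wx: "w \<in> ball x \<delta>" and yx: "y \<in> ball x \<delta>" using y \<delta> by auto
        then have seg: "closed_segment y w \<subseteq> ball x \<delta>" by (simp add: closed_segment_subset)
        have dball: "d \<in> ball v \<delta>0" using dv \<delta> by (simp add: dist_norm norm_minus_commute)
        have "f i w > 0" if i: "i \<in> I" for i
        proof -
          have "f i y \<le> f i w"
          proof (rule C1_increasing_segment)
            show "C1_with_gradient U (f i) (g i)" using C1 i Ik by auto
            show "closed_segment y w \<subseteq> U" using seg r \<delta> by fastforce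
            fix \<zeta> assume "\<zeta> \<in> closed_segment y w"
            then have "\<zeta> \<in> ball x \<delta>0" using seg \<delta> by fastforce
            then have "g i \<zeta> \<bullet> d > 0" using \<delta>0(3) i dball by blast
            then show "g i \<zeta> \<bullet> (w - y) \<ge> 0" unfolding wd using t by simp
          qed
          then show ?thesis using y i by (auto simp: cell_def)
        qed
        moreover have "w \<in> U" using wx r \<delta> by fastforce
        ultimately show "w \<in> cell I" by (simp add: cell_def)
      qed
      moreover have "dist (y + t *\<^sub>R v) y \<le> t" using t v by (simp add: dist_norm mult_left_le)
      ultimately show "\<exists>z. dist z y \<le> t \<and> ball z (\<delta> / 3 * t) \<subseteq> cell I" by blast
    qed
    then show ?thesis using \<delta> by (intro exI[of _ "\<delta> / 3"]) auto
  qed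
  have monoQ: "Q I e'" if "Q I e" "0 < e'" "e' \<le> e" for I e e'
    using corkscrew_at_mono[of "cell I" x e e'] that unfolding corkscrew_at_def Q_def by simp
  have "\<exists>e>0. e \<le> 1 \<and> (\<forall>I\<in>F. Q I e)"
    by (rule finite_common_radius[OF finF cellQ]) (simp_all add: monoQ)
  then obtain e0 where e0: "e0 > 0" "\<And>I. I \<in> F \<Longrightarrow> Q I e0" by blast
  obtain r where r: "r > 0" "ball x r \<subseteq> U" using U open_contains_ball by blast
  define e where "e = min e0 r"
  have e: "0 < e" "e \<le> e0" "e \<le> r" using e0 r by (auto simp: e_def)
  have "corkscrew_at \<Omega> x e"
    unfolding corkscrew_at_def
  proof (intro ballI allI impI)
    fix y t assume y: "y \<in> \<Omega> \<inter> ball x e" and t: "0 < t \<and> t < e"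
    then have "y \<in> \<Omega> \<inter> U" using r e by auto
    then obtain I where I: "I \<in> F" "y \<in> cell I"
      unfolding \<Omega> cell_def by (elim UN_E)
    have "y \<in> cell I \<inter> ball x e" using I y by simp
    then obtain z where "dist z y \<le> t" "ball z (e * t) \<subseteq> cell I"
      using bspec[OF monoQ[OF e0(2)[OF I(1)] e(1,2), unfolded Q_def]] t by blast
    moreover have "cell I \<subseteq> \<Omega> \<inter> U" unfolding \<Omega> cell_def using I(1) by (rule UN_upper)
    ultimately show "\<exists>z. dist z y \<le> t \<and> ball z (e * t) \<subseteq> \<Omega>" by blast
  qed
  then show ?thesis using e by blast
qed

lemma corkscrew:
  fixes \<Omega> :: "(real^'n::finite) set"
  assumes "open \<Omega>" "bounded \<Omega>" "piecewise_C1_boundary \<Omega>"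
  shows "\<exists>e>0. e \<le> 1 \<and> (\<forall>y\<in>\<Omega>. \<forall>t. 0 < t \<and> t < e \<longrightarrow> (\<exists>z. dist z y \<le> t \<and> ball z (e * t) \<subseteq> \<Omega>))"
proof -
  have "\<exists>e>0. corkscrew_at \<Omega> x e" if "x \<in> closure \<Omega>" for x
  proof (cases "x \<in> \<Omega>")
    case True
    then show ?thesis using corkscrew_at_interior assms(1) by blast
  next
    case False
    then have "x \<in> frontier \<Omega>" using that assms(1) by (simp add: frontier_def interior_open)
    then show ?thesis using corkscrew_at_frontier assms(3) by blast
  qed
  then obtain e where e: "\<And>x. x \<in> closure \<Omega> \<Longrightarrow> 0 < e x" "\<And>x. x \<in> closure \<Omega> \<Longrightarrow> corkscrew_at \<Omega> x (e x)" by metis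
  have comp: "compact (closure \<Omega>)" using assms(2) by simp
  have cov: "closure \<Omega> \<subseteq> (\<Union>x\<in>closure \<Omega>. ball x (e x))" using e(1) by force
  obtain D where D: "D \<subseteq> closure \<Omega>" "finite D" "closure \<Omega> \<subseteq> (\<Union>x\<in>D. ball x (e x))"
    by (rule compactE_image[OF comp _ cov]) auto
  have "\<exists>\<delta>>0. \<delta> \<le> 1 \<and> (\<forall>x\<in>D. \<delta> \<le> e x)"
    by (rule finite_common_radius[OF D(2)]) (use D(1) e(1) in auto)
  then obtain \<delta> where \<delta>: "\<delta> > 0" "\<delta> \<le> 1" "\<And>x. x \<in> D \<Longrightarrow> \<delta> \<le> e x" by blast
  have "\<exists>z. dist z y \<le> t \<and> ball z (\<delta> * t) \<subseteq> \<Omega>" if y: "y \<in> \<Omega>" and t: "0 < t \<and> t < \<delta>" for y t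
  proof -
    obtain x where x: "x \<in> D" "y \<in> ball x (e x)" using D(3) y closure_subset by blast
    have "t < e x" using \<delta>(3)[OF x(1)] t by linarith
    then obtain z where z: "dist z y \<le> t" "ball z (e x * t) \<subseteq> \<Omega>"
      using e(2)[of x] D(1) x y t unfolding corkscrew_at_def by blast
    have "\<delta> * t \<le> e x * t" using \<delta>(3)[OF x(1)] t by (intro mult_right_mono) auto
    then have "ball z (\<delta> * t) \<subseteq> ball z (e x * t)" by (rule subset_ball)
    then show ?thesis using z by blast
  qed
  then show ?thesis using \<delta> by blast
qed

section \<open>Separated sets and volume counting\<close>

definition separated :: "real \<Rightarrow> 'a::metric_space set \<Rightarrow> bool" where
  "separated a Y \<longleftrightarrow> (\<forall>y\<in>Y. \<forall>y'\<in>Y. y \<noteq> y' \<longrightarrow> a \<le> dist y y')"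

text \<open>The balls of radius \<open>a / 2\<close> around the points are disjoint and lie in the
  ball of radius \<open>r + a / 2\<close>; the volume of the unit ball cancels.\<close>

lemma separated_card_le:
  fixes Y :: "'a::euclidean_space set"
  assumes Y: "finite Y" "separated a Y" "Y \<subseteq> ball x r" and a: "0 < a" and r: "0 \<le> r"
  shows "real (card Y) * (a / 2) ^ DIM('a) \<le> (r + a / 2) ^ DIM('a)"
proof -
  define V where "V = unit_ball_vol (real DIM('a))"
  have V: "0 < V" by (simp add: V_def)
  have disj: "disjoint_family_on (\<lambda>y. ball y (a / 2)) Y"
    unfolding disjoint_family_on_def
  proof (intro ballI impI)
    fix y y' assume "y \<in> Y" "y' \<in> Y" "y \<noteq> y'"
    then have "a \<le> dist y y'" using Y(2) by (simp add: separated_def)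
    then show "ball y (a / 2) \<inter> ball y' (a / 2) = {}"
      by (intro disjoint_ballI) simp
  qed
  have sub: "(\<Union>y\<in>Y. ball y (a / 2)) \<subseteq> ball x (r + a / 2)"
  proof
    fix z assume "z \<in> (\<Union>y\<in>Y. ball y (a / 2))"
    then obtain y where "y \<in> Y" "dist y z < a / 2" by auto
    then show "z \<in> ball x (r + a / 2)" using Y(3) dist_triangle[of x z y] by fastforce
  qed
  have "ennreal (real (card Y) * (V * (a / 2) ^ DIM('a))) = (\<Sum>y\<in>Y. emeasure lborel (ball y (a / 2)))"
    using a by (simp add: emeasure_ball V_def ennreal_mult ennreal_of_nat_eq_real_of_nat)
  also have "\<dots> = emeasure lborel (\<Union>y\<in>Y. ball y (a / 2))"
    by (rule sum_emeasure[OF _ disj Y(1)]) auto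
  also have "\<dots> \<le> emeasure lborel (ball x (r + a / 2))"
    by (rule emeasure_mono[OF sub]) simp
  also have "\<dots> = ennreal (V * (r + a / 2) ^ DIM('a))"
    using a r by (simp add: emeasure_ball V_def)
  finally have "real (card Y) * (V * (a / 2) ^ DIM('a)) \<le> V * (r + a / 2) ^ DIM('a)"
    using V a r by (subst (asm) ennreal_le_iff) auto
  then have "V * (real (card Y) * (a / 2) ^ DIM('a)) \<le> V * (r + a / 2) ^ DIM('a)"
    by (simp only: mult_ac)
  then show ?thesis using V by simp
qed

text \<open>Separated subsets of a bounded set have bounded cardinality, so there is one of largest
  cardinality; a point at distance at least \<open>a\<close> from all its members could be added to
  it.\<close>

lemma maximal_separated_subset:
  fixes Z :: "'a::euclidean_space set"
  assumes "bounded Z" "0 < a"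
  shows "\<exists>Y\<subseteq>Z. finite Y \<and> separated a Y \<and> (\<forall>z\<in>Z. \<exists>y\<in>Y. dist z y < a)"
proof -
  obtain x r where r: "Z \<subseteq> ball x r" using bounded_subset_ballD[OF assms(1)] by blast
  define R where "R = max 0 r"
  have R: "0 \<le> R" "Z \<subseteq> ball x R" using r by (auto simp: R_def)
  let ?P = "\<lambda>Y. Y \<subseteq> Z \<and> finite Y \<and> separated a Y"
  let ?b = "(R + a / 2) ^ DIM('a) / (a / 2) ^ DIM('a)"
  have bnd: "card Y < Suc (nat \<lceil>?b\<rceil>)" if "?P Y" for Y
  proof -
    have "real (card Y) \<le> ?b"
      using separated_card_le[of Y a x R] that subset_trans[OF _ R(2), of Y] R(1) assms(2) by (simp add: pos_le_divide_eq)
    then show ?thesis by linarith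
  qed
  have "\<exists>Y. ?P Y \<and> (\<forall>Y'. ?P Y' \<longrightarrow> card Y' \<le> card Y)"
    by (rule ex_has_greatest_nat[of ?P "{}"]) (use bnd in \<open>auto simp: separated_def less_imp_le\<close>)
  then obtain Y where Y: "?P Y" and max: "\<And>Y'. ?P Y' \<Longrightarrow> card Y' \<le> card Y" by blast
  have "\<exists>y\<in>Y. dist z y < a" if z: "z \<in> Z" for z
  proof (rule ccontr)
    assume "\<not> ?thesis"
    then have far: "\<And>y. y \<in> Y \<Longrightarrow> a \<le> dist z y" by force
    then have "z \<notin> Y" using assms(2) by fastforce
    moreover have "?P (insert z Y)"
      using Y z far by (auto simp: separated_def dist_commute)
    ultimately show False using max[of "insert z Y"] Y by simp
  qed
  then show ?thesis using Y by blast
qed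

section \<open>Differentiable Lipschitz functions and partitions of unity\<close>

text \<open>Differentiability at every point, on top of the Lipschitz bound, lets the classical
  partial derivatives serve as weak ones and avoids Rademacher's theorem. For this reason the
  constructions below use the square of the positive part where a plain maximum would be the usual
  choice.\<close>

definition lip_diff :: "real \<Rightarrow> ('a::euclidean_space \<Rightarrow> real) \<Rightarrow> bool" where
  "lip_diff L f \<longleftrightarrow> (\<forall>x y. \<bar>f x - f y\<bar> \<le> L * dist x y) \<and> (\<forall>x. f differentiable (at x))"

lemma lip_diffD: "lip_diff L f \<Longrightarrow> \<bar>f x - f y\<bar> \<le> L * dist x y"
  and lip_diff_differentiable: "lip_diff L f \<Longrightarrow> f differentiable (at x)"
  by (auto simp: lip_diff_def)

lemma lip_diff_mono: "lip_diff L f \<Longrightarrow> L \<le> L' \<Longrightarrow> lip_diff L' f"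
  unfolding lip_diff_def by (meson mult_right_mono order_trans zero_le_dist)

lemma lip_diff_add:
  assumes f: "lip_diff L f" and g: "lip_diff M g"
  shows "lip_diff (L + M) (\<lambda>x. f x + g x)"
  unfolding lip_diff_def
proof (intro conjI allI)
  fix x y
  have "\<bar>f x + g x - (f y + g y)\<bar> \<le> \<bar>f x - f y\<bar> + \<bar>g x - g y\<bar>" by linarith
  also have "\<dots> \<le> L * dist x y + M * dist x y" by (intro add_mono lip_diffD f g)
  finally show "\<bar>f x + g x - (f y + g y)\<bar> \<le> (L + M) * dist x y" by (simp add: distrib_right)
qed (intro differentiable_add lip_diff_differentiable[OF f] lip_diff_differentiable[OF g])

lemma lip_diff_minus: "lip_diff L f \<Longrightarrow> lip_diff L (\<lambda>x. c - f x)"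
  unfolding lip_diff_def by (auto simp: abs_minus_commute intro!: derivative_intros)

lemma lip_diff_cmult: "lip_diff L f \<Longrightarrow> lip_diff (\<bar>c\<bar> * L) (\<lambda>x. c * f x)"
  unfolding lip_diff_def
  by (auto simp: right_diff_distrib[symmetric] abs_mult mult.assoc intro!: mult_left_mono)

lemma lip_diff_mult:
  assumes f: "lip_diff L f" "\<And>x. \<bar>f x\<bar> \<le> A" and g: "lip_diff M g" "\<And>x. \<bar>g x\<bar> \<le> B"
  shows "lip_diff (L * B + A * M) (\<lambda>x. f x * g x)"
  unfolding lip_diff_def
proof (intro conjI allI)
  fix x y
  have A0: "0 \<le> A" using f(2)[of x] by linarith
  have "f x * g x - f y * g y = (f x - f y) * g x + f y * (g x - g y)" by (simp add: algebra_simps)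
  also have "\<bar>\<dots>\<bar> \<le> \<bar>f x - f y\<bar> * \<bar>g x\<bar> + \<bar>f y\<bar> * \<bar>g x - g y\<bar>"
    by (rule order_trans[OF abs_triangle_ineq]) (simp add: abs_mult)
  also have "\<dots> \<le> (L * dist x y) * B + A * (M * dist x y)"
    using A0 order_trans[OF abs_ge_zero lip_diffD[OF f(1), of x y]]
    by (intro add_mono mult_mono f g lip_diffD) auto
  finally show "\<bar>f x * g x - f y * g y\<bar> \<le> (L * B + A * M) * dist x y" by (simp add: algebra_simps)
qed (intro differentiable_mult lip_diff_differentiable[OF f(1)] lip_diff_differentiable[OF g(1)])

lemma lip_diff_inverse:
  assumes f: "lip_diff L f" and m: "0 < m" "\<And>x. m \<le> f x"
  shows "lip_diff (L / m\<^sup>2) (\<lambda>x. 1 / f x)"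
  unfolding lip_diff_def
proof (intro conjI allI)
  fix x y
  have pos: "0 < f x" "0 < f y" using m less_le_trans by blast+
  have "1 / f x - 1 / f y = (f y - f x) / (f x * f y)" using pos by (simp add: field_simps)
  then have "\<bar>1 / f x - 1 / f y\<bar> = \<bar>f x - f y\<bar> / (f x * f y)"
    using pos by (simp add: abs_mult abs_minus_commute)
  also have "\<dots> \<le> (L * dist x y) / m\<^sup>2"
    unfolding power2_eq_square using m pos lip_diffD[OF f, of x y]
    by (intro frac_le mult_mono) (auto intro: order_trans[OF abs_ge_zero])
  finally show "\<bar>1 / f x - 1 / f y\<bar> \<le> L / m\<^sup>2 * dist x y" by simp
next
  fix x
  have "f x \<noteq> 0" using m(1) m(2)[of x] by linarith
  then show "(\<lambda>x. 1 / f x) differentiable at x"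
    by (intro differentiable_divide lip_diff_differentiable[OF f]) auto
qed

text \<open>Between two given points at most \<open>2 * \<kappa>\<close> summands can change, so the
  constant depends on the overlap and not on the size of \<open>Y\<close>.\<close>

lemma lip_diff_sum:
  fixes f :: "'i \<Rightarrow> 'a::euclidean_space \<Rightarrow> real"
  assumes fin: "finite Y" and f: "\<And>y. y \<in> Y \<Longrightarrow> lip_diff L (f y)" and L: "0 \<le> L"
    and count: "\<And>x. card {y\<in>Y. f y x \<noteq> 0} \<le> \<kappa>"
  shows "lip_diff (2 * real \<kappa> * L) (\<lambda>x. \<Sum>y\<in>Y. f y x)"
  unfolding lip_diff_def
proof (intro conjI allI)
  fix x x'
  let ?N = "{y\<in>Y. f y x \<noteq> 0} \<union> {y\<in>Y. f y x' \<noteq> 0}"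
  have "(\<Sum>y\<in>Y. f y x) - (\<Sum>y\<in>Y. f y x') = (\<Sum>y\<in>?N. f y x - f y x')"
    unfolding sum_subtractf[symmetric] by (rule sum.mono_neutral_right) (use fin in auto)
  also have "\<bar>\<dots>\<bar> \<le> (\<Sum>y\<in>?N. \<bar>f y x - f y x'\<bar>)" by (rule sum_abs)
  also have "\<dots> \<le> (\<Sum>y\<in>?N. L * dist x x')" by (intro sum_mono lip_diffD f) auto
  also have "\<dots> = real (card ?N) * (L * dist x x')" by simp
  also have "\<dots> \<le> real (2 * \<kappa>) * (L * dist x x')"
  proof (rule mult_right_mono)
    have "card ?N \<le> card {y\<in>Y. f y x \<noteq> 0} + card {y\<in>Y. f y x' \<noteq> 0}" by (rule card_Un_le)
    then show "real (card ?N) \<le> real (2 * \<kappa>)" using count[of x] count[of x'] by linarith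
  qed (use L in simp)
  finally show "\<bar>(\<Sum>y\<in>Y. f y x) - (\<Sum>y\<in>Y. f y x')\<bar> \<le> 2 * real \<kappa> * L * dist x x'" by simp
qed (intro differentiable_sum fin ballI lip_diff_differentiable[OF f])

definition square_pos :: "real \<Rightarrow> real" where
  "square_pos t = (max 0 t)\<^sup>2"

lemma square_pos_differentiable: "square_pos differentiable (at t)"
proof -
  have "(square_pos has_real_derivative 2 * max 0 t) (at t)"
  proof (cases t "0::real" rule: linorder_cases)
    case less
    have "((\<lambda>t. 0) has_real_derivative 2 * max 0 t) (at t)" using less by simp
    then show ?thesis
      by (rule has_field_derivative_transform_within_open[where S="{..<0}"]) (use less in \<open>auto simp: square_pos_def\<close>)
  next
    case equal
    have "((\<lambda>h. square_pos h / h) \<longlongrightarrow> 0) (at 0)"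
    proof (rule Lim_null_comparison[where g=abs])
      have "norm (square_pos h / h) \<le> \<bar>h\<bar>" for h
        by (auto simp: square_pos_def max_def power2_eq_square)
      then show "\<forall>\<^sub>F h in at 0. norm (square_pos h / h) \<le> \<bar>h\<bar>" by (intro always_eventually) blast
      show "(abs \<longlongrightarrow> 0) (at (0::real))" by (intro tendsto_eq_intros) auto
    qed
    then show ?thesis using equal by (simp add: DERIV_def square_pos_def)
  next
    case greater
    have "((\<lambda>t. t\<^sup>2) has_real_derivative 2 * max 0 t) (at t)"
      using greater by (auto intro!: derivative_eq_intros)
    then show ?thesis
      by (rule has_field_derivative_transform_within_open[where S="{0<..}"]) (use greater in \<open>auto simp: square_pos_def\<close>)
  qed
  then show ?thesis using real_differentiable_def by blast
qed

lemma square_pos_lipschitz: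
  assumes "a \<le> 1" "b \<le> 1"
  shows "\<bar>square_pos a - square_pos b\<bar> \<le> 2 * \<bar>a - b\<bar>"
proof -
  let ?a = "max 0 a" and ?b = "max 0 b"
  have "square_pos a - square_pos b = (?a + ?b) * (?a - ?b)"
    by (simp add: square_pos_def power2_eq_square algebra_simps)
  also have "\<bar>\<dots>\<bar> = (?a + ?b) * \<bar>?a - ?b\<bar>" by (simp add: abs_mult)
  also have "\<dots> \<le> 2 * \<bar>a - b\<bar>" using assms by (intro mult_mono) auto
  finally show ?thesis .
qed

lemma square_pos_bounds: "0 \<le> square_pos t" "t \<le> 0 \<Longrightarrow> square_pos t = 0" "t \<le> 1 \<Longrightarrow> square_pos t \<le> 1"
  by (auto simp: square_pos_def power_le_one)

lemma lip_diff_square_pos: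
  assumes f: "lip_diff L f" and le: "\<And>x. f x \<le> 1"
  shows "lip_diff (2 * L) (\<lambda>x. square_pos (f x))"
  unfolding lip_diff_def
proof (intro conjI allI)
  fix x y
  have "\<bar>square_pos (f x) - square_pos (f y)\<bar> \<le> 2 * \<bar>f x - f y\<bar>" by (rule square_pos_lipschitz[OF le le])
  also have "\<dots> \<le> 2 * (L * dist x y)" by (intro mult_left_mono lip_diffD[OF f]) auto
  finally show "\<bar>square_pos (f x) - square_pos (f y)\<bar> \<le> 2 * L * dist x y" by simp
next
  fix x
  show "(\<lambda>x. square_pos (f x)) differentiable at x"
    using differentiable_chain_at[OF lip_diff_differentiable[OF f] square_pos_differentiable, of x] by (simp add: o_def)
qed

text \<open>Built on the squared distance, which unlike the distance is differentiable at the centre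
  \<open>y\<close> too.\<close>

definition bump :: "real \<Rightarrow> 'a::euclidean_space \<Rightarrow> 'a \<Rightarrow> real" where
  "bump \<rho> y x = square_pos (1 - (dist x y)\<^sup>2 / \<rho>\<^sup>2)"

lemma bump_range: "0 \<le> bump \<rho> y x" "bump \<rho> y x \<le> 1"
  unfolding bump_def by (auto intro: square_pos_bounds)

lemma bump_eq_0: "0 < \<rho> \<Longrightarrow> \<rho> \<le> dist x y \<Longrightarrow> bump \<rho> y x = 0"
  unfolding bump_def by (intro square_pos_bounds(2)) (simp add: divide_simps power_mono)

lemma bump_ge:
  assumes "0 < \<rho>" "dist x y \<le> q * \<rho>" "q\<^sup>2 \<le> 1"
  shows "(1 - q\<^sup>2)\<^sup>2 \<le> bump \<rho> y x"
proof -
  have "(dist x y)\<^sup>2 \<le> (q * \<rho>)\<^sup>2" using assms by (intro power_mono) auto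
  then have "(dist x y)\<^sup>2 / \<rho>\<^sup>2 \<le> q\<^sup>2" using assms(1) by (simp add: power_mult_distrib divide_simps)
  then show ?thesis
    unfolding bump_def square_pos_def using assms(3) by (intro power_mono) auto
qed

lemma lip_diff_bump:
  assumes \<rho>: "0 < \<rho>"
  shows "lip_diff (4 / \<rho>) (bump \<rho> y)"
  unfolding lip_diff_def
proof (intro conjI allI)
  fix x x'
  \<comment> \<open>The squared distance is not Lipschitz on the whole space. Truncating the
    distance at \<rho> leaves the bump unchanged, since \<open>square_pos\<close> vanishes for
    arguments up to 0, and makes the argument globally Lipschitz.\<close>
  let ?g = "\<lambda>x. 1 - (min (dist x y) \<rho>)\<^sup>2 / \<rho>\<^sup>2"
  have b: "bump \<rho> y x = square_pos (?g x)" for x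
    using \<rho> by (cases "dist x y \<le> \<rho>") (auto simp: bump_def min_def square_pos_bounds(2) divide_simps power_mono)
  let ?m = "min (dist x y) \<rho>" and ?m' = "min (dist x' y) \<rho>"
  have "?g x - ?g x' = (?m' + ?m) * (?m' - ?m) / \<rho>\<^sup>2"
    by (simp add: power2_eq_square algebra_simps diff_divide_distrib)
  then have "\<bar>?g x - ?g x'\<bar> = (?m' + ?m) * \<bar>?m' - ?m\<bar> / \<rho>\<^sup>2"
    using \<rho> by (simp add: abs_mult)
  also have "\<dots> \<le> (2 * \<rho>) * dist x x' / \<rho>\<^sup>2"
  proof (intro divide_right_mono mult_mono)
    have "\<bar>?m' - ?m\<bar> \<le> \<bar>dist x' y - dist x y\<bar>" by linarith
    also have "\<dots> \<le> dist x x'" using abs_dist_diff_le[of x' y x] by (simp add: dist_commute)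
    finally show "\<bar>?m' - ?m\<bar> \<le> dist x x'" .
  qed (use \<rho> in auto)
  also have "\<dots> = 2 / \<rho> * dist x x'" using \<rho> by (simp add: power2_eq_square)
  finally have g: "\<bar>?g x - ?g x'\<bar> \<le> 2 / \<rho> * dist x x'" .
  have "\<bar>bump \<rho> y x - bump \<rho> y x'\<bar> \<le> 2 * \<bar>?g x - ?g x'\<bar>"
    unfolding b by (rule square_pos_lipschitz) auto
  then show "\<bar>bump \<rho> y x - bump \<rho> y x'\<bar> \<le> 4 / \<rho> * dist x x'" using g by simp
next
  fix x
  have "(\<lambda>x. 1 - (dist x y)\<^sup>2 / \<rho>\<^sup>2) differentiable at x"
    unfolding dist_norm power2_norm_eq_inner divide_inverse by (intro derivative_intros differentiable_inner differentiable_diff differentiable_mult)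
  then show "bump \<rho> y differentiable at x"
    using differentiable_chain_at[OF _ square_pos_differentiable, of "\<lambda>x. 1 - (dist x y)\<^sup>2 / \<rho>\<^sup>2" x]
    by (simp add: o_def bump_def[abs_def])
qed

text \<open>Up to half the radius the bump is at least \<open>(1 - 1 / 4)\<^sup>2 = 9 / 16\<close>,
  so the factor \<open>16 / 9\<close> makes the argument of \<open>square_pos\<close> nonpositive
  there and the function equals 1. The outer \<open>square_pos\<close> keeps it differentiable where
  it reaches 1.\<close>

definition plateau :: "real \<Rightarrow> 'a::euclidean_space \<Rightarrow> 'a \<Rightarrow> real" where
  "plateau \<rho> y x = 1 - square_pos (1 - 16 / 9 * bump \<rho> y x)"

lemma plateau_range: "0 \<le> plateau \<rho> y x" "plateau \<rho> y x \<le> 1"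
  using bump_range[of \<rho> y x] square_pos_bounds[of "1 - 16 / 9 * bump \<rho> y x"] by (auto simp: plateau_def)

lemma plateau_eq_0: "0 < \<rho> \<Longrightarrow> \<rho> \<le> dist x y \<Longrightarrow> plateau \<rho> y x = 0"
  by (simp add: plateau_def bump_eq_0 square_pos_def)

lemma plateau_eq_1:
  assumes "0 < \<rho>" "dist x y \<le> \<rho> / 2"
  shows "plateau \<rho> y x = 1"
proof -
  have "(1 - (1 / 2)\<^sup>2)\<^sup>2 \<le> bump \<rho> y x" using assms by (intro bump_ge) (auto simp: power2_eq_square)
  then have "9 / 16 \<le> bump \<rho> y x" by (simp add: power2_eq_square)
  then show ?thesis by (simp add: plateau_def square_pos_bounds(2))
qed

text \<open>\<open>128 / 9\<close> is the constant 4 of the bump times \<open>16 / 9\<close> times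
  the 2 contributed by \<open>square_pos\<close>.\<close>

lemma lip_diff_plateau: "0 < \<rho> \<Longrightarrow> lip_diff (128 / (9 * \<rho>)) (plateau \<rho> y)"
  unfolding plateau_def[abs_def]
  using lip_diff_minus[OF lip_diff_square_pos[OF lip_diff_minus[OF lip_diff_cmult[OF lip_diff_bump[of \<rho> y], of "16 / 9"], of 1]], of 1]
  bump_range(1)[of \<rho> y] by simp

text \<open>A plateau function \<open>\<psi>\<^sub>y\<close> keeps its full value, and the rest of the mass is distributed
  according to the functions \<open>\<theta>\<^sub>y\<close>. The term with \<open>square_pos\<close> in the denominator vanishes where the sum
  of the \<open>\<theta>\<^sub>y\<close> is at least \<open>c\<close>; elsewhere it keeps the denominator away from \<open>0\<close>.\<close>

definition pu_function :: "'i set \<Rightarrow> real \<Rightarrow> ('i \<Rightarrow> 'a::euclidean_space \<Rightarrow> real) \<Rightarrow> ('i \<Rightarrow> 'a \<Rightarrow> real) \<Rightarrow> 'i \<Rightarrow> 'a \<Rightarrow> real" where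
  "pu_function Y c \<psi> \<theta> y x = \<psi> y x + (1 - (\<Sum>y\<in>Y. \<psi> y x)) * (\<theta> y x * (1 / ((\<Sum>y\<in>Y. \<theta> y x) + square_pos (c - (\<Sum>y\<in>Y. \<theta> y x)))))"

text \<open>At each point at most one plateau is nonzero, so the sum of the plateaus lies between 0
  and 1, and where one of them equals 1 no mass is left to distribute. The Lipschitz constant is
  what the product and quotient rules give for sums with overlap \<kappa>; it is proportional to
  \<open>L\<close> and independent of the cardinality of \<open>Y\<close>.\<close>

lemma pu_function:
  fixes \<psi> \<theta> :: "'i \<Rightarrow> 'a::euclidean_space \<Rightarrow> real"
  assumes fin: "finite Y" and L: "0 \<le> L" and c: "0 < c" "c \<le> 1"
    and \<psi>: "\<And>y. y \<in> Y \<Longrightarrow> lip_diff L (\<psi> y)" "\<And>y x. 0 \<le> \<psi> y x" "\<And>y x. \<psi> y x \<le> 1"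
    and \<theta>: "\<And>y. y \<in> Y \<Longrightarrow> lip_diff L (\<theta> y)" "\<And>y x. 0 \<le> \<theta> y x" "\<And>y x. \<theta> y x \<le> 1"
    and count: "\<And>x. card {y\<in>Y. \<psi> y x \<noteq> 0} \<le> \<kappa>" "\<And>x. card {y\<in>Y. \<theta> y x \<noteq> 0} \<le> \<kappa>"
    and disj: "\<forall>y\<in>Y. \<forall>y'\<in>Y. \<forall>x. \<psi> y x \<noteq> 0 \<longrightarrow> \<psi> y' x \<noteq> 0 \<longrightarrow> y = y'"
    and y: "y \<in> Y"
  shows "0 \<le> pu_function Y c \<psi> \<theta> y x"
    and "pu_function Y c \<psi> \<theta> y x \<noteq> 0 \<Longrightarrow> \<psi> y x \<noteq> 0 \<or> \<theta> y x \<noteq> 0"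
    and "\<psi> y x = 1 \<Longrightarrow> pu_function Y c \<psi> \<theta> y x = 1"
    and "c \<le> (\<Sum>y\<in>Y. \<theta> y x) \<Longrightarrow> (\<Sum>y\<in>Y. pu_function Y c \<psi> \<theta> y x) = 1"
    and "lip_diff ((1 + (2 * real \<kappa> * (4 / c\<^sup>2) + (4 / c\<^sup>2 + 6 * real \<kappa> * (16 / c ^ 4)))) * L) (pu_function Y c \<psi> \<theta> y)"
proof -
  define X where "X x = (\<Sum>y\<in>Y. \<psi> y x)" for x
  define S where "S x = (\<Sum>y\<in>Y. \<theta> y x)" for x
  define D where "D x = S x + square_pos (c - S x)" for x
  have pu: "pu_function Y c \<psi> \<theta> y x = \<psi> y x + (1 - X x) * (\<theta> y x * (1 / D x))" for y x
    by (simp add: pu_function_def X_def S_def D_def)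
  have S0: "0 \<le> S x" for x unfolding S_def by (intro sum_nonneg \<theta>)
  have X_single: "X x = \<psi> y x" if "y \<in> Y" "\<psi> y x \<noteq> 0" for x y
  proof -
    have "X x = (\<Sum>z\<in>{y}. \<psi> z x)"
      unfolding X_def by (rule sum.mono_neutral_right) (use fin that disj in auto)
    then show ?thesis by simp
  qed
  have X01: "0 \<le> X x" "X x \<le> 1" for x
  proof -
    show "0 \<le> X x" unfolding X_def by (intro sum_nonneg \<psi>)
    show "X x \<le> 1"
    proof (cases "\<exists>y\<in>Y. \<psi> y x \<noteq> 0")
      case True
      then show ?thesis using X_single \<psi>(3) by metis
    next
      case False
      then show ?thesis by (simp add: X_def)
    qed
  qed
  \<comment> \<open>If the sum of the \<theta> is at least \<open>c / 2\<close>, it suffices alone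
    since \<open>c\<^sup>2 \<le> c\<close>; otherwise the \<open>square_pos\<close> term is at least
    \<open>(c / 2)\<^sup>2\<close>.\<close>
  have D: "c\<^sup>2 / 4 \<le> D x" for x
  proof (cases "c / 2 \<le> S x")
    case True
    have "c\<^sup>2 \<le> c" using c by (simp add: power2_eq_square mult_left_le)
    then show ?thesis using True square_pos_bounds(1)[of "c - S x"] c by (simp add: D_def)
  next
    case False
    then have "(c / 2)\<^sup>2 \<le> square_pos (c - S x)" unfolding square_pos_def using c by (intro power_mono) auto
    then show ?thesis using S0[of x] by (simp add: D_def power_divide)
  qed
  have c4: "0 < c\<^sup>2 / 4" using c by simp
  have Dpos: "0 < D x" for x using c4 D less_le_trans by blast
  show "0 \<le> pu_function Y c \<psi> \<theta> y x"
    unfolding pu using \<psi>(2) \<theta>(2) X01(2) Dpos[of x] by (intro add_nonneg_nonneg mult_nonneg_nonneg) (auto simp: less_imp_le)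
  show "pu_function Y c \<psi> \<theta> y x \<noteq> 0 \<Longrightarrow> \<psi> y x \<noteq> 0 \<or> \<theta> y x \<noteq> 0" unfolding pu by auto
  show "pu_function Y c \<psi> \<theta> y x = 1" if "\<psi> y x = 1" using X_single[OF y, of x] that unfolding pu by simp
  show "(\<Sum>y\<in>Y. pu_function Y c \<psi> \<theta> y x) = 1" if "c \<le> (\<Sum>y\<in>Y. \<theta> y x)"
  proof -
    have "D x = S x" using that by (simp add: D_def S_def square_pos_bounds(2))
    moreover have "(\<Sum>y\<in>Y. pu_function Y c \<psi> \<theta> y x) = X x + (1 - X x) * (S x * (1 / D x))"
      unfolding pu sum.distrib X_def[symmetric] sum_distrib_left[symmetric] sum_distrib_right[symmetric] S_def[symmetric] ..
    ultimately show ?thesis using Dpos[of x] by simp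
  qed
  have lX: "lip_diff (2 * real \<kappa> * L) (\<lambda>x. 1 - X x)"
    unfolding X_def by (intro lip_diff_minus lip_diff_sum fin \<psi>(1) L count(1))
  have lS: "lip_diff (2 * real \<kappa> * L) S"
    unfolding S_def[abs_def] by (intro lip_diff_sum fin \<theta>(1) L count(2))
  have "lip_diff (2 * (2 * real \<kappa> * L)) (\<lambda>x. square_pos (c - S x))"
    by (intro lip_diff_square_pos lip_diff_minus lS) (use S0 c in \<open>auto intro: order_trans[of _ c]\<close>)
  from lip_diff_add[OF lS this] have lD: "lip_diff (6 * real \<kappa> * L) D"
    unfolding D_def[abs_def] by (simp add: mult_ac)
  have lI: "lip_diff (6 * real \<kappa> * L / (c\<^sup>2 / 4)\<^sup>2) (\<lambda>x. 1 / D x)" by (rule lip_diff_inverse[OF lD c4 D])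
  have bI: "\<bar>1 / D x\<bar> \<le> 4 / c\<^sup>2" for x
    using D[of x] Dpos[of x] c by (simp add: field_simps)
  have lT: "lip_diff (L * (4 / c\<^sup>2) + 1 * (6 * real \<kappa> * L / (c\<^sup>2 / 4)\<^sup>2)) (\<lambda>x. \<theta> y x * (1 / D x))"
    by (rule lip_diff_mult[OF \<theta>(1)[OF y] _ lI bI]) (use \<theta> in auto)
  have bT: "\<bar>\<theta> y x * (1 / D x)\<bar> \<le> 4 / c\<^sup>2" for x
  proof -
    have "\<bar>\<theta> y x\<bar> * \<bar>1 / D x\<bar> \<le> 1 * (4 / c\<^sup>2)" using \<theta> by (intro mult_mono bI) auto
    then show ?thesis by (simp only: abs_mult)
  qed
  have "lip_diff (2 * real \<kappa> * L * (4 / c\<^sup>2) + 1 * (L * (4 / c\<^sup>2) + 1 * (6 * real \<kappa> * L / (c\<^sup>2 / 4)\<^sup>2))) (\<lambda>x. (1 - X x) * (\<theta> y x * (1 / D x)))"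
    by (rule lip_diff_mult[OF lX _ lT bT]) (use X01 in auto)
  from lip_diff_add[OF \<psi>(1)[OF y] this]
  have "lip_diff (L + (2 * real \<kappa> * L * (4 / c\<^sup>2) + 1 * (L * (4 / c\<^sup>2) + 1 * (6 * real \<kappa> * L / (c\<^sup>2 / 4)\<^sup>2)))) (pu_function Y c \<psi> \<theta> y)"
    unfolding pu[abs_def] .
  moreover have "L + (2 * real \<kappa> * L * (4 / c\<^sup>2) + 1 * (L * (4 / c\<^sup>2) + 1 * (6 * real \<kappa> * L / (c\<^sup>2 / 4)\<^sup>2))) =
    (1 + (2 * real \<kappa> * (4 / c\<^sup>2) + (4 / c\<^sup>2 + 6 * real \<kappa> * (16 / c ^ 4)))) * L"
    by (simp add: power_divide algebra_simps flip: power_mult)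
  ultimately show "lip_diff ((1 + (2 * real \<kappa> * (4 / c\<^sup>2) + (4 / c\<^sup>2 + 6 * real \<kappa> * (16 / c ^ 4)))) * L) (pu_function Y c \<psi> \<theta> y)"
    by simp
qed

section \<open>Weak derivatives of differentiable Lipschitz functions\<close>

lemma DERIV_along_axis:
  fixes g :: "real^'n::finite \<Rightarrow> real"
  assumes "g differentiable (at (x + t *\<^sub>R axis i 1))"
  shows "DERIV (\<lambda>s. g (x + s *\<^sub>R axis i 1)) t :> partial_deriv i g (x + t *\<^sub>R axis i 1)"
proof -
  obtain g' where g': "(g has_derivative g') (at (x + t *\<^sub>R axis i 1))"
    using assms unfolding differentiable_def by blast
  have "((\<lambda>s. x + s *\<^sub>R axis i 1) has_derivative (\<lambda>s. s *\<^sub>R axis i 1)) (at t)"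
    by (auto intro!: derivative_eq_intros)
  from has_derivative_compose[OF this g']
  have "((\<lambda>s. g (x + s *\<^sub>R axis i 1)) has_derivative (\<lambda>s. g' (s *\<^sub>R axis i 1))) (at t)" .
  moreover have "(\<lambda>s. g' (s *\<^sub>R axis i 1)) = (*) (g' (axis i 1))"
    using has_derivative_bounded_linear[OF g'] by (auto simp: fun_eq_iff linear_simps mult.commute)
  ultimately show ?thesis
    unfolding has_field_derivative_def partial_deriv_eq[OF g'] by simp
qed

lemma difference_quotient_tendsto:
  fixes g :: "real^'n::finite \<Rightarrow> real"
  assumes "g differentiable (at x)" and e: "\<And>k::nat. 0 < e k" "e \<longlonglongrightarrow> 0"
  shows "(\<lambda>k. (g (x + e k *\<^sub>R axis i 1) - g x) / e k) \<longlonglongrightarrow> partial_deriv i g x"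
proof -
  have "DERIV (\<lambda>s. g (x + s *\<^sub>R axis i 1)) 0 :> partial_deriv i g (x + 0 *\<^sub>R axis i 1)"
    by (rule DERIV_along_axis) (simp add: assms(1))
  then have "((\<lambda>s. (g (x + s *\<^sub>R axis i 1) - g x) / s) \<longlongrightarrow> partial_deriv i g x) (at 0)"
    by (simp add: DERIV_def)
  moreover have "filterlim e (at 0) sequentially"
    using e by (auto simp: filterlim_at less_imp_neq[symmetric])
  ultimately show ?thesis by (rule filterlim_compose)
qed

lemma partial_deriv_bound_increment:
  fixes g :: "real^'n::finite \<Rightarrow> real"
  assumes "\<And>x. g differentiable (at x)" "\<And>x. \<bar>partial_deriv i g x\<bar> \<le> B" "0 < t"
  shows "\<bar>g (x + t *\<^sub>R axis i 1) - g x\<bar> \<le> B * t"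
proof -
  obtain z where "g (x + t *\<^sub>R axis i 1) - g (x + 0 *\<^sub>R axis i 1) = (t - 0) * partial_deriv i g (x + z *\<^sub>R axis i 1)"
    using MVT2[OF assms(3), of "\<lambda>s. g (x + s *\<^sub>R axis i 1)" "\<lambda>s. partial_deriv i g (x + s *\<^sub>R axis i 1)"] DERIV_along_axis[OF assms(1)] by blast
  then have "\<bar>g (x + t *\<^sub>R axis i 1) - g x\<bar> = \<bar>partial_deriv i g (x + z *\<^sub>R axis i 1)\<bar> * t"
    using assms(3) by (simp add: abs_mult mult.commute)
  also have "\<dots> \<le> B * t" using assms by (intro mult_right_mono) auto
  finally show ?thesis .
qed

lemma lip_diff_continuous: "lip_diff L f \<Longrightarrow> continuous_on UNIV f"
  by (intro continuous_at_imp_continuous_on ballI differentiable_imp_continuous_within lip_diff_differentiable)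

text \<open>Both properties pass from the difference quotients along an axis to their pointwise
  limit. Measurability has to be obtained in this way because \<open>lip_diff\<close> does not make
  the derivative continuous.\<close>

lemma lip_diff_partial_deriv:
  fixes f :: "real^'n::finite \<Rightarrow> real"
  assumes f: "lip_diff L f"
  shows "\<bar>partial_deriv i f x\<bar> \<le> L" and "partial_deriv i f \<in> borel_measurable borel"
proof -
  define e where "e k = 1 / real (Suc k)" for k
  have e: "0 < e k" "e \<longlonglongrightarrow> 0" for k
    unfolding e_def using LIMSEQ_Suc[OF lim_1_over_n] by auto
  have lim: "(\<lambda>k. (f (x + e k *\<^sub>R axis i 1) - f x) / e k) \<longlonglongrightarrow> partial_deriv i f x" for x
    by (rule difference_quotient_tendsto[OF lip_diff_differentiable[OF f] e])
  show "\<bar>partial_deriv i f x\<bar> \<le> L"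
  proof (rule LIMSEQ_le_const2[OF tendsto_rabs[OF lim]], intro exI allI impI)
    fix k
    have "\<bar>f (x + e k *\<^sub>R axis i 1) - f x\<bar> \<le> L * e k"
      using lip_diffD[OF f, of "x + e k *\<^sub>R axis i 1" x] e(1)[of k] by (simp add: dist_norm)
    then show "\<bar>(f (x + e k *\<^sub>R axis i 1) - f x) / e k\<bar> \<le> L"
      using e(1)[of k] by (simp add: abs_mult field_simps)
  qed
  have [measurable]: "f \<in> borel_measurable borel"
    using lip_diff_continuous[OF f] by (rule borel_measurable_continuous_onI)
  show "partial_deriv i f \<in> borel_measurable borel"
    by (rule borel_measurable_LIMSEQ_real[OF lim]) measurable
qed

lemma integrable_bounded_cball:
  fixes f :: "'a::euclidean_space \<Rightarrow> real"
  assumes "f \<in> borel_measurable borel" "\<And>x. x \<in> cball c r \<Longrightarrow> \<bar>f x\<bar> \<le> C" "\<And>x. x \<notin> cball c r \<Longrightarrow> f x = 0"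
  shows "integrable lborel f"
proof (rule Bochner_Integration.integrable_bound)
  show "integrable lborel (\<lambda>x. C * indicator (cball c r) x)"
    by (intro integrable_mult_right integrable_real_indicator) (use emeasure_lborel_cball_finite[of c r] in auto)
  show "AE x in lborel. norm (f x) \<le> norm (C * indicator (cball c r) x)"
  proof (rule AE_I2)
    fix x
    show "norm (f x) \<le> norm (C * indicator (cball c r) x)"
      using assms(2)[of x] assms(3)[of x] by (cases "x \<in> cball c r") auto
  qed
qed (use assms(1) in simp)

lemma test_functionD:
  fixes \<psi> :: "real^'n::finite \<Rightarrow> real"
  assumes "test_function U \<psi>"
  shows "\<psi> differentiable (at x)" "continuous_on UNIV \<psi>" "continuous_on UNIV (partial_deriv i \<psi>)"
    and "x \<notin> closure {x. \<psi> x \<noteq> 0} \<Longrightarrow> \<psi> x = 0" "x \<notin> closure {x. \<psi> x \<noteq> 0} \<Longrightarrow> partial_deriv i \<psi> x = 0"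
proof -
  have s: "iter_partial \<alpha> \<psi> differentiable (at x)" for \<alpha> x
    using assms unfolding test_function_def smooth_def by blast
  show d: "\<psi> differentiable (at x)" for x using s[of "[]"] by simp
  have "partial_deriv i \<psi> differentiable (at x)" for x using s[of "[i]"] by simp
  then show "continuous_on UNIV \<psi>" "continuous_on UNIV (partial_deriv i \<psi>)"
    using d by (simp_all add: continuous_at_imp_continuous_on differentiable_imp_continuous_within)
  show z: "\<psi> x = 0" if "x \<notin> closure {x. \<psi> x \<noteq> 0}" for x
    using that subsetD[OF closure_subset, of x "{x. \<psi> x \<noteq> 0}"] by auto
  show "partial_deriv i \<psi> x = 0" if x: "x \<notin> closure {x. \<psi> x \<noteq> 0}"
  proof -
    have "((\<lambda>x. 0) has_derivative (\<lambda>v. 0)) (at x)" by simp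
    moreover have "open (- closure {x. \<psi> x \<noteq> 0})" by (rule open_Compl[OF closed_closure])
    moreover have "x \<in> - closure {x. \<psi> x \<noteq> 0}" using x by simp
    moreover have "0 = \<psi> y" if "y \<in> - closure {x. \<psi> x \<noteq> 0}" for y 
      by (rule z[OF that[unfolded Compl_iff], symmetric])
    ultimately have "(\<psi> has_derivative (\<lambda>v. 0)) (at x)"
      by (rule has_derivative_transform_within_open)
    then show ?thesis by (rule partial_deriv_eq)
  qed
qed

text \<open>By translation invariance the difference quotients of \<open>f\<close> times \<psi>
  along an axis have integral 0, and dominated convergence carries this over to the derivative of
  the product. No iterated integrals occur.\<close>

lemma integral_by_parts_lip_diff:
  fixes f \<psi> :: "real^'n::finite \<Rightarrow> real"
  assumes f: "lip_diff L f" and \<psi>: "test_function U \<psi>"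
  shows "(LINT x|lborel. f x * partial_deriv i \<psi> x) = - (LINT x|lborel. partial_deriv i f x * \<psi> x)"
proof -
  note T = test_functionD[OF \<psi>]
  let ?K = "closure {x. \<psi> x \<noteq> 0}"
  have "bounded ?K" using \<psi> unfolding test_function_def by (intro compact_imp_bounded) blast
  then obtain R where R: "?K \<subseteq> cball 0 R"
    using bounded_subset_ballD[of ?K 0] ball_subset_cball subset_trans by metis
  have bnd: "\<exists>B\<ge>0. \<forall>x\<in>cball 0 r. \<bar>g x\<bar> \<le> B" if "continuous_on UNIV g" for r and g :: "real^'n \<Rightarrow> real"
  proof -
    have "compact (g ` cball 0 r)"
      by (rule compact_continuous_image[OF continuous_on_subset[OF that]]) auto
    then obtain B where "\<forall>y\<in>g ` cball 0 r. norm y \<le> B"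
      using compact_imp_bounded bounded_iff by blast
    then show ?thesis by (intro exI[of _ "max 0 B"]) (auto simp: le_max_iff_disj)
  qed
  have z: "\<psi> x = 0" "partial_deriv i \<psi> x = 0" if "x \<notin> cball 0 R" for x
    using T(4,5)[of x] that R by blast+
  obtain A where A: "0 \<le> A" "\<And>x. x \<in> cball 0 R \<Longrightarrow> \<bar>\<psi> x\<bar> \<le> A" using bnd[OF T(2)] by blast
  have A': "\<bar>\<psi> x\<bar> \<le> A" for x using A z[of x] by (cases "x \<in> cball 0 R") auto
  obtain B where B: "0 \<le> B" "\<And>x. x \<in> cball 0 R \<Longrightarrow> \<bar>partial_deriv i \<psi> x\<bar> \<le> B" using bnd[OF T(3)] by blast
  have B': "\<bar>partial_deriv i \<psi> x\<bar> \<le> B" for x using B z[of x] by (cases "x \<in> cball 0 R") auto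
  obtain M where M: "0 \<le> M" "\<And>x. x \<in> cball 0 (R + 1) \<Longrightarrow> \<bar>f x\<bar> \<le> M" using bnd[OF lip_diff_continuous[OF f]] by blast
  have L: "0 \<le> L" using lip_diff_partial_deriv(1)[OF f, of i 0] by linarith
  note [measurable] = borel_measurable_continuous_onI[OF T(2)] borel_measurable_continuous_onI[OF T(3)]
    borel_measurable_continuous_onI[OF lip_diff_continuous[OF f]] lip_diff_partial_deriv(2)[OF f]
  have MR: "\<bar>f x\<bar> \<le> M" if "x \<in> cball 0 R" for x using M(2)[of x] that by simp
  have i1: "integrable lborel (\<lambda>x. f x * partial_deriv i \<psi> x)"
    by (rule integrable_bounded_cball[of _ 0 R "M * B"]) (use MR B z M in \<open>auto simp: abs_mult intro!: mult_mono\<close>)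
  have i2: "integrable lborel (\<lambda>x. partial_deriv i f x * \<psi> x)"
    by (rule integrable_bounded_cball[of _ 0 R "L * A"]) (use lip_diff_partial_deriv(1)[OF f] A z L in \<open>auto simp: abs_mult intro!: mult_mono\<close>)
  define H where "H x = f x * \<psi> x" for x
  have [measurable]: "H \<in> borel_measurable borel" unfolding H_def by measurable
  have iH: "integrable lborel H"
    unfolding H_def by (rule integrable_bounded_cball[of _ 0 R "M * A"]) (use MR A z M in \<open>auto simp: abs_mult intro!: mult_mono\<close>)
  define e where "e k = 1 / real (Suc k)" for k
  have e: "0 < e k" "e k \<le> 1" "e \<longlonglongrightarrow> 0" for k
    unfolding e_def using LIMSEQ_Suc[OF lim_1_over_n] by auto
  define Q where "Q k x = (H (x + e k *\<^sub>R axis i 1) - H x) / e k" for k x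
  have Q0: "(LINT x|lborel. Q k x) = 0" for k
  proof -
    have "(LINT x|lborel. H (x + e k *\<^sub>R axis i 1) - H x) = (LINT x|lborel. H (x + e k *\<^sub>R axis i 1)) - (LINT x|lborel. H x)"
      by (intro Bochner_Integration.integral_diff integrable_translate iH)
    also have "(LINT x|lborel. H (x + e k *\<^sub>R axis i 1)) = (LINT x|lborel. H x)"
      by (rule integral_translate) measurable
    finally show ?thesis unfolding Q_def by simp
  qed
  have H': "partial_deriv i H x = partial_deriv i f x * \<psi> x + f x * partial_deriv i \<psi> x" and Hd: "H differentiable (at x)" for x
  proof -
    obtain f' p' where fp: "(f has_derivative f') (at x)" "(\<psi> has_derivative p') (at x)"
      using lip_diff_differentiable[OF f] T(1) unfolding differentiable_def by metis
    have d: "(H has_derivative (\<lambda>v. f x * p' v + f' v * \<psi> x)) (at x)"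
      unfolding H_def[abs_def] by (rule has_derivative_mult[OF fp])
    then show "H differentiable (at x)" unfolding differentiable_def by blast
    show "partial_deriv i H x = partial_deriv i f x * \<psi> x + f x * partial_deriv i \<psi> x"
      unfolding partial_deriv_eq[OF d] partial_deriv_eq[OF fp(1)] partial_deriv_eq[OF fp(2)] by simp
  qed
  have "(\<lambda>k. LINT x|lborel. Q k x) \<longlonglongrightarrow> (LINT x|lborel. partial_deriv i f x * \<psi> x + f x * partial_deriv i \<psi> x)"
  proof (rule integral_dominated_convergence)
    \<comment> \<open>Shifts by at most 1 enlarge the support radius \<open>R\<close> to
      \<open>R + 1\<close>, which is why \<open>f\<close> was bounded on the larger ball.\<close>
    show "integrable lborel (\<lambda>x. (L * A + M * B) * indicator (cball (0::real^'n) (R + 1)) x)"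
      by (intro integrable_mult_right integrable_real_indicator) (use emeasure_lborel_cball_finite[of 0 "R + 1"] in auto)
    show "AE x in lborel. (\<lambda>k. Q k x) \<longlonglongrightarrow> partial_deriv i f x * \<psi> x + f x * partial_deriv i \<psi> x"
      unfolding Q_def H'[symmetric] by (intro AE_I2 difference_quotient_tendsto Hd e)
    show "AE x in lborel. norm (Q k x) \<le> (L * A + M * B) * indicator (cball 0 (R + 1)) x" for k
    proof (rule AE_I2)
      fix x :: "real^'n"
      let ?y = "x + e k *\<^sub>R axis i 1"
      have d: "dist ?y x = e k" using e(1)[of k] by (simp add: dist_norm)
      show "norm (Q k x) \<le> (L * A + M * B) * indicator (cball 0 (R + 1)) x"
      proof (cases "x \<in> cball 0 (R + 1)")
        case True
        have "H ?y - H x = (f ?y - f x) * \<psi> ?y + f x * (\<psi> ?y - \<psi> x)" by (simp add: H_def algebra_simps)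
        also have "\<bar>\<dots>\<bar> \<le> \<bar>f ?y - f x\<bar> * \<bar>\<psi> ?y\<bar> + \<bar>f x\<bar> * \<bar>\<psi> ?y - \<psi> x\<bar>"
          by (rule order_trans[OF abs_triangle_ineq]) (simp add: abs_mult)
        also have "\<dots> \<le> (L * e k) * A + M * (B * e k)"
          using lip_diffD[OF f, of ?y x] L M e(1)[of k] True unfolding d
          by (intro add_mono mult_mono A' partial_deriv_bound_increment T(1) B' lip_diff_differentiable[OF f] lip_diff_partial_deriv(1)[OF f]) auto
        finally have "\<bar>H ?y - H x\<bar> \<le> (L * A + M * B) * e k" by (simp add: algebra_simps)
        then show ?thesis using True e(1)[of k] by (simp add: Q_def field_simps)
      next
        case False
        then have "x \<notin> cball 0 R" by simp
        moreover have "?y \<notin> cball 0 R"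
          using False dist_triangle[of 0 x ?y] d e(2)[of k] by (auto simp: dist_commute)
        ultimately show ?thesis using False by (simp add: Q_def H_def z)
      qed
    qed
    show "Q k \<in> borel_measurable lborel" for k unfolding Q_def by measurable
  qed measurable
  then have "(LINT x|lborel. partial_deriv i f x * \<psi> x + f x * partial_deriv i \<psi> x) = 0"
    unfolding Q0 by (simp add: LIMSEQ_const_iff)
  then show ?thesis unfolding Bochner_Integration.integral_add[OF i2 i1] by simp
qed

lemma integral_test_function_domain:
  fixes g \<psi> :: "real^'n::finite \<Rightarrow> real"
  assumes "\<And>x. x \<notin> U \<Longrightarrow> \<psi> x = 0"
  shows "(LINT x:U|lborel. g x * \<psi> x) = (LINT x|lborel. g x * \<psi> x)"
  unfolding set_lebesgue_integral_def
  by (rule Bochner_Integration.integral_cong) (use assms in \<open>auto simp: indicator_def\<close>)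

lemma weak_partial_lip_diff:
  fixes f :: "real^'n::finite \<Rightarrow> real"
  assumes f: "lip_diff L f"
  shows "weak_partial U [] f f" "weak_partial U [i] f (partial_deriv i f)"
proof -
  have sf: "set_integrable lborel K f" if "compact K" for K
    unfolding set_integrable_def
    by (rule borel_integrable_compact[OF that continuous_on_subset[OF lip_diff_continuous[OF f]]]) simp
  have sp: "set_integrable lborel K (partial_deriv i f)" if K: "compact K" for K
  proof -
    obtain R where R: "K \<subseteq> cball 0 R" 
      using bounded_subset_ballD[OF compact_imp_bounded[OF K], of 0] ball_subset_cball subset_trans by metis
    have "K \<in> sets borel" using K by (simp add: compact_imp_closed)
    then have m: "(\<lambda>x. indicator K x *\<^sub>R partial_deriv i f x) \<in> borel_measurable borel"
      using lip_diff_partial_deriv(2)[OF f, of i] by measurable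
    show ?thesis
      unfolding set_integrable_def
      by (rule integrable_bounded_cball[OF m, of 0 R L])
         (use R lip_diff_partial_deriv(1)[OF f, of i] order_trans[OF abs_ge_zero lip_diff_partial_deriv(1)[OF f]] in \<open>auto simp: indicator_def\<close>)
  qed
  show "weak_partial U [] f f"
    unfolding weak_partial_def by (auto intro: sf)
  show "weak_partial U [i] f (partial_deriv i f)"
    unfolding weak_partial_def
  proof (intro conjI allI impI)
    fix \<psi> :: "real^'n \<Rightarrow> real" assume \<psi>: "test_function U \<psi>"
    have z: "\<psi> x = 0" "partial_deriv i \<psi> x = 0" if "x \<notin> U" for x
    proof -
      have "x \<notin> closure {x. \<psi> x \<noteq> 0}" using \<psi> that unfolding test_function_def by blast
      then show "\<psi> x = 0" "partial_deriv i \<psi> x = 0" using test_functionD(4,5)[OF \<psi>] by blast+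
    qed
    have "(LINT x:U|lborel. f x * partial_deriv i \<psi> x) = - (LINT x:U|lborel. partial_deriv i f x * \<psi> x)"
      using integral_test_function_domain[of U \<psi> "partial_deriv i f"] integral_test_function_domain[of U "partial_deriv i \<psi>" f]
        integral_by_parts_lip_diff[OF f \<psi>, of i] z by simp
    then show "(LINT x:U|lborel. f x * iter_partial [i] \<psi> x) = (- 1) ^ length [i] * (LINT x:U|lborel. partial_deriv i f x * \<psi> x)"
      by simp
  qed (auto intro: sf sp)
qed

section \<open>The covering\<close>

text \<open>Half the separation is \<open>e * h / 16\<close> and the enlarged ball has radius at
  most \<open>h\<close>, so the quotient of the radii is at most \<open>16 / e\<close>, uniformly in
  \<open>h\<close>.\<close>

lemma separated_points_finite_overlap:
  fixes Y :: "'a::euclidean_space set"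
  assumes Y: "finite Y" "separated (e * h / 8) Y" and e: "0 < e" "e \<le> 1" and h: "0 < h"
  shows "card (Y \<inter> ball x (h / 2)) \<le> nat \<lceil>(16 / e) ^ DIM('a)\<rceil>"
proof -
  let ?b = "e * h / 8"
  have b: "0 < ?b" "?b \<le> h" using e h by (auto intro: mult_left_le_one_le order_trans[of _ "e * h"])
  have "real (card (Y \<inter> ball x (h / 2))) * (?b / 2) ^ DIM('a) \<le> (h / 2 + ?b / 2) ^ DIM('a)"
    by (rule separated_card_le[of _ _ x]) (use Y b h in \<open>auto simp: separated_def\<close>)
  also have "\<dots> \<le> h ^ DIM('a)"
  proof (rule power_mono)
    show "h / 2 + ?b / 2 \<le> h" using b by linarith
  qed (use b h in simp)
  finally have "real (card (Y \<inter> ball x (h / 2))) \<le> h ^ DIM('a) / (?b / 2) ^ DIM('a)"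
    using b by (simp add: pos_le_divide_eq)
  also have "\<dots> = (h / (?b / 2)) ^ DIM('a)" by (simp only: power_divide)
  also have "h / (?b / 2) = 16 / e" using e h by (simp add: field_simps)
  finally show ?thesis by linarith
qed

theorem theorem5p6:
  fixes \<Omega> :: "(real^'n::finite) set"
  assumes "open \<Omega>" and "bounded \<Omega>" and "piecewise_C1_boundary \<Omega>"
  shows "\<exists>(A::real) (B::real) (\<sigma>::real) (C :: nat \<Rightarrow> real) (\<kappa>::nat) (m::nat).
    A > 0 \<and> B > 0 \<and> \<sigma> > 0 \<and> m \<ge> 1 \<and>
    (\<exists>h\<^sub>0>0. \<forall>h. 0 < h \<and> h < h\<^sub>0 \<longrightarrow>
      (\<exists>(J :: nat set) (\<omega> :: nat \<Rightarrow> (real^'n) set) (\<omega>s :: nat \<Rightarrow> (real^'n) set)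
         (\<phi> :: nat \<Rightarrow> real^'n \<Rightarrow> real) (\<Psi> :: nat \<Rightarrow> (real^'n \<Rightarrow> complex) set).
        covering_with_balls \<Omega> J \<omega> \<omega>s \<and>
        lipschitz_partition_of_unity \<Omega> J \<omega> \<phi> \<and>
        (\<forall>j\<in>J. \<Psi> j = restrict_to (\<omega> j) ` polys m) \<and>
        local_spaces m J \<omega> \<Psi> \<and>
        assumption_A \<sigma> h \<Omega> J \<omega> \<omega>s \<phi> \<and>
        assumption_B \<kappa> m C \<Omega> J \<omega> \<omega>s \<phi> \<and>
        assumption_C m A J \<omega> \<omega>s \<Psi> \<and>
        assumption_D m B J \<omega> \<Psi>))"
proof -
  let ?n = "CARD('n)"
  obtain e where e: "e > 0" "e \<le> 1" and cork: "\<And>y t. y \<in> \<Omega> \<Longrightarrow> 0 < t \<Longrightarrow> t < e \<Longrightarrow> \<exists>z. dist z y \<le> t \<and> ball z (e * t) \<subseteq> \<Omega>"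
    using corkscrew[OF assms] by blast
  \<comment> \<open>\<open>e / 32 * h\<close> will be the radius \<open>b / 4\<close> of the inner
    balls.\<close>
  have e32: "0 < e / 32" "e / 32 \<le> 1" using e by auto
  obtain K where K0: "K > 0" and K: "\<And>h c s t p (U :: (real^'n) set) U' \<omega>. p \<in> polys 1 \<Longrightarrow> 0 < h \<Longrightarrow> h \<le> 1 \<Longrightarrow> 0 \<le> s \<Longrightarrow> s \<le> t \<Longrightarrow> t \<le> 1 \<Longrightarrow>
    ball c (e / 32 * h) \<subseteq> U \<Longrightarrow> U \<subseteq> \<omega> \<Longrightarrow> U' \<subseteq> \<omega> \<Longrightarrow> \<omega> \<subseteq> ball c h \<Longrightarrow>
    sobolev_norm_on t U' (restrict_to \<omega> p) \<le> K * h powr (s - t) * sobolev_norm_on s U (restrict_to \<omega> p)"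
    using sobolev_norm_on_affine_le[OF e32, where 'n='n] by metis
  define c :: real where "c = 25 / 81"
    \<comment> \<open>\<open>(1 - (2/3)\<^sup>2)\<^sup>2\<close>, the value of the bump function of radius \<open>3 h / 8\<close> at distance \<open>h / 4\<close>\<close>
  define \<kappa> where "\<kappa> = nat \<lceil>(16 / e) ^ ?n\<rceil>"
  \<comment> \<open>The first factor is produced by \<open>pu_function\<close>;
    \<open>2048 / (9 * e)\<close> is \<open>h\<close> times the common Lipschitz constant
    \<open>L\<close> of plateaus and bumps.\<close>
  define C1 where "C1 = (1 + (2 * real \<kappa> * (4 / c\<^sup>2) + (4 / c\<^sup>2 + 6 * real \<kappa> * (16 / c ^ 4)))) * (2048 / (9 * e))"
  define C :: "nat \<Rightarrow> real" where "C k = (if k = 0 then 1 else C1)" for k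
  have main: "\<exists>(J :: nat set) (\<omega> :: nat \<Rightarrow> (real^'n) set) (\<omega>s :: nat \<Rightarrow> (real^'n) set)
         (\<phi> :: nat \<Rightarrow> real^'n \<Rightarrow> real) (\<Psi> :: nat \<Rightarrow> (real^'n \<Rightarrow> complex) set).
        covering_with_balls \<Omega> J \<omega> \<omega>s \<and>
        lipschitz_partition_of_unity \<Omega> J \<omega> \<phi> \<and>
        (\<forall>j\<in>J. \<Psi> j = restrict_to (\<omega> j) ` polys 1) \<and>
        local_spaces 1 J \<omega> \<Psi> \<and>
        assumption_A (e / 16) h \<Omega> J \<omega> \<omega>s \<phi> \<and>
        assumption_B \<kappa> 1 C \<Omega> J \<omega> \<omega>s \<phi> \<and>
        assumption_C 1 K J \<omega> \<omega>s \<Psi> \<and>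
        assumption_D 1 K J \<omega> \<Psi>" if h: "0 < h" "h < e" for h
  proof -
    have h1: "h \<le> 1" using h e by simp
    \<comment> \<open>The radius of the interior balls that \<open>cork\<close> yields for
      \<open>t = h / 8\<close>.\<close>
    define b where "b = e * h / 8"
    have b: "0 < b" "b \<le> h / 8"
      using e h mult_right_mono[of e 1 h] by (auto simp: b_def)
    define Z where "Z = {z. ball z b \<subseteq> \<Omega>}"
    have "Z \<subseteq> \<Omega>" using b centre_in_ball unfolding Z_def by blast
    then have "bounded Z" using assms(2) bounded_subset by blast
    then obtain Y where YZ: "Y \<subseteq> Z" and fin: "finite Y" and sep: "separated b Y" and near: "\<And>z. z \<in> Z \<Longrightarrow> \<exists>y\<in>Y. dist z y < b"
      using maximal_separated_subset[OF _ b(1)] by metis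
    have close: "\<exists>y\<in>Y. dist x y \<le> h / 4" if x: "x \<in> \<Omega>" for x
    proof -
      obtain z where z: "dist z x \<le> h / 8" "ball z (e * (h / 8)) \<subseteq> \<Omega>"
        using cork[OF x, of "h / 8"] h by auto
      then have "z \<in> Z" by (simp add: Z_def b_def)
      then obtain y where "y \<in> Y" "dist z y < b" using near by blast
      then show ?thesis using z(1) b dist_triangle[of x y z] by (intro bexI[of _ y]) (auto simp: dist_commute)
    qed

    \<comment> \<open>Overlap and partition of unity\<close>
    have over: "card (Y \<inter> ball x (h / 2)) \<le> \<kappa>" for x
      using separated_points_finite_overlap[OF fin sep[unfolded b_def] e h(1), of x] by (simp add: \<kappa>_def)
    \<comment> \<open>The plateau is 1 on the inner ball of radius \<open>b / 4\<close>, and its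
      radius \<open>b / 2\<close> separates the plateaus at \<open>b\<close>-separated centres. The
      bump radius \<open>3 * h / 8\<close> lies strictly between \<open>h / 4\<close>, within which
      every point of \<Omega> has a centre, and the radius \<open>h / 2\<close> of the covering
      sets.\<close>
    let ?\<psi> = "plateau (b / 2) :: real^'n \<Rightarrow> real^'n \<Rightarrow> real" and ?\<theta> = "bump (3 * h / 8) :: real^'n \<Rightarrow> real^'n \<Rightarrow> real"
    define L where "L = 2048 / (9 * e) / h"
    have L0: "0 \<le> L" using e h by (simp add: L_def)
    have b2: "0 < b / 2" and h38: "0 < 3 * h / 8" using b h by auto
    have l\<psi>: "lip_diff L (?\<psi> y)" for y
    proof -
      have "128 / (9 * (b / 2)) = L" using e h by (simp add: L_def b_def field_simps)
      then show ?thesis using lip_diff_plateau[OF b2, of y] by simp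
    qed
    have l\<theta>: "lip_diff L (?\<theta> y)" for y
    proof (rule lip_diff_mono[OF lip_diff_bump[OF h38]])
      have "4 / (3 * h / 8) = (32 / 3) / h" by simp
      also have "\<dots> \<le> (2048 / (9 * e)) / h"
      proof (rule divide_right_mono)
        show "32 / 3 \<le> 2048 / (9 * e)" using e by (simp add: field_simps)
      qed (use h in simp)
      finally show "4 / (3 * h / 8) \<le> L" by (simp add: L_def)
    qed
    have s\<psi>: "dist x y < b / 2" if "?\<psi> y x \<noteq> 0" for x y
      using that plateau_eq_0[OF b2, of x y] by (cases "b / 2 \<le> dist x y") auto
    have s\<theta>: "dist x y < 3 * h / 8" if "?\<theta> y x \<noteq> 0" for x y
      using that bump_eq_0[OF h38, of x y] by (cases "3 * h / 8 \<le> dist x y") auto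
    have c\<psi>: "card {y\<in>Y. ?\<psi> y x \<noteq> 0} \<le> \<kappa>" for x
    proof (rule order_trans[OF card_mono over])
      show "{y\<in>Y. ?\<psi> y x \<noteq> 0} \<subseteq> Y \<inter> ball x (h / 2)"
      proof safe
        fix y assume "?\<psi> y x \<noteq> 0"
        from s\<psi>[OF this] show "y \<in> ball x (h / 2)" using b h by simp
      qed
    qed (use fin in simp)
    have c\<theta>: "card {y\<in>Y. ?\<theta> y x \<noteq> 0} \<le> \<kappa>" for x
    proof (rule order_trans[OF card_mono over])
      show "{y\<in>Y. ?\<theta> y x \<noteq> 0} \<subseteq> Y \<inter> ball x (h / 2)"
      proof safe
        fix y assume "?\<theta> y x \<noteq> 0"
        from s\<theta>[OF this] show "y \<in> ball x (h / 2)" using h by simp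
      qed
    qed (use fin in simp)
    have disj: "\<forall>y\<in>Y. \<forall>y'\<in>Y. \<forall>x. ?\<psi> y x \<noteq> 0 \<longrightarrow> ?\<psi> y' x \<noteq> 0 \<longrightarrow> y = y'"
    proof (intro ballI allI impI, rule ccontr)
      fix y y' x assume y: "y \<in> Y" "y' \<in> Y" and x: "?\<psi> y x \<noteq> 0" "?\<psi> y' x \<noteq> 0" and "y \<noteq> y'"
      then have "b \<le> dist y y'" using sep unfolding separated_def by blast
      then show False using s\<psi>[OF x(1)] s\<psi>[OF x(2)] dist_triangle[of y y' x] by (simp add: dist_commute)
    qed
    have c01: "0 < c" "c \<le> 1" by (auto simp: c_def)
    note pu = pu_function[of Y L c ?\<psi> ?\<theta> \<kappa>, OF fin L0 c01 l\<psi> plateau_range l\<theta> bump_range c\<psi> c\<theta> disj]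
    let ?p = "pu_function Y c ?\<psi> ?\<theta>"
    have sum\<theta>: "c \<le> (\<Sum>y\<in>Y. ?\<theta> y x)" if x: "x \<in> \<Omega>" for x
    proof -
      obtain y where y: "y \<in> Y" "dist x y \<le> h / 4" using close[OF x] by blast
      have "(1 - (2 / 3)\<^sup>2)\<^sup>2 \<le> ?\<theta> y x" by (rule bump_ge[OF h38]) (use y in \<open>auto simp: power2_eq_square\<close>)
      then have "c \<le> ?\<theta> y x" by (simp add: c_def power2_eq_square)
      also have "\<dots> \<le> (\<Sum>y\<in>Y. ?\<theta> y x)" by (rule member_le_sum[OF y(1)]) (auto simp: bump_range fin)
      finally show ?thesis .
    qed
    have psupp: "dist x y < 3 * h / 8" if "y \<in> Y" "?p y x \<noteq> 0" for x y
      using pu(2)[OF that] s\<psi>[of y x] s\<theta>[of y x] b h by auto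
    obtain f where f: "bij_betw f {0..<card Y} Y" using ex_bij_betw_nat_finite[OF fin] by blast
    define J where "J = {0..<card Y}"
    have fJ: "bij_betw f J Y" using f by (simp add: J_def)
    have fY: "f j \<in> Y" if "j \<in> J" for j using bij_betwE[OF fJ] that by blast
    have fs: "f ` J = Y" and inj: "inj_on f J" using fJ by (auto simp: bij_betw_def)
    define \<omega> where "\<omega> j = ball (f j) (h / 2)" for j
    define \<omega>s where "\<omega>s j = ball (f j) (b / 4)" for j
    define \<phi> where "\<phi> j = ?p (f j)" for j
    define \<Psi> where "\<Psi> j = restrict_to (\<omega> j) ` (polys 1 :: (real^'n \<Rightarrow> complex) set)" for j
    have b4: "b / 4 < h / 2" using b h by simp
    have sub: "\<omega>s j \<subseteq> \<omega> j" "closure (\<omega>s j) \<subseteq> \<omega> j" for j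
      unfolding \<omega>_def \<omega>s_def using b4 b by (auto intro: subset_ball)
    have diam: "diameter (\<omega> j) = h" for j unfolding \<omega>_def using h by simp
    have C1: "C1 / h = (1 + (2 * real \<kappa> * (4 / c\<^sup>2) + (4 / c\<^sup>2 + 6 * real \<kappa> * (16 / c ^ 4)))) * L"
      by (simp add: C1_def L_def)
    have l\<phi>: "lip_diff (C1 / h) (\<phi> j)" if "j \<in> J" for j
      unfolding C1 \<phi>_def by (rule pu(5)[OF fY[OF that]])
    have sum1: "(\<Sum>y\<in>Y. ?p y x) = 1" if "x \<in> \<Omega>" for x
    \<comment> \<open>The facts \<open>pu\<close> refer to a member of \<open>Y\<close>. If there is
      none, \<Omega> has no points either, because each of them is close to a centre.\<close>
    proof (cases "Y = {}")
      case True
      then show ?thesis using close[OF that] by simp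
    next
      case False
      then obtain y where "y \<in> Y" by blast
      from pu(4)[OF this sum\<theta>[OF that]] show ?thesis .
    qed

    \<comment> \<open>Verification of the covering properties and the four assumptions\<close>
    have cov: "covering_with_balls \<Omega> J \<omega> \<omega>s"
      unfolding covering_with_balls_def
    proof (intro conjI ballI)
      show "\<Omega> \<subseteq> (\<Union>j\<in>J. \<omega> j)"
      proof
        fix x assume "x \<in> \<Omega>"
        then obtain y where "y \<in> Y" "dist x y \<le> h / 4" using close by blast
        moreover then obtain j where "j \<in> J" "f j = y" using fs by blast
        ultimately show "x \<in> (\<Union>j\<in>J. \<omega> j)" using h by (intro UN_I[of j]) (auto simp: \<omega>_def dist_commute)
      qed
      show "\<exists>c r. 0 < r \<and> \<omega>s j = ball c r" for j
        unfolding \<omega>s_def using b by (intro exI[of _ "f j"] exI[of _ "b / 4"]) simp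
    qed (use sub in \<open>auto simp: \<omega>_def\<close>)
    have part: "lipschitz_partition_of_unity \<Omega> J \<omega> \<phi>"
      unfolding lipschitz_partition_of_unity_def
    proof (intro conjI ballI allI)
      fix j assume j: "j \<in> J"
      have "0 \<le> C1 / h" using e h c01 by (auto simp: C1_def intro!: mult_nonneg_nonneg add_nonneg_nonneg divide_nonneg_nonneg)
      then show "\<exists>L. L-lipschitz_on UNIV (\<phi> j)"
        using lip_diffD[OF l\<phi>[OF j]] by (intro exI[of _ "C1 / h"] lipschitz_onI) (auto simp: dist_real_def)
      show "0 \<le> \<phi> j x" for x unfolding \<phi>_def by (rule pu(1)[OF fY[OF j]])
      have "{x. \<phi> j x \<noteq> 0} \<subseteq> cball (f j) (3 * h / 8)"
      proof
        fix x assume "x \<in> {x. \<phi> j x \<noteq> 0}"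
        then have "?p (f j) x \<noteq> 0" by (simp add: \<phi>_def)
        from psupp[OF fY[OF j] this] show "x \<in> cball (f j) (3 * h / 8)" by (simp add: dist_commute)
      qed
      then have "closure {x. \<phi> j x \<noteq> 0} \<subseteq> cball (f j) (3 * h / 8)" by (rule closure_minimal) simp
      also have "\<dots> \<subseteq> \<omega> j" unfolding \<omega>_def using h by auto
      finally show "closure {x. \<phi> j x \<noteq> 0} \<subseteq> \<omega> j" .
    next
      fix x assume x: "x \<in> \<Omega>"
      \<comment> \<open>\<open>J\<close> is finite, so \<open>supp_sum\<close> is the ordinary
        sum.\<close>
      have "supp_sum (\<lambda>j. \<phi> j x) J = (\<Sum>j\<in>J. \<phi> j x)"
        unfolding supp_sum_def by (rule sum.mono_neutral_left) (auto simp: J_def support_on_def)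
      also have "\<dots> = (\<Sum>y\<in>Y. ?p y x)" unfolding \<phi>_def by (rule sum.reindex_bij_betw[OF fJ])
      finally show "supp_sum (\<lambda>j. \<phi> j x) J = 1" using sum1[OF x] by simp
    qed
    have loc: "local_spaces 1 J \<omega> \<Psi>"
      unfolding local_spaces_def
    proof (intro ballI conjI subsetI)
      fix j show "linear_subspace (\<Psi> j)" unfolding \<Psi>_def by (rule linear_subspace_restrict_polys)
      fix w assume "w \<in> \<Psi> j"
      then obtain p where "p \<in> polys 1" "w = restrict_to (\<omega> j) p" unfolding \<Psi>_def by blast
      then show "w \<in> sobolev_on (real 1) (\<omega> j)"
        using restrict_polys_1_sobolev_on[of p "\<omega> j" "f j" h 1] subset_ball[of "h / 2" h "f j"] h h1 unfolding \<omega>_def by auto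
    qed
    have asA: "assumption_A (e / 16) h \<Omega> J \<omega> \<omega>s \<phi>"
      unfolding assumption_A_def
    proof (intro conjI ballI h1 sub impI)
      fix j assume j: "j \<in> J"
      show "diameter (\<omega> j) \<le> h" by (simp add: diam)
      show "e / 16 * h \<le> diameter (\<omega>s j)" unfolding \<omega>s_def using b by (simp add: b_def)
      have "ball (f j) b \<subseteq> \<Omega>" using fY[OF j] YZ unfolding Z_def by blast
      moreover have "\<omega>s j \<subseteq> ball (f j) b" unfolding \<omega>s_def using b by (intro subset_ball) simp
      ultimately show "\<omega>s j \<subseteq> \<Omega>" by blast
    qed (auto simp: \<omega>_def)
    have asB: "assumption_B \<kappa> 1 C \<Omega> J \<omega> \<omega>s \<phi>"
      unfolding assumption_B_def
    proof (intro conjI allI impI ballI)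
      fix I assume I: "I \<subseteq> J \<and> card I = \<kappa> + 1"
      show "(\<Inter>j\<in>I. \<omega> j) = {}"
      proof (rule ccontr)
        assume "(\<Inter>j\<in>I. \<omega> j) \<noteq> {}"
        then obtain x where x: "\<And>j. j \<in> I \<Longrightarrow> x \<in> \<omega> j" by blast
        have "f ` I \<subseteq> Y \<inter> ball x (h / 2)"
        proof (intro subsetI)
          fix y assume "y \<in> f ` I"
          then obtain j where j: "j \<in> I" "y = f j" by blast
          then have "x \<in> ball (f j) (h / 2)" "f j \<in> Y" using x[of j] I fY[of j] unfolding \<omega>_def by blast+
          then show "y \<in> Y \<inter> ball x (h / 2)" using j by (simp add: dist_commute)
        qed
        then have "card (f ` I) \<le> card (Y \<inter> ball x (h / 2))" by (rule card_mono[rotated]) (simp add: fin)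
        then have "card (f ` I) \<le> \<kappa>" using over[of x] by linarith
        moreover have "card (f ` I) = card I" by (rule card_image[OF inj_on_subset[OF inj]]) (use I in blast)
        ultimately show False using I by simp
      qed
    next
      fix j and \<alpha> :: "'n list" assume j: "j \<in> J" and \<alpha>: "length \<alpha> \<le> 1"
      show "\<exists>g. weak_partial \<Omega> \<alpha> (\<phi> j) g \<and> (AE x in lborel. x \<in> \<Omega> \<longrightarrow> \<bar>g x\<bar> \<le> C (length \<alpha>) / diameter (\<omega> j) ^ length \<alpha>)"
      proof (cases \<alpha>)
        case Nil
        \<comment> \<open>Nonnegative functions with sum 1 on \<Omega> are at most 1 there; this is
          the value of \<open>C 0\<close>.\<close>
        have "\<bar>\<phi> j x\<bar> \<le> 1" if "x \<in> \<Omega>" for x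
        proof -
          have "?p (f j) x \<le> (\<Sum>y\<in>Y. ?p y x)" by (rule member_le_sum[OF fY[OF j]]) (auto simp: pu(1) fin)
          then show ?thesis using sum1[OF that] pu(1)[OF fY[OF j], of x] by (simp add: \<phi>_def)
        qed
        then show ?thesis using weak_partial_lip_diff(1)[OF l\<phi>[OF j]] unfolding Nil by (intro exI[of _ "\<phi> j"]) (auto simp: C_def)
      next
        case (Cons i \<beta>)
        then have \<beta>: "\<alpha> = [i]" using \<alpha> by simp
        show ?thesis
          using weak_partial_lip_diff(2)[OF l\<phi>[OF j]] lip_diff_partial_deriv(1)[OF l\<phi>[OF j], of i]
          unfolding \<beta> by (intro exI[of _ "partial_deriv i (\<phi> j)"]) (auto simp: C_def diam)
      qed
    next
      fix j x assume j: "j \<in> J" and x: "x \<in> \<omega>s j"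
      have "?\<psi> (f j) x = 1" by (rule plateau_eq_1[OF b2]) (use x in \<open>simp add: \<omega>s_def dist_commute\<close>)
      then show "\<phi> j x = 1" unfolding \<phi>_def by (rule pu(3)[OF fY[OF j]])
    qed
    have asC: "assumption_C 1 K J \<omega> \<omega>s \<Psi>"
      unfolding assumption_C_def
    proof (intro conjI ballI allI impI)
      fix j w l assume "w \<in> \<Psi> j" and l: "0 \<le> l \<and> l \<le> real 1"
      then obtain p where p: "p \<in> polys 1" and w: "w = restrict_to (\<omega> j) p" unfolding \<Psi>_def by blast
      \<comment> \<open>With equal orders the power of \<open>h\<close> is 1.\<close>
      have "sobolev_norm_on l (\<omega> j) (restrict_to (\<omega> j) p) \<le> K * h powr (l - l) * sobolev_norm_on l (\<omega>s j) (restrict_to (\<omega> j) p)"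
      proof (rule K[OF p h(1) h1, where c = "f j"])
        show "ball (f j) (e / 32 * h) \<subseteq> \<omega>s j" by (simp add: \<omega>s_def b_def)
        show "\<omega> j \<subseteq> ball (f j) h" unfolding \<omega>_def using h by (intro subset_ball) simp
      qed (use l sub in auto)
      then show "sobolev_norm_on l (\<omega> j) w \<le> K * sobolev_norm_on l (\<omega>s j) w" using h by (simp add: w)
    qed (auto simp: \<Psi>_def)
    have asD: "assumption_D 1 K J \<omega> \<Psi>"
      unfolding assumption_D_def
    proof (intro ballI allI impI)
      fix j w s t assume "w \<in> \<Psi> j" and st: "0 \<le> s \<and> s \<le> t \<and> t \<le> real 1"
      then obtain p where p: "p \<in> polys 1" and w: "w = restrict_to (\<omega> j) p" unfolding \<Psi>_def by blast
      have "sobolev_norm_on t (\<omega> j) (restrict_to (\<omega> j) p) \<le> K * h powr (s - t) * sobolev_norm_on s (\<omega> j) (restrict_to (\<omega> j) p)"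
      proof (rule K[OF p h(1) h1, where c = "f j"])
        show "ball (f j) (e / 32 * h) \<subseteq> \<omega> j"
          unfolding \<omega>_def using b4 by (intro subset_ball) (simp add: b_def)
        show "\<omega> j \<subseteq> ball (f j) h" unfolding \<omega>_def using h by (intro subset_ball) simp
      qed (use st in auto)
      then show "sobolev_norm_on t (\<omega> j) w \<le> K * diameter (\<omega> j) powr (s - t) * sobolev_norm_on s (\<omega> j) w"
        by (simp add: w diam)
    qed
    have "\<forall>j\<in>J. \<Psi> j = restrict_to (\<omega> j) ` polys 1" by (simp add: \<Psi>_def)
    then show ?thesis using cov part loc asA asB asC asD by (intro exI conjI)
  qed
  have "\<exists>h\<^sub>0>0. \<forall>h. 0 < h \<and> h < h\<^sub>0 \<longrightarrow>
      (\<exists>(J :: nat set) (\<omega> :: nat \<Rightarrow> (real^'n) set) (\<omega>s :: nat \<Rightarrow> (real^'n) set)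
         (\<phi> :: nat \<Rightarrow> real^'n \<Rightarrow> real) (\<Psi> :: nat \<Rightarrow> (real^'n \<Rightarrow> complex) set).
        covering_with_balls \<Omega> J \<omega> \<omega>s \<and>
        lipschitz_partition_of_unity \<Omega> J \<omega> \<phi> \<and>
        (\<forall>j\<in>J. \<Psi> j = restrict_to (\<omega> j) ` polys 1) \<and>
        local_spaces 1 J \<omega> \<Psi> \<and>
        assumption_A (e / 16) h \<Omega> J \<omega> \<omega>s \<phi> \<and>
        assumption_B \<kappa> 1 C \<Omega> J \<omega> \<omega>s \<phi> \<and>
        assumption_C 1 K J \<omega> \<omega>s \<Psi> \<and>
        assumption_D 1 K J \<omega> \<Psi>)"
    using e(1) main by (intro exI[of _ e] conjI allI impI) simp_all
  moreover have "0 < e / 16" using e by simp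
  ultimately show ?thesis
    using K0 order_refl[of "1::nat"]
    by - (rule exI[of _ K], rule exI[of _ K], rule exI[of _ "e / 16"], rule exI[of _ C], rule exI[of _ \<kappa>], rule exI[of _ 1],
      (rule conjI, assumption)+, assumption)
qed

end
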